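(* Consider a branching random walk with a random environment in time, with the notation and standing assumption of the context. The sequences $\{(N_{\nu,n},\mathscr{D}_n)\}$ ($\nu=1,2,3$) are martingales. Moreover, the following assertions about their rates of convergence hold. (1) Suppose that for some $\lambda>1$ one has $\mathbb{E}\ln m_0>0$, $\mathbb{E}\big(\frac{1}{m_0}\widehat N_0(\ln^+\widehat N_0)^{1+\lambda}\big)<\infty$ and $\mathbb{E}(\ln^- m_0)^{1+\lambda}<\infty$, and that $\mathbb{E}(|\widehat L_0|^{\eta})<\infty$ for some $\eta>2$. Then there exists a real random variable $V_1$ such that a.s. $N_{1,n}-V_1=o(n^{-\lambda+1+\delta})$ for all $\delta>0$. (2) Suppose that for some $\lambda>2$ one has $\mathbb{E}\ln m_0>0$, $\mathbb{E}\big(\frac{1}{m_0}\widehat N_0(\ln^+\widehat N_0)^{1+\lambda}\big)<\infty$ and $\mathbb{E}(\ln^- m_0)^{1+\lambda}<\infty$, and that $\mathbb{E}(|\widehat L_0|^{\eta})<\infty$ for some $\eta>4$. Then there exists a real random variable $V_2$ such that a.s. $N_{2,n}-V_2=o(n^{-\lambda+2+\delta})$ for all $\delta>0$. (3) Suppose that for some $\lambda>3$ one has $\mathbb{E}\ln m_0>0$, $\mathbb{E}\big(\frac{1}{m_0}\widehat N_0(\ln^+\widehat N_0)^{1+\lambda}\big)<\infty$ and $\mathbb{E}(\ln^- m_0)^{1+\lambda}<\infty$, and that $\mathbb{E}(|\widehat L_0|^{\eta})<\infty$ for some $\eta>6$. Then there exists a real random variable $V_3$ such that a.s. $N_{3,n}-V_3=o(n^{-\lambda+3+\delta})$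 for all $\delta>0$.
   Context: Model. The environment $\xi=(\xi_0,\xi_1,\dots)$ is a sequence of i.i.d. random elements of a measurable space $\Theta$. Each realization of $\xi_n$ determines an offspring distribution $p(\xi_n)=(p_0(\xi_n),p_1(\xi_n),\dots)$ on $\{0,1,2,\dots\}$ and a moving (displacement) distribution $G(\xi_n)$ on $\mathbb{R}$; $p(\xi_n)$ and $G(\xi_n)$ are not assumed independent. Given $\xi$, under the quenched law $\mathbb{P}_\xi$ (expectation $\mathbb{E}_\xi$), the random variables $N_u$ and $L_{ui}$, indexed by all finite sequences $u$ of positive integers (including the empty sequence $\varnothing$) and $i\ge1$, are independent; $N_u$ has law $p(\xi_{|u|})$ and $L_{ui}$ has law $G(\xi_{|u|})$, where $|u|$ is the length of $u$. The annealed law $\mathbb{P}$ (expectation $\mathbb{E}$) is the law of (environment, process) obtained by averaging $\mathbb{P}_\xi$ over $\xi$; "a.s." refers to $\mathbb{P}$. The genealogical tree $\mathbb{T}$ is defined by: $\varnothing\in\mathbb{T}$; $ui\in\mathbb{T}$ implies $u\in\mathbb{T}$; and if $u\in\mathbb{T}$ then $ui\in\mathbb{T}$ iff $1\le i\le N_u$. $\mathbb{T}_n=\{u\in\mathbb{T}:|u|=n\}$ is the set of particles of generation $n$. Positions: $S_\varnothing=0$, $S_{ui}=S_u+L_{ui}$. Notation. $\widehat N_n=N_{1_n}$ and $\widehat L_n=L_{1_{n+1}}$, where $1_n$ is the sequence of $n$ ones ($1_0=\varnothing$); under $\mathbb{P}_\xi$ they have the laws $p(\xi_n)$ and $G(\xi_n)$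 respectively. $m_n=\mathbb{E}_\xi\widehat N_n$, $\Pi_0=1$, $\Pi_n=m_0\cdots m_{n-1}$; $l_n=\mathbb{E}_\xi\widehat L_n$, $\sigma_n^{(\nu)}=\mathbb{E}_\xi(\widehat L_n-l_n)^\nu$ for $\nu\ge2$; $\ell_n=\sum_{k=0}^{n-1}l_k$, $s_n^{(\nu)}=\sum_{k=0}^{n-1}\sigma_k^{(\nu)}$ for $\nu\ge 2$, $s_n=(s_n^{(2)})^{1/2}$. $\ln^+x=\max(\ln x,0)$, $\ln^-x=\max(-\ln x,0)$. Standing assumption throughout: $\mathbb{E}\ln m_0>0$ and $\mathbb{E}\big(\frac1{m_0}\widehat N_0(\ln^+\widehat N_0)^{1+\lambda}\big)<\infty$, where the value of $\lambda>0$ is specified in the hypotheses of each part. Sequences: $N_{1,n}=\frac1{\Pi_n}\sum_{u\in\mathbb{T}_n}(S_u-\ell_n)$, $N_{2,n}=\frac1{\Pi_n}\sum_{u\in\mathbb{T}_n}\big[(S_u-\ell_n)^2-s_n^2\big]$, $N_{3,n}=\frac1{\Pi_n}\sum_{u\in\mathbb{T}_n}\big[(S_u-\ell_n)^3-3(S_u-\ell_n)s_n^2-s_n^{(3)}\big]$. Filtration: $\mathscr{D}_0$ is the trivial $\sigma$-field, and $\mathscr{D}_n=\sigma(\xi,N_u,L_{ui}:i\ge1,|u|<n)$ for $n\ge1$.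
   Formalization: The martingale claim for N_{ν,n} is stated under the added condition E|L̂_0|^ν<∞ (ν=1,2,3), without which l_n and σ_n^{(ν)} may not exist or N_{ν,n} may fail to be integrable; this is weaker than the moment condition of each part. *)

theory Defs
  imports "HOL-Probability.Probability" "HOL-Library.Landau_Symbols"
begin

text \<open>The environment is i.i.d. with marginal law \<open>\<tau>\<close>, a probability measure on the measurable space
  \<open>\<Theta> = (space \<tau>, sets \<tau>)\<close>. The maps \<open>p\<close> and \<open>G\<close> assign to a point of \<open>\<Theta>\<close> its offspring law and its
  displacement law, both measurably.\<close>

definition random_environment ::
  "'e measure \<Rightarrow> ('e \<Rightarrow> nat pmf) \<Rightarrow> ('e \<Rightarrow> real measure) \<Rightarrow> bool" where
  "random_environment \<tau> p G \<longleftrightarrow>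
     prob_space \<tau> \<and>
     (\<forall>k. (\<lambda>x. pmf (p x) k) \<in> borel_measurable \<tau>) \<and>
     G \<in> \<tau> \<rightarrow>\<^sub>M prob_algebra borel"

definition env_law :: "'e measure \<Rightarrow> (nat \<Rightarrow> 'e) measure" where
  "env_law \<tau> = (\<Pi>\<^sub>M n\<in>UNIV. \<tau>)"

text \<open>Individuals are the finite sequences of positive integers; \<open>ui\<close> is \<open>u @ [i]\<close>.\<close>

definition seqs :: "nat list set" where
  "seqs = lists {1..}"

text \<open>A realization of the process consists of the families \<open>(N\<^sub>u)\<close>, indexed by all sequences,
  and \<open>(L\<^sub>u\<^sub>i)\<close>, indexed by the sequences \<open>ui\<close>, i.e. by the nonempty ones.\<close>

type_synonym process = "(nat list \<Rightarrow> nat) \<times> (nat list \<Rightarrow> real)"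

text \<open>The law of the process given the environment: all \<open>N\<^sub>u\<close> and \<open>L\<^sub>u\<^sub>i\<close> are independent, with laws
  \<open>p (\<xi> |u|)\<close> and \<open>G (\<xi> |u|)\<close>. For \<open>v = ui\<close> the parent \<open>u\<close> has length \<open>|v| - 1\<close>.\<close>

definition quenched_law ::
  "('e \<Rightarrow> nat pmf) \<Rightarrow> ('e \<Rightarrow> real measure) \<Rightarrow> (nat \<Rightarrow> 'e) \<Rightarrow> process measure" where
  "quenched_law p G \<xi> =
     (\<Pi>\<^sub>M u\<in>seqs. measure_pmf (p (\<xi> (length u)))) \<Otimes>\<^sub>M
     (\<Pi>\<^sub>M v\<in>seqs - {[]}. G (\<xi> (length v - 1)))"

text \<open>The average of \<open>\<delta>\<^sub>\<xi> \<otimes> P\<^sub>\<xi>\<close> over the law of the environment.\<close>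

definition annealed_law ::
  "'e measure \<Rightarrow> ('e \<Rightarrow> nat pmf) \<Rightarrow> ('e \<Rightarrow> real measure) \<Rightarrow> ((nat \<Rightarrow> 'e) \<times> process) measure" where
  "annealed_law \<tau> p G =
     env_law \<tau> \<bind> (\<lambda>\<xi>. return (env_law \<tau>) \<xi> \<Otimes>\<^sub>M quenched_law p G \<xi>)"

abbreviation env :: "(nat \<Rightarrow> 'e) \<times> process \<Rightarrow> nat \<Rightarrow> 'e" where
  "env \<omega> \<equiv> fst \<omega>"

abbreviation offspring :: "process \<Rightarrow> nat list \<Rightarrow> nat" where
  "offspring w \<equiv> fst w"

abbreviation displ :: "process \<Rightarrow> nat list \<Rightarrow> real" where
  "displ w \<equiv> snd w"

inductive_set tree :: "process \<Rightarrow> nat list set" for w :: process where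
  root: "[] \<in> tree w"
| child: "u \<in> tree w \<Longrightarrow> 1 \<le> i \<Longrightarrow> i \<le> offspring w u \<Longrightarrow> u @ [i] \<in> tree w"

definition generation :: "process \<Rightarrow> nat \<Rightarrow> nat list set" where
  "generation w n = {u \<in> tree w. length u = n}"

definition position :: "process \<Rightarrow> nat list \<Rightarrow> real" where
  "position w u = (\<Sum>k<length u. displ w (take (Suc k) u))"

lemma position_Nil: "position w [] = 0"
  by (simp add: position_def)

lemma position_snoc: "position w (u @ [i]) = position w u + displ w (u @ [i])"
  by (simp add: position_def)

lemma tree_snoc_iff: "u @ [i] \<in> tree w \<longleftrightarrow> u \<in> tree w \<and> 1 \<le> i \<and> i \<le> offspring w u"
  by (auto intro: tree.child elim: tree.cases)

definition N_hat :: "nat \<Rightarrow> process \<Rightarrow> real" where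
  "N_hat n w = real (offspring w (replicate n 1))"

definition L_hat :: "nat \<Rightarrow> process \<Rightarrow> real" where
  "L_hat n w = displ w (replicate (n + 1) 1)"

definition mean_offspring ::
  "('e \<Rightarrow> nat pmf) \<Rightarrow> ('e \<Rightarrow> real measure) \<Rightarrow> nat \<Rightarrow> (nat \<Rightarrow> 'e) \<Rightarrow> real" where
  "mean_offspring p G n \<xi> = (\<integral>w. N_hat n w \<partial>quenched_law p G \<xi>)"

definition Pi_norm ::
  "('e \<Rightarrow> nat pmf) \<Rightarrow> ('e \<Rightarrow> real measure) \<Rightarrow> nat \<Rightarrow> (nat \<Rightarrow> 'e) \<Rightarrow> real" where
  "Pi_norm p G n \<xi> = (\<Prod>k<n. mean_offspring p G k \<xi>)"

definition mean_displ ::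
  "('e \<Rightarrow> nat pmf) \<Rightarrow> ('e \<Rightarrow> real measure) \<Rightarrow> nat \<Rightarrow> (nat \<Rightarrow> 'e) \<Rightarrow> real" where
  "mean_displ p G n \<xi> = (\<integral>w. L_hat n w \<partial>quenched_law p G \<xi>)"

definition central_moment ::
  "('e \<Rightarrow> nat pmf) \<Rightarrow> ('e \<Rightarrow> real measure) \<Rightarrow> nat \<Rightarrow> nat \<Rightarrow> (nat \<Rightarrow> 'e) \<Rightarrow> real" where
  "central_moment p G \<nu> n \<xi> =
     (\<integral>w. (L_hat n w - mean_displ p G n \<xi>) ^ \<nu> \<partial>quenched_law p G \<xi>)"

definition ell ::
  "('e \<Rightarrow> nat pmf) \<Rightarrow> ('e \<Rightarrow> real measure) \<Rightarrow> nat \<Rightarrow> (nat \<Rightarrow> 'e) \<Rightarrow> real" where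
  "ell p G n \<xi> = (\<Sum>k<n. mean_displ p G k \<xi>)"

definition s_mom ::
  "('e \<Rightarrow> nat pmf) \<Rightarrow> ('e \<Rightarrow> real measure) \<Rightarrow> nat \<Rightarrow> nat \<Rightarrow> (nat \<Rightarrow> 'e) \<Rightarrow> real" where
  "s_mom p G \<nu> n \<xi> = (\<Sum>k<n. central_moment p G \<nu> k \<xi>)"

definition s_dev ::
  "('e \<Rightarrow> nat pmf) \<Rightarrow> ('e \<Rightarrow> real measure) \<Rightarrow> nat \<Rightarrow> (nat \<Rightarrow> 'e) \<Rightarrow> real" where
  "s_dev p G n \<xi> = sqrt (s_mom p G 2 n \<xi>)"

definition N1 ::
  "('e \<Rightarrow> nat pmf) \<Rightarrow> ('e \<Rightarrow> real measure) \<Rightarrow> nat \<Rightarrow> (nat \<Rightarrow> 'e) \<times> process \<Rightarrow> real" where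
  "N1 p G n = (\<lambda>(\<xi>, w). 1 / Pi_norm p G n \<xi> *
     (\<Sum>u\<in>generation w n. position w u - ell p G n \<xi>))"

definition N2 ::
  "('e \<Rightarrow> nat pmf) \<Rightarrow> ('e \<Rightarrow> real measure) \<Rightarrow> nat \<Rightarrow> (nat \<Rightarrow> 'e) \<times> process \<Rightarrow> real" where
  "N2 p G n = (\<lambda>(\<xi>, w). 1 / Pi_norm p G n \<xi> *
     (\<Sum>u\<in>generation w n. (position w u - ell p G n \<xi>)\<^sup>2 - (s_dev p G n \<xi>)\<^sup>2))"

definition N3 ::
  "('e \<Rightarrow> nat pmf) \<Rightarrow> ('e \<Rightarrow> real measure) \<Rightarrow> nat \<Rightarrow> (nat \<Rightarrow> 'e) \<times> process \<Rightarrow> real" where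
  "N3 p G n = (\<lambda>(\<xi>, w). 1 / Pi_norm p G n \<xi> *
     (\<Sum>u\<in>generation w n. (position w u - ell p G n \<xi>) ^ 3
        - 3 * (position w u - ell p G n \<xi>) * (s_dev p G n \<xi>)\<^sup>2 - s_mom p G 3 n \<xi>))"

definition filtr ::
  "'e measure \<Rightarrow> ('e \<Rightarrow> nat pmf) \<Rightarrow> ('e \<Rightarrow> real measure) \<Rightarrow> nat \<Rightarrow> ((nat \<Rightarrow> 'e) \<times> process) measure" where
  "filtr \<tau> p G n = (let \<Omega> = space (annealed_law \<tau> p G) in
     sigma \<Omega> (if n = 0 then {} else
         {env -` A \<inter> \<Omega> | A. A \<in> sets (env_law \<tau>)}
       \<union> {(\<lambda>\<omega>. offspring (snd \<omega>) u) -` A \<inter> \<Omega> | u A. u \<in> seqs \<and> length u < n}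
       \<union> {(\<lambda>\<omega>. displ (snd \<omega>) (u @ [i])) -` A \<inter> \<Omega> | u i A.
            u \<in> seqs \<and> length u < n \<and> 1 \<le> i \<and> A \<in> sets borel}))"

definition martingale ::
  "'a measure \<Rightarrow> (nat \<Rightarrow> 'a measure) \<Rightarrow> (nat \<Rightarrow> 'a \<Rightarrow> real) \<Rightarrow> bool" where
  "martingale M F X \<longleftrightarrow>
     (\<forall>n. subalgebra M (F n)) \<and> (\<forall>n. sets (F n) \<subseteq> sets (F (Suc n))) \<and>
     (\<forall>n. X n \<in> borel_measurable (F n)) \<and> (\<forall>n. integrable M (X n)) \<and>
     (\<forall>n. AE \<omega> in M. real_cond_exp M (F n) (X (Suc n)) \<omega> = X n \<omega>)"

definition ln_plus :: "real \<Rightarrow> real" where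
  "ln_plus x = max (ln x) 0"

definition ln_minus :: "real \<Rightarrow> real" where
  "ln_minus x = max (- ln x) 0"

text \<open>\<open>E ln m\<^sub>0 > 0\<close>. Since \<open>ln 0 = 0\<close> and non-integrable functions have integral \<open>0\<close> here, the
  requirement \<open>0 < m\<^sub>0 < \<infinity>\<close> a.s., without which \<open>ln m\<^sub>0\<close> is not real-valued, is
  stated separately, as is integrability of \<open>ln m\<^sub>0\<close>. The latter excludes only \<open>E ln m\<^sub>0 = \<infinity>\<close>,
  which is impossible under \<open>offspring_moment\<close>: Jensen's inequality for
  the convex map \<open>x (ln\<^sup>+ x)^(1 + lam)\<close> gives \<open>E (ln\<^sup>+ m\<^sub>0)^(1 + lam) < \<infinity>\<close>.\<close>

definition supercritical ::
  "'e measure \<Rightarrow> ('e \<Rightarrow> nat pmf) \<Rightarrow> ('e \<Rightarrow> real measure) \<Rightarrow> bool" where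
  "supercritical \<tau> p G \<longleftrightarrow>
     (AE \<omega> in annealed_law \<tau> p G.
        integrable (quenched_law p G (env \<omega>)) (N_hat 0) \<and> 0 < mean_offspring p G 0 (env \<omega>)) \<and>
     integrable (annealed_law \<tau> p G) (\<lambda>\<omega>. ln (mean_offspring p G 0 (env \<omega>))) \<and>
     0 < (\<integral>\<omega>. ln (mean_offspring p G 0 (env \<omega>)) \<partial>annealed_law \<tau> p G)"

definition offspring_moment ::
  "'e measure \<Rightarrow> ('e \<Rightarrow> nat pmf) \<Rightarrow> ('e \<Rightarrow> real measure) \<Rightarrow> real \<Rightarrow> bool" where
  "offspring_moment \<tau> p G lam \<longleftrightarrow>
     integrable (annealed_law \<tau> p G)
       (\<lambda>\<omega>. 1 / mean_offspring p G 0 (env \<omega>) * N_hat 0 (snd \<omega>)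
            * ln_plus (N_hat 0 (snd \<omega>)) powr (1 + lam))"

definition ln_minus_moment ::
  "'e measure \<Rightarrow> ('e \<Rightarrow> nat pmf) \<Rightarrow> ('e \<Rightarrow> real measure) \<Rightarrow> real \<Rightarrow> bool" where
  "ln_minus_moment \<tau> p G lam \<longleftrightarrow>
     integrable (annealed_law \<tau> p G)
       (\<lambda>\<omega>. ln_minus (mean_offspring p G 0 (env \<omega>)) powr (1 + lam))"

definition displ_moment ::
  "'e measure \<Rightarrow> ('e \<Rightarrow> nat pmf) \<Rightarrow> ('e \<Rightarrow> real measure) \<Rightarrow> real \<Rightarrow> bool" where
  "displ_moment \<tau> p G \<eta> \<longleftrightarrow>
     integrable (annealed_law \<tau> p G) (\<lambda>\<omega>. \<bar>L_hat 0 (snd \<omega>)\<bar> powr \<eta>)"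

end

theory Submission
  imports Defs "HOL-Real_Asymp.Real_Asymp"
begin

text \<open>Write \<open>P\<^sub>n\<close> for the polynomial summed in \<open>N\<^sub>\<nu>\<close>, so that
  averaging \<open>P\<^sub>n\<^sub>+\<^sub>1\<close> over one centred displacement gives \<open>P\<^sub>n\<close>. For a fixed environment all
  coordinates of the process are independent, and the martingale property follows by integrating
  out first the displacement and then the offspring number of each particle of generation \<open>n\<close>.

  For the rate, the children of \<open>u\<close> are discarded when \<open>N\<^sub>u / m\<^sub>n > exp (\<gamma> n)\<close>.
  The retained part of the increment \<open>N\<^sub>\<nu>\<^sub>,\<^sub>n\<^sub>+\<^sub>1 - N\<^sub>\<nu>\<^sub>,\<^sub>n\<close>, suitably centred,
  is a sum of uncorrelated terms; its quenched second moment is at most a power of \<open>n\<close> times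
  \<open>exp (\<gamma> n) / \<Pi>\<^sub>n\<close>, which is exponentially small because \<open>\<Pi>\<^sub>n \<ge> \<kappa> exp (2 \<gamma> n)\<close>
  almost surely. The discarded part has quenched first moment at most \<open>q\<^sub>n n powr (\<nu> + \<epsilon>)\<close> up to
  constants, where \<open>q\<^sub>n\<close> is the size-biased tail of \<open>N / m\<close> beyond \<open>exp (\<gamma> n)\<close>, and the logarithmic
  moments make \<open>\<Sum> n powr lam * q\<^sub>n\<close> finite. Hence the increments are absolutely summable
  against the weight \<open>n powr (lam - \<nu> - \<epsilon>)\<close>, which gives both convergence and rate.\<close>

section \<open>Resampling one coordinate of a product measure\<close>

text \<open>Generations are random finite sets without a deterministic bound, so sums over them
  cannot be exchanged with integrals directly. Estimates are made for labels at most
  \<open>K\<close>, with constants independent of \<open>K\<close>, and passed to the limit by Fatou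
  or dominated convergence. The truncation disturbs centring: the truncated sums are martingales
  only up to a factor tending to 1, and the centring constant \<alpha> has to be adapted to
  \<open>K\<close>. Cutting at N_u / m_n rather than at N_u is dictated by the variance, in which
  the cutoff appears divided by m_n, while m_n can be arbitrarily small. The exponent \<nu> in the
  rate is the price of the growth bound n^\<nu> for the first absolute moment of the polynomial,
  obtained by convexity without cancellation. The positive \<delta> pays for summable weights
  n^(-1-\<epsilon>) in place of a law of large numbers for the displacement moments.\<close>

lemma measure_eqI_nn_integral:
  assumes "sets M = sets N" "\<And>f :: _ \<Rightarrow> ennreal. f \<in> borel_measurable M \<Longrightarrow> (\<integral>\<^sup>+x. f x \<partial>M) = (\<integral>\<^sup>+x. f x \<partial>N)"
  shows "M = N"
proof (rule measure_eqI[OF assms(1)])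
  fix A assume A: "A \<in> sets M"
  then have "(\<integral>\<^sup>+x. indicator A x \<partial>M) = (\<integral>\<^sup>+x. indicator A x \<partial>N)"
    by (intro assms(2)) auto
  with A assms(1) show "emeasure M A = emeasure N A" by simp
qed

text \<open>Fubini puts the coordinate in \<open>B\<close> outermost, so that for each fixed value
  of it the hypothesis on \<open>A\<close> can be applied inside.\<close>

lemma distr_resample_fst:
  assumes "prob_space D" "prob_space A" "prob_space B"
    and f[measurable]: "f \<in> D \<Otimes>\<^sub>M A \<rightarrow>\<^sub>M A" and eq: "distr (D \<Otimes>\<^sub>M A) A f = A"
  shows "distr (D \<Otimes>\<^sub>M (A \<Otimes>\<^sub>M B)) (A \<Otimes>\<^sub>M B) (\<lambda>(k, w). (f (k, fst w), snd w)) = A \<Otimes>\<^sub>M B"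
proof (rule measure_eqI_nn_integral)
  interpret D: prob_space D by fact
  interpret A: prob_space A by fact
  interpret B: prob_space B by fact
  interpret AB': prob_space "A \<Otimes>\<^sub>M B" by (intro prob_space_pair) unfold_locales
  interpret AB: pair_sigma_finite A B ..
  interpret DB: pair_sigma_finite D B ..
  interpret DA: pair_sigma_finite D A ..
  show "sets (distr (D \<Otimes>\<^sub>M (A \<Otimes>\<^sub>M B)) (A \<Otimes>\<^sub>M B) (\<lambda>(k, w). (f (k, fst w), snd w))) = sets (A \<Otimes>\<^sub>M B)"
    by simp
  fix g :: "_ \<Rightarrow> ennreal" assume "g \<in> borel_measurable (distr (D \<Otimes>\<^sub>M (A \<Otimes>\<^sub>M B)) (A \<Otimes>\<^sub>M B) (\<lambda>(k, w). (f (k, fst w), snd w)))"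
  then have g[measurable]: "g \<in> borel_measurable (A \<Otimes>\<^sub>M B)" by simp
  have "(\<integral>\<^sup>+x. g x \<partial>(distr (D \<Otimes>\<^sub>M (A \<Otimes>\<^sub>M B)) (A \<Otimes>\<^sub>M B) (\<lambda>(k, w). (f (k, fst w), snd w))))
      = (\<integral>\<^sup>+x. g (f (fst x, fst (snd x)), snd (snd x)) \<partial>(D \<Otimes>\<^sub>M (A \<Otimes>\<^sub>M B)))"
    by (subst nn_integral_distr) (auto simp: case_prod_beta)
  also have "\<dots> = (\<integral>\<^sup>+k. \<integral>\<^sup>+w. g (f (k, fst w), snd w) \<partial>(A \<Otimes>\<^sub>M B) \<partial>D)"
    by (subst AB'.nn_integral_fst[symmetric]) auto
  also have "\<dots> = (\<integral>\<^sup>+k. \<integral>\<^sup>+b. \<integral>\<^sup>+a. g (f (k, a), b) \<partial>A \<partial>B \<partial>D)"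
  proof (rule nn_integral_cong)
    fix k assume [measurable]: "k \<in> space D"
    show "(\<integral>\<^sup>+w. g (f (k, fst w), snd w) \<partial>(A \<Otimes>\<^sub>M B)) = (\<integral>\<^sup>+b. \<integral>\<^sup>+a. g (f (k, a), b) \<partial>A \<partial>B)"
      by (subst AB.nn_integral_snd[symmetric]) auto
  qed
  also have "\<dots> = (\<integral>\<^sup>+b. \<integral>\<^sup>+k. \<integral>\<^sup>+a. g (f (k, a), b) \<partial>A \<partial>D \<partial>B)"
    by (rule DB.Fubini'[symmetric]) measurable
  also have "\<dots> = (\<integral>\<^sup>+b. \<integral>\<^sup>+a. g (a, b) \<partial>A \<partial>B)"
  proof (rule nn_integral_cong)
    fix b assume [measurable]: "b \<in> space B"
    have "(\<integral>\<^sup>+k. \<integral>\<^sup>+a. g (f (k, a), b) \<partial>A \<partial>D) = (\<integral>\<^sup>+x. g (f x, b) \<partial>(D \<Otimes>\<^sub>M A))"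
      by (subst A.nn_integral_fst[symmetric]) auto
    also have "\<dots> = (\<integral>\<^sup>+a. g (a, b) \<partial>(distr (D \<Otimes>\<^sub>M A) A f))"
      by (subst nn_integral_distr) auto
    finally show "(\<integral>\<^sup>+k. \<integral>\<^sup>+a. g (f (k, a), b) \<partial>A \<partial>D) = (\<integral>\<^sup>+a. g (a, b) \<partial>A)"
      unfolding eq .
  qed
  also have "\<dots> = (\<integral>\<^sup>+x. g x \<partial>(A \<Otimes>\<^sub>M B))"
    by (rule AB.nn_integral_snd) measurable
  finally show "(\<integral>\<^sup>+x. g x \<partial>(distr (D \<Otimes>\<^sub>M (A \<Otimes>\<^sub>M B)) (A \<Otimes>\<^sub>M B) (\<lambda>(k, w). (f (k, fst w), snd w))))
     = (\<integral>\<^sup>+x. g x \<partial>(A \<Otimes>\<^sub>M B))" .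
qed

lemma distr_resample_snd:
  assumes "prob_space D" "prob_space A" "prob_space B"
    and f[measurable]: "f \<in> D \<Otimes>\<^sub>M B \<rightarrow>\<^sub>M B" and eq: "distr (D \<Otimes>\<^sub>M B) B f = B"
  shows "distr (D \<Otimes>\<^sub>M (A \<Otimes>\<^sub>M B)) (A \<Otimes>\<^sub>M B) (\<lambda>(k, w). (fst w, f (k, snd w))) = A \<Otimes>\<^sub>M B"
proof (rule measure_eqI_nn_integral)
  interpret D: prob_space D by fact
  interpret A: prob_space A by fact
  interpret B: prob_space B by fact
  interpret AB': prob_space "A \<Otimes>\<^sub>M B" by (intro prob_space_pair) unfold_locales
  interpret AB: pair_sigma_finite A B ..
  interpret DB: pair_sigma_finite D B ..
  interpret DA: pair_sigma_finite D A ..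
  show "sets (distr (D \<Otimes>\<^sub>M (A \<Otimes>\<^sub>M B)) (A \<Otimes>\<^sub>M B) (\<lambda>(k, w). (fst w, f (k, snd w)))) = sets (A \<Otimes>\<^sub>M B)"
    by simp
  fix g :: "_ \<Rightarrow> ennreal" assume "g \<in> borel_measurable (distr (D \<Otimes>\<^sub>M (A \<Otimes>\<^sub>M B)) (A \<Otimes>\<^sub>M B) (\<lambda>(k, w). (fst w, f (k, snd w))))"
  then have g[measurable]: "g \<in> borel_measurable (A \<Otimes>\<^sub>M B)" by simp
  have "(\<integral>\<^sup>+x. g x \<partial>(distr (D \<Otimes>\<^sub>M (A \<Otimes>\<^sub>M B)) (A \<Otimes>\<^sub>M B) (\<lambda>(k, w). (fst w, f (k, snd w)))))
      = (\<integral>\<^sup>+x. g (fst (snd x), f (fst x, snd (snd x))) \<partial>(D \<Otimes>\<^sub>M (A \<Otimes>\<^sub>M B)))"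
    by (subst nn_integral_distr) (auto simp: case_prod_beta)
  also have "\<dots> = (\<integral>\<^sup>+k. \<integral>\<^sup>+w. g (fst w, f (k, snd w)) \<partial>(A \<Otimes>\<^sub>M B) \<partial>D)"
    by (subst AB'.nn_integral_fst[symmetric]) auto
  also have "\<dots> = (\<integral>\<^sup>+k. \<integral>\<^sup>+a. \<integral>\<^sup>+b. g (a, f (k, b)) \<partial>B \<partial>A \<partial>D)"
  proof (rule nn_integral_cong)
    fix k assume [measurable]: "k \<in> space D"
    show "(\<integral>\<^sup>+w. g (fst w, f (k, snd w)) \<partial>(A \<Otimes>\<^sub>M B)) = (\<integral>\<^sup>+a. \<integral>\<^sup>+b. g (a, f (k, b)) \<partial>B \<partial>A)"
      by (subst B.nn_integral_fst[symmetric]) auto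
  qed
  also have "\<dots> = (\<integral>\<^sup>+a. \<integral>\<^sup>+k. \<integral>\<^sup>+b. g (a, f (k, b)) \<partial>B \<partial>D \<partial>A)"
    by (rule DA.Fubini'[symmetric]) measurable
  also have "\<dots> = (\<integral>\<^sup>+a. \<integral>\<^sup>+b. g (a, b) \<partial>B \<partial>A)"
  proof (rule nn_integral_cong)
    fix a assume [measurable]: "a \<in> space A"
    have "(\<integral>\<^sup>+k. \<integral>\<^sup>+b. g (a, f (k, b)) \<partial>B \<partial>D) = (\<integral>\<^sup>+x. g (a, f x) \<partial>(D \<Otimes>\<^sub>M B))"
      by (subst B.nn_integral_fst[symmetric]) auto
    also have "\<dots> = (\<integral>\<^sup>+b. g (a, b) \<partial>(distr (D \<Otimes>\<^sub>M B) B f))"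
      by (subst nn_integral_distr) auto
    finally show "(\<integral>\<^sup>+k. \<integral>\<^sup>+b. g (a, f (k, b)) \<partial>B \<partial>D) = (\<integral>\<^sup>+b. g (a, b) \<partial>B)"
      unfolding eq .
  qed
  also have "\<dots> = (\<integral>\<^sup>+x. g x \<partial>(A \<Otimes>\<^sub>M B))"
    by (rule B.nn_integral_fst) measurable
  finally show "(\<integral>\<^sup>+x. g x \<partial>(distr (D \<Otimes>\<^sub>M (A \<Otimes>\<^sub>M B)) (A \<Otimes>\<^sub>M B) (\<lambda>(k, w). (fst w, f (k, snd w)))))
     = (\<integral>\<^sup>+x. g x \<partial>(A \<Otimes>\<^sub>M B))" .
qed

text \<open>\<open>U (k, w)\<close> is \<open>w\<close> with the coordinate \<open>X\<close> replaced by \<open>k\<close>.\<close>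

locale resampling = M: prob_space M + D: prob_space D
  for M :: "'a measure" and D :: "'b measure" +
  fixes U :: "'b \<times> 'a \<Rightarrow> 'a" and X :: "'a \<Rightarrow> 'b"
  assumes U[measurable]: "U \<in> D \<Otimes>\<^sub>M M \<rightarrow>\<^sub>M M" and X[measurable]: "X \<in> M \<rightarrow>\<^sub>M D"
    and distr_U: "distr (D \<Otimes>\<^sub>M M) M U = M"
    and X_U: "\<And>k w. k \<in> space D \<Longrightarrow> w \<in> space M \<Longrightarrow> X (U (k, w)) = k"
begin

sublocale DM: pair_sigma_finite D M ..

text \<open>This is conditioning on all coordinates except \<open>X\<close>: by
  \<open>distr_U\<close> the integral may be taken at \<open>U (k, w)\<close>, where
  \<open>X\<close> equals the fresh \<open>k\<close> while \<open>F\<close> does not notice the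
  replacement.\<close>

lemma nn_integral_resample:
  assumes F[measurable]: "(\<lambda>(w, k). F w k) \<in> borel_measurable (M \<Otimes>\<^sub>M D)"
    and inv: "\<And>k k' w. k \<in> space D \<Longrightarrow> w \<in> space M \<Longrightarrow> F (U (k, w)) k' = F w k'"
  shows "(\<integral>\<^sup>+w. F w (X w) \<partial>M) = (\<integral>\<^sup>+w. \<integral>\<^sup>+k. F w k \<partial>D \<partial>M)"
proof -
  have [measurable]: "(\<lambda>w. F w (X w)) \<in> borel_measurable M"
    using measurable_compose[OF measurable_Pair[OF measurable_ident X] F] by simp
  have [measurable]: "(\<lambda>z. F (snd z) (fst z)) \<in> borel_measurable (D \<Otimes>\<^sub>M M)"
    using measurable_compose[OF measurable_Pair[OF measurable_snd measurable_fst] F] by simp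
  have "(\<integral>\<^sup>+w. F w (X w) \<partial>M) = (\<integral>\<^sup>+w. F w (X w) \<partial>distr (D \<Otimes>\<^sub>M M) M U)"
    by (simp add: distr_U)
  also have "\<dots> = (\<integral>\<^sup>+z. F (U z) (X (U z)) \<partial>(D \<Otimes>\<^sub>M M))"
    by (subst nn_integral_distr) auto
  also have "\<dots> = (\<integral>\<^sup>+z. F (snd z) (fst z) \<partial>(D \<Otimes>\<^sub>M M))"
    by (intro nn_integral_cong) (auto simp: space_pair_measure X_U inv)
  also have "\<dots> = (\<integral>\<^sup>+w. \<integral>\<^sup>+k. F w k \<partial>D \<partial>M)"
    by (subst DM.nn_integral_snd[symmetric]) auto
  finally show ?thesis .
qed

lemma
  fixes F :: "'a \<Rightarrow> 'b \<Rightarrow> real"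
  assumes F[measurable]: "(\<lambda>(w, k). F w k) \<in> borel_measurable (M \<Otimes>\<^sub>M D)"
    and inv: "\<And>k k' w. k \<in> space D \<Longrightarrow> w \<in> space M \<Longrightarrow> F (U (k, w)) k' = F w k'"
    and int: "integrable M (\<lambda>w. F w (X w))"
  shows integrable_resample: "integrable M (\<lambda>w. \<integral>k. F w k \<partial>D)"
    and integral_resample: "(\<integral>w. F w (X w) \<partial>M) = (\<integral>w. \<integral>k. F w k \<partial>D \<partial>M)"
proof -
  have [measurable]: "(\<lambda>w. F w (X w)) \<in> borel_measurable M"
    using measurable_compose[OF measurable_Pair[OF measurable_ident X] F] by simp
  have [measurable]: "(\<lambda>z. F (snd z) (fst z)) \<in> borel_measurable (D \<Otimes>\<^sub>M M)"
    using measurable_compose[OF measurable_Pair[OF measurable_snd measurable_fst] F] by simp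
  have int': "integrable (D \<Otimes>\<^sub>M M) (\<lambda>(k, w). F w k)"
  proof -
    have "integrable (distr (D \<Otimes>\<^sub>M M) M U) (\<lambda>w. F w (X w))"
      using int by (simp add: distr_U)
    then have "integrable (D \<Otimes>\<^sub>M M) (\<lambda>z. F (U z) (X (U z)))"
      by (subst (asm) integrable_distr_eq) auto
    then show ?thesis
      by (rule Bochner_Integration.integrable_cong[THEN iffD1, OF refl, rotated])
         (auto simp: space_pair_measure X_U inv)
  qed
  show "integrable M (\<lambda>w. \<integral>k. F w k \<partial>D)"
    using DM.integrable_snd[OF int'] .
  have "(\<integral>w. F w (X w) \<partial>M) = (\<integral>w. F w (X w) \<partial>distr (D \<Otimes>\<^sub>M M) M U)"
    by (simp add: distr_U)
  also have "\<dots> = (\<integral>z. F (U z) (X (U z)) \<partial>(D \<Otimes>\<^sub>M M))"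
    by (subst integral_distr) auto
  also have "\<dots> = (\<integral>(k, w). F w k \<partial>(D \<Otimes>\<^sub>M M))"
    by (intro Bochner_Integration.integral_cong) (auto simp: space_pair_measure X_U inv)
  also have "\<dots> = (\<integral>w. \<integral>k. F w k \<partial>D \<partial>M)"
    using DM.integral_snd[OF int'] by simp
  finally show "(\<integral>w. F w (X w) \<partial>M) = (\<integral>w. \<integral>k. F w k \<partial>D \<partial>M)" .
qed

lemma integral_resample_mult:
  fixes Z :: "'a \<Rightarrow> real" and h :: "'b \<Rightarrow> real"
  assumes Z: "integrable M Z" and inv: "\<And>k w. k \<in> space D \<Longrightarrow> w \<in> space M \<Longrightarrow> Z (U (k, w)) = Z w"
    and h[measurable]: "h \<in> borel_measurable D" and b: "\<And>k. \<bar>h k\<bar> \<le> 1"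
  shows "integrable M (\<lambda>w. Z w * h (X w))"
    and "(\<integral>w. Z w * h (X w) \<partial>M) = (\<integral>w. Z w \<partial>M) * (\<integral>k. h k \<partial>D)"
proof -
  have [measurable]: "Z \<in> borel_measurable M" using Z by auto
  show int: "integrable M (\<lambda>w. Z w * h (X w))"
    by (rule Bochner_Integration.integrable_bound[OF Z])
       (use b in \<open>auto simp: abs_mult intro!: mult_left_le\<close>)
  have "(\<integral>w. Z w * h (X w) \<partial>M) = (\<integral>w. \<integral>k. Z w * h k \<partial>D \<partial>M)"
    by (rule integral_resample[where F="\<lambda>w k. Z w * h k"]) (use inv int in auto)
  then show "(\<integral>w. Z w * h (X w) \<partial>M) = (\<integral>w. Z w \<partial>M) * (\<integral>k. h k \<partial>D)"
    by simp
qed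

lemma distr_coordinate: "distr M D X = D"
proof (rule measure_eqI_nn_integral)
  fix f :: "_ \<Rightarrow> ennreal" assume "f \<in> borel_measurable (distr M D X)"
  then have [measurable]: "f \<in> borel_measurable D" by simp
  show "(\<integral>\<^sup>+x. f x \<partial>distr M D X) = (\<integral>\<^sup>+x. f x \<partial>D)"
    using nn_integral_resample[of "\<lambda>w k. f k"] by (simp add: nn_integral_distr M.emeasure_space_1)
qed simp

lemma nn_integral_coordinate:
  assumes "h \<in> borel_measurable D"
  shows "(\<integral>\<^sup>+w. h (X w) \<partial>M) = (\<integral>\<^sup>+k. h k \<partial>D)"
  using nn_integral_distr[of X M D h] assms by (simp add: distr_coordinate)

lemma integral_coordinate:
  fixes h :: "'b \<Rightarrow> real"
  assumes [measurable]: "h \<in> borel_measurable D"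
  shows "(\<integral>w. h (X w) \<partial>M) = (\<integral>k. h k \<partial>D)" "integrable M (\<lambda>w. h (X w)) \<longleftrightarrow> integrable D h"
  using integral_distr[of X M D h] integrable_distr_eq[of X M D h] by (auto simp: distr_coordinate)

end

section \<open>Labels of individuals and finite truncations of a generation\<close>

lemma seqs_snoc [simp]: "u @ [i] \<in> seqs \<longleftrightarrow> u \<in> seqs \<and> 1 \<le> i"
  by (auto simp: seqs_def)

lemma seqs_Nil [simp]: "[] \<in> seqs"
  by (simp add: seqs_def)

lemma seqs_take: "u \<in> seqs \<Longrightarrow> take k u \<in> seqs"
  by (auto simp: seqs_def dest: in_set_takeD)

lemma seqs_replicate [simp]: "replicate n (Suc 0) \<in> seqs"
  by (auto simp: seqs_def)

text \<open>Sums over generation \<open>n\<close> are approximated by sums over this fixed finite set,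
  with \<open>K\<close> tending to infinity.\<close>

definition trunc_seqs :: "nat \<Rightarrow> nat \<Rightarrow> nat list set" where
  "trunc_seqs K n = {u. set u \<subseteq> {1..K} \<and> length u = n}"

lemma finite_trunc_seqs [simp]: "finite (trunc_seqs K n)"
  unfolding trunc_seqs_def by (rule finite_lists_length_eq) simp

lemma trunc_seqsD: "u \<in> trunc_seqs K n \<Longrightarrow> u \<in> seqs" "u \<in> trunc_seqs K n \<Longrightarrow> length u = n"
  by (auto simp: trunc_seqs_def seqs_def)

lemma trunc_seqs_0: "trunc_seqs K 0 = {[]}"
  by (auto simp: trunc_seqs_def)

lemma trunc_seqs_Suc: "trunc_seqs K (Suc n) = (\<lambda>(u, i). u @ [i]) ` (trunc_seqs K n \<times> {1..K})"
proof (intro equalityI subsetI)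
  fix v assume v: "v \<in> trunc_seqs K (Suc n)"
  then have "v \<noteq> []" by (auto simp: trunc_seqs_def)
  then obtain u i where "v = u @ [i]" by (metis append_butlast_last_id)
  with v show "v \<in> (\<lambda>(u, i). u @ [i]) ` (trunc_seqs K n \<times> {1..K})"
    by (auto simp: trunc_seqs_def)
qed (auto simp: trunc_seqs_def)

lemma sum_trunc_seqs_Suc:
  "(\<Sum>v\<in>trunc_seqs K (Suc n). f v) = (\<Sum>u\<in>trunc_seqs K n. \<Sum>i=1..K. f (u @ [i]))"
proof -
  have "inj_on (\<lambda>(u, i). u @ [i]) (trunc_seqs K n \<times> {1..K})" by (auto simp: inj_on_def)
  then show ?thesis
    by (simp only: trunc_seqs_Suc sum.reindex sum.cartesian_product) (simp add: case_prod_beta)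
qed

text \<open>No bound on the labels is uniform in \<open>w\<close>, so \<open>K0\<close> depends on
  the realization and the limit in \<open>K\<close> is a pointwise one.\<close>

lemma generation_subset_trunc_seqs: "\<exists>K0. \<forall>K\<ge>K0. generation w n \<subseteq> trunc_seqs K n"
proof (induction n)
  case 0
  then show ?case by (auto simp: generation_def trunc_seqs_def)
next
  case (Suc n)
  then obtain K0 where K0: "\<And>K. K \<ge> K0 \<Longrightarrow> generation w n \<subseteq> trunc_seqs K n" by auto
  have fin: "finite (generation w n)" using K0[OF order_refl] finite_trunc_seqs by (rule finite_subset)
  \<comment> \<open>\<open>K0\<close> dominates the labels inside generation \<open>n\<close>, the
    second entry the last label of any child; \<open>insert 0\<close> keeps \<open>Max\<close>
    meaningful for an extinct generation.\<close>
  let ?K = "max K0 (Max (insert 0 (offspring w ` generation w n)))"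
  have "generation w (Suc n) \<subseteq> trunc_seqs K (Suc n)" if K: "K \<ge> ?K" for K
  proof
    fix v assume v: "v \<in> generation w (Suc n)"
    then have "v \<noteq> []" by (auto simp: generation_def)
    then obtain u i where ui: "v = u @ [i]" by (metis append_butlast_last_id)
    with v have u: "u \<in> generation w n" "1 \<le> i" "i \<le> offspring w u"
      by (auto simp: generation_def tree_snoc_iff)
    have "offspring w u \<le> Max (insert 0 (offspring w ` generation w n))"
      using fin u by (intro Max_ge) auto
    with K u ui K0[of K] show "v \<in> trunc_seqs K (Suc n)"
      by (auto simp: trunc_seqs_Suc image_iff)
  qed
  then show ?case by blast
qed

lemma finite_generation [simp]: "finite (generation w n)"
  using generation_subset_trunc_seqs[of w n] finite_subset[OF _ finite_trunc_seqs] by blast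

lemma sum_generation_trunc:
  "\<exists>K0. \<forall>K\<ge>K0. (\<Sum>u\<in>trunc_seqs K n. of_bool (u \<in> tree w) * f u) = (\<Sum>u\<in>generation w n. f u :: real)"
proof -
  obtain K0 where K0: "\<And>K. K \<ge> K0 \<Longrightarrow> generation w n \<subseteq> trunc_seqs K n"
    using generation_subset_trunc_seqs by blast
  have "(\<Sum>u\<in>trunc_seqs K n. of_bool (u \<in> tree w) * f u) = (\<Sum>u\<in>generation w n. f u)" if "K \<ge> K0" for K
  proof -
    have "(\<Sum>u\<in>generation w n. f u) = (\<Sum>u\<in>generation w n. of_bool (u \<in> tree w) * f u)"
      by (intro sum.cong) (auto simp: generation_def)
    also have "\<dots> = (\<Sum>u\<in>trunc_seqs K n. of_bool (u \<in> tree w) * f u)"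
      using K0[OF that] by (intro sum.mono_neutral_left finite_trunc_seqs) (auto simp: generation_def dest: trunc_seqsD)
    finally show ?thesis by simp
  qed
  then show ?thesis by blast
qed

text \<open>Whether \<open>u\<close> is born depends on the offspring numbers of its proper
  prefixes, never on that of \<open>u\<close> itself; this is what makes N_u independent of the
  event \<open>u \<in> tree w\<close>.\<close>

lemma tree_cong:
  assumes "\<And>k. k < length u \<Longrightarrow> offspring w (take k u) = offspring w' (take k u)"
  shows "u \<in> tree w \<longleftrightarrow> u \<in> tree w'"
  using assms
proof (induction u rule: rev_induct)
  case Nil
  then show ?case by (simp add: tree.root)
next
  case (snoc i u)
  have "u \<in> tree w \<longleftrightarrow> u \<in> tree w'"
  proof (rule snoc.IH)
    fix k assume "k < length u"
    then show "offspring w (take k u) = offspring w' (take k u)"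
      using snoc.prems[of k] by simp
  qed
  then show ?case using snoc.prems[of "length u"] by (simp add: tree_snoc_iff)
qed

lemma position_cong:
  assumes "\<And>k. k < length u \<Longrightarrow> displ w (take (Suc k) u) = displ w' (take (Suc k) u)"
  shows "position w u = position w' u"
  using assms by (simp add: position_def)

section \<open>The quenched law\<close>

text \<open>Transfers first-moment bounds from the truncated sums to the full generation. They are
  requested only from an index \<open>k\<close> on because the increment estimate holds only once
  \<open>K\<close> reaches the cutoff \<open>b\<close>.\<close>

lemma integrable_Fatou:
  fixes f :: "nat \<Rightarrow> 'a \<Rightarrow> real"
  assumes f: "\<And>K. K \<ge> k \<Longrightarrow> integrable M (f K)"
    and lim: "\<And>w. w \<in> space M \<Longrightarrow> (\<lambda>K. f K w) \<longlonglongrightarrow> g w"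
    and bound: "\<And>K. K \<ge> k \<Longrightarrow> (\<integral>w. \<bar>f K w\<bar> \<partial>M) \<le> C"
  shows "integrable M g" "(\<integral>w. \<bar>g w\<bar> \<partial>M) \<le> C"
proof -
  have lim': "(\<lambda>K. f (K + k) w) \<longlonglongrightarrow> g w" if "w \<in> space M" for w
    using LIMSEQ_ignore_initial_segment[OF lim[OF that]] .
  have [measurable]: "f (K + k) \<in> borel_measurable M" for K using f by auto
  have [measurable]: "g \<in> borel_measurable M"
    by (rule borel_measurable_LIMSEQ_real[where u="\<lambda>K. f (K + k)"]) (auto intro: lim')
  have "0 \<le> (\<integral>w. \<bar>f k w\<bar> \<partial>M)" by simp
  with bound[of k] have C: "0 \<le> C" by linarith
  have "(\<integral>\<^sup>+w. ennreal \<bar>g w\<bar> \<partial>M) = (\<integral>\<^sup>+w. liminf (\<lambda>K. ennreal \<bar>f (K + k) w\<bar>) \<partial>M)"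
  proof (rule nn_integral_cong)
    fix w assume "w \<in> space M"
    from tendsto_ennrealI[OF tendsto_rabs[OF lim'[OF this]]]
    show "ennreal \<bar>g w\<bar> = liminf (\<lambda>K. ennreal \<bar>f (K + k) w\<bar>)"
      by (intro lim_imp_Liminf[symmetric]) auto
  qed
  also have "\<dots> \<le> liminf (\<lambda>K. \<integral>\<^sup>+w. ennreal \<bar>f (K + k) w\<bar> \<partial>M)"
    by (rule nn_integral_liminf) measurable
  also have "\<dots> \<le> ennreal C"
  proof (rule Liminf_le)
    show "\<forall>\<^sub>F K in sequentially. (\<integral>\<^sup>+w. ennreal \<bar>f (K + k) w\<bar> \<partial>M) \<le> ennreal C"
    proof (rule always_eventually, rule allI)
      fix K
      show "(\<integral>\<^sup>+w. ennreal \<bar>f (K + k) w\<bar> \<partial>M) \<le> ennreal C"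
        using f[of "K + k"] bound[of "K + k"]
        by (subst nn_integral_eq_integral) (auto intro!: ennreal_leI)
    qed
  qed simp
  finally have le: "(\<integral>\<^sup>+w. ennreal \<bar>g w\<bar> \<partial>M) \<le> ennreal C" .
  show int: "integrable M g"
    using le by (intro integrableI_bounded) (auto simp: less_top[symmetric] top_unique)
  have "ennreal (\<integral>w. \<bar>g w\<bar> \<partial>M) \<le> ennreal C"
    using le int by (subst nn_integral_eq_integral[symmetric]) auto
  then show "(\<integral>w. \<bar>g w\<bar> \<partial>M) \<le> C"
    using C by (simp add: ennreal_le_iff)
qed

locale quenched =
  fixes p :: "'e \<Rightarrow> nat pmf" and G :: "'e \<Rightarrow> real measure" and \<xi> :: "nat \<Rightarrow> 'e"
  assumes G: "\<And>n. G (\<xi> n) \<in> space (prob_algebra borel)"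
begin

abbreviation "M \<equiv> quenched_law p G \<xi>"
abbreviation "MN \<equiv> (\<Pi>\<^sub>M u\<in>seqs. measure_pmf (p (\<xi> (length u))))"
abbreviation "MD \<equiv> (\<Pi>\<^sub>M v\<in>seqs - {[]}. G (\<xi> (length v - 1)))"

lemma prob_G: "prob_space (G (\<xi> n))"
  using G[of n] by (simp add: space_prob_algebra)

lemma sets_G [measurable_cong]: "sets (G (\<xi> n)) = sets borel"
  using G[of n] by (simp add: space_prob_algebra)

lemma prob_MN: "prob_space MN"
  by (intro prob_space_PiM prob_space_measure_pmf)

lemma prob_MD: "prob_space MD"
  by (intro prob_space_PiM prob_G)

sublocale M: prob_space M
  unfolding quenched_law_def
proof -
  interpret MN: prob_space MN by (rule prob_MN)
  interpret MD: prob_space MD by (rule prob_MD)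
  interpret pair_prob_space MN MD ..
  show "prob_space (MN \<Otimes>\<^sub>M MD)" by unfold_locales
qed

text \<open>The right side does not mention \<xi>: all quenched laws share one \<sigma>-algebra,
  without which they could not form a kernel.\<close>

lemma sets_M [measurable_cong]:
  "sets M = sets ((\<Pi>\<^sub>M u\<in>seqs. count_space UNIV) \<Otimes>\<^sub>M (\<Pi>\<^sub>M v\<in>seqs - {[]}. borel))"
  unfolding quenched_law_def
  by (intro sets_pair_measure_cong sets_PiM_cong) (auto simp: sets_G)

lemma measurable_offspring [measurable (raw)]:
  assumes u: "u \<in> seqs" and f: "f \<in> N \<rightarrow>\<^sub>M M"
  shows "(\<lambda>w. offspring (f w) u) \<in> N \<rightarrow>\<^sub>M count_space UNIV"
proof -
  have "(\<lambda>w. offspring w u) \<in> M \<rightarrow>\<^sub>M count_space UNIV"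
    unfolding measurable_cong_sets[OF sets_M refl]
    by (rule measurable_compose[OF measurable_fst measurable_component_singleton[OF u]])
  then show ?thesis using f by (rule measurable_compose[rotated])
qed

lemma measurable_displ [measurable (raw)]:
  assumes v: "v \<in> seqs" "v \<noteq> []" and f: "f \<in> N \<rightarrow>\<^sub>M M"
  shows "(\<lambda>w. displ (f w) v) \<in> N \<rightarrow>\<^sub>M borel"
proof -
  have v': "v \<in> seqs - {[]}" using v by simp
  have "(\<lambda>w. displ w v) \<in> M \<rightarrow>\<^sub>M borel"
    unfolding measurable_cong_sets[OF sets_M refl]
    by (rule measurable_compose[OF measurable_snd measurable_component_singleton[OF v']])
  then show ?thesis using f by (rule measurable_compose[rotated])
qed

lemma measurable_tree [measurable]: "u \<in> seqs \<Longrightarrow> Measurable.pred M (\<lambda>w. u \<in> tree w)"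
proof (induction u rule: rev_induct)
  case (snoc i u)
  then have [measurable]: "Measurable.pred M (\<lambda>w. u \<in> tree w)" "u \<in> seqs" by auto
  show ?case unfolding tree_snoc_iff by measurable
qed (simp add: tree.root)

lemma measurable_position [measurable]: "u \<in> seqs \<Longrightarrow> (\<lambda>w. position w u) \<in> borel_measurable M"
  unfolding position_def by (auto intro!: borel_measurable_sum measurable_displ simp: seqs_take)

lemma resampling_offspring:
  assumes u: "u \<in> seqs"
  shows "resampling M (measure_pmf (p (\<xi> (length u)))) (\<lambda>(k, w). ((fst w)(u := k), snd w)) (\<lambda>w. offspring w u)"
proof
  let ?D = "measure_pmf (p (\<xi> (length u)))"
  \<comment> \<open>\<open>distr_pair_PiM_eq_PiM\<close> adjoins a coordinate to a product; since
    \<open>u\<close> is already an index, the same fact says that overwriting coordinate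
    \<open>u\<close> preserves the law.\<close>
  have ins: "insert u seqs = seqs" using u by auto
  let ?f = "\<lambda>(k, a). a(u := k)"
  have f: "?f \<in> ?D \<Otimes>\<^sub>M MN \<rightarrow>\<^sub>M MN"
  proof -
    have "(\<lambda>z. (snd z)(u := fst z)) \<in> ?D \<Otimes>\<^sub>M MN \<rightarrow>\<^sub>M (\<Pi>\<^sub>M v\<in>insert u seqs. measure_pmf (p (\<xi> (length v))))"
      by (rule measurable_fun_upd[where J=seqs]) auto
    then show ?thesis by (simp add: ins case_prod_beta')
  qed
  have "distr (?D \<Otimes>\<^sub>M MN) MN ?f = MN"
    using distr_pair_PiM_eq_PiM[of seqs "\<lambda>u. measure_pmf (p (\<xi> (length u)))" u]
    by (simp add: ins prob_space_measure_pmf)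
  from distr_resample_fst[OF prob_space_measure_pmf prob_MN prob_MD f this]
  show "distr (?D \<Otimes>\<^sub>M M) M (\<lambda>(k, w). ((fst w)(u := k), snd w)) = M"
    by (simp add: quenched_law_def case_prod_beta')
  have "(\<lambda>z. (?f (fst z, fst (snd z)), snd (snd z))) \<in> ?D \<Otimes>\<^sub>M (MN \<Otimes>\<^sub>M MD) \<rightarrow>\<^sub>M (MN \<Otimes>\<^sub>M MD)"
    by (rule measurable_Pair[OF measurable_compose[OF _ f]]) auto
  then show "(\<lambda>(k, w). ((fst w)(u := k), snd w)) \<in> ?D \<Otimes>\<^sub>M M \<rightarrow>\<^sub>M M"
    by (simp add: quenched_law_def case_prod_beta')
  show "(\<lambda>w. offspring w u) \<in> M \<rightarrow>\<^sub>M ?D"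
    using u by measurable
qed (auto simp: prob_space_measure_pmf measure_pmf.emeasure_space_1)

lemma resampling_displ:
  assumes v: "v \<in> seqs" "v \<noteq> []"
  shows "resampling M (G (\<xi> (length v - 1))) (\<lambda>(x, w). (fst w, (snd w)(v := x))) (\<lambda>w. displ w v)"
proof -
  let ?D = "G (\<xi> (length v - 1))"
  interpret D: prob_space ?D by (rule prob_G)
  show ?thesis
  proof
    have ins: "insert v (seqs - {[]}) = seqs - {[]}" using v by auto
    let ?f = "\<lambda>(k, a). a(v := k)"
    have f: "?f \<in> ?D \<Otimes>\<^sub>M MD \<rightarrow>\<^sub>M MD"
    proof -
      have "(\<lambda>z. (snd z)(v := fst z)) \<in> ?D \<Otimes>\<^sub>M MD \<rightarrow>\<^sub>M (\<Pi>\<^sub>M v\<in>insert v (seqs - {[]}). G (\<xi> (length v - 1)))"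
        by (rule measurable_fun_upd[where J="seqs - {[]}"]) auto
      then show ?thesis by (simp add: ins case_prod_beta')
    qed
    have "distr (?D \<Otimes>\<^sub>M MD) MD ?f = MD"
      using distr_pair_PiM_eq_PiM[of "seqs - {[]}" "\<lambda>v. G (\<xi> (length v - 1))" v]
      by (simp add: ins prob_G)
    from distr_resample_snd[OF prob_G prob_MN prob_MD f this]
    show "distr (?D \<Otimes>\<^sub>M M) M (\<lambda>(x, w). (fst w, (snd w)(v := x))) = M"
      by (simp add: quenched_law_def case_prod_beta')
    have "(\<lambda>z. (fst (snd z), ?f (fst z, snd (snd z)))) \<in> ?D \<Otimes>\<^sub>M (MN \<Otimes>\<^sub>M MD) \<rightarrow>\<^sub>M (MN \<Otimes>\<^sub>M MD)"
      by (rule measurable_Pair[OF _ measurable_compose[OF _ f]]) auto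
    then show "(\<lambda>(x, w). (fst w, (snd w)(v := x))) \<in> ?D \<Otimes>\<^sub>M M \<rightarrow>\<^sub>M M"
      by (simp add: quenched_law_def case_prod_beta')
    show "(\<lambda>w. displ w v) \<in> M \<rightarrow>\<^sub>M ?D"
      unfolding measurable_cong_sets[OF refl sets_G] using v by (intro measurable_displ) auto
  qed auto
qed

lemma mean_offspring_eq: "mean_offspring p G n \<xi> = measure_pmf.expectation (p (\<xi> n)) real"
proof -
  interpret r: resampling M "measure_pmf (p (\<xi> (length (replicate n (1::nat)))))"
    "\<lambda>(k, w). ((fst w)(replicate n 1 := k), snd w)" "\<lambda>w. offspring w (replicate n 1)"
    by (rule resampling_offspring) simp
  show ?thesis using r.integral_coordinate(1)[of real]
    by (simp add: mean_offspring_def N_hat_def)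
qed

lemma integrable_N_hat_iff:
  "integrable M (N_hat n) \<longleftrightarrow> integrable (measure_pmf (p (\<xi> n))) real"
proof -
  interpret r: resampling M "measure_pmf (p (\<xi> (length (replicate n (1::nat)))))"
    "\<lambda>(k, w). ((fst w)(replicate n 1 := k), snd w)" "\<lambda>w. offspring w (replicate n 1)"
    by (rule resampling_offspring) simp
  show ?thesis using r.integral_coordinate(2)[of real]
    by (simp add: N_hat_def[abs_def])
qed

lemma integral_displ:
  fixes h :: "real \<Rightarrow> real"
  assumes "v \<in> seqs" "length v = Suc n" and h: "h \<in> borel_measurable borel"
  shows "(\<integral>w. h (displ w v) \<partial>M) = (\<integral>x. h x \<partial>G (\<xi> n))"
    "integrable M (\<lambda>w. h (displ w v)) \<longleftrightarrow> integrable (G (\<xi> n)) h"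
proof -
  interpret r: resampling M "G (\<xi> (length v - 1))"
    "\<lambda>(x, w). (fst w, (snd w)(v := x))" "\<lambda>w. displ w v"
    using assms by (intro resampling_displ) auto
  from h have "h \<in> borel_measurable (G (\<xi> (length v - 1)))" by measurable
  from r.integral_coordinate[OF this] assms
  show "(\<integral>w. h (displ w v) \<partial>M) = (\<integral>x. h x \<partial>G (\<xi> n))"
    "integrable M (\<lambda>w. h (displ w v)) \<longleftrightarrow> integrable (G (\<xi> n)) h"
    by auto
qed

lemma mean_displ_eq: "mean_displ p G n \<xi> = (\<integral>x. x \<partial>G (\<xi> n))"
  using integral_displ(1)[of "replicate (Suc n) (Suc 0)" n "\<lambda>x. x"] seqs_replicate[of "Suc n"]
  by (simp add: mean_displ_def L_hat_def)

lemma central_moment_eq: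
  "central_moment p G \<nu> n \<xi> = (\<integral>x. (x - (\<integral>x. x \<partial>G (\<xi> n))) ^ \<nu> \<partial>G (\<xi> n))"
  using integral_displ(1)[of "replicate (Suc n) (Suc 0)" n "\<lambda>x. (x - mean_displ p G n \<xi>) ^ \<nu>"]
    seqs_replicate[of "Suc n"]
  by (simp add: central_moment_def L_hat_def mean_displ_eq)

text \<open>The quenched law is the product of an offspring block and a displacement block, so
  Fubini factorizes; boundedness of \<open>t\<close> makes integrability of \<open>f\<close>
  sufficient.\<close>

lemma indep_offspring_displ:
  fixes t :: "(nat list \<Rightarrow> nat) \<Rightarrow> real" and f :: "(nat list \<Rightarrow> real) \<Rightarrow> real"
  assumes t: "(\<lambda>w. t (fst w)) \<in> borel_measurable M" and tb: "\<And>a. \<bar>t a\<bar> \<le> 1"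
    and f: "integrable M (\<lambda>w. f (snd w))"
  shows "integrable M (\<lambda>w. t (fst w) * f (snd w))"
    and "(\<integral>w. t (fst w) * f (snd w) \<partial>M) = (\<integral>w. t (fst w) \<partial>M) * (\<integral>w. f (snd w) \<partial>M)"
proof -
  interpret MN: prob_space MN by (rule prob_MN)
  interpret MD: prob_space MD by (rule prob_MD)
  interpret pair_prob_space MN MD ..
  have M: "M = MN \<Otimes>\<^sub>M MD" by (simp add: quenched_law_def)
  have [measurable]: "(\<lambda>w. f (snd w)) \<in> borel_measurable M" using f by auto
  note [measurable] = t
  show int: "integrable M (\<lambda>w. t (fst w) * f (snd w))"
    by (rule Bochner_Integration.integrable_bound[OF f])
       (use tb in \<open>auto simp: abs_mult intro!: mult_left_le_one_le\<close>)
  have it: "integrable M (\<lambda>w. t (fst w))"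
    by (rule M.integrable_const_bound[where B=1]) (use tb in auto)
  have 1: "(\<integral>w. t (fst w) * f (snd w) \<partial>M) = (\<integral>a. t a * (\<integral>b. f b \<partial>MD) \<partial>MN)"
    unfolding M using integral_fst'[OF int[unfolded M]] by simp
  have 2: "(\<integral>w. t (fst w) \<partial>M) = (\<integral>a. t a \<partial>MN)"
    unfolding M using integral_fst'[OF it[unfolded M]] by (simp add: MD.prob_space del: One_nat_def)
  have 3: "(\<integral>w. f (snd w) \<partial>M) = (\<integral>b. f b \<partial>MD)"
    unfolding M using integral_fst'[OF f[unfolded M]] by (simp add: MN.prob_space del: One_nat_def)
  show "(\<integral>w. t (fst w) * f (snd w) \<partial>M) = (\<integral>w. t (fst w) \<partial>M) * (\<integral>w. f (snd w) \<partial>M)"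
    unfolding 1 2 3 by simp
qed

lemma tree_fst: "u \<in> tree w \<longleftrightarrow> u \<in> tree (fst w, b)"
  by (rule tree_cong) simp

lemma position_snd: "position w u = position (a, snd w) u"
  by (rule position_cong) simp

definition tree_prob :: "nat list \<Rightarrow> real" where
  "tree_prob u = (\<integral>w. of_bool (u \<in> tree w) \<partial>M)"

lemma tree_prob_nonneg: "0 \<le> tree_prob u"
  by (simp add: tree_prob_def)

lemma integrable_of_bool [simp]:
  assumes "Measurable.pred M P"
  shows "integrable M (\<lambda>w. of_bool (P w) :: real)"
  using assms by (intro M.integrable_const_bound[where B=1]) auto

lemma tree_offspring_prob:
  assumes u: "u \<in> seqs"
  shows "(\<integral>w. of_bool (u \<in> tree w) * of_bool (P (offspring w u)) \<partial>M)
    = tree_prob u * measure_pmf.prob (p (\<xi> (length u))) {k. P k}"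
proof -
  interpret r: resampling M "measure_pmf (p (\<xi> (length u)))"
    "\<lambda>(k, w). ((fst w)(u := k), snd w)" "\<lambda>w. offspring w u"
    by (rule resampling_offspring[OF u])
  have inv: "u \<in> tree ((fst w)(u := k), snd w) \<longleftrightarrow> u \<in> tree w" for k w
    by (rule tree_cong) (auto simp: list_eq_iff_nth_eq)
  have "(\<integral>w. of_bool (u \<in> tree w) * of_bool (P (offspring w u)) \<partial>M)
     = tree_prob u * measure_pmf.expectation (p (\<xi> (length u))) (\<lambda>k. of_bool (P k))"
    unfolding tree_prob_def by (rule r.integral_resample_mult(2)) (use u in \<open>auto simp: inv\<close>)
  also have "measure_pmf.expectation (p (\<xi> (length u))) (\<lambda>k. of_bool (P k) :: real)
      = measure_pmf.expectation (p (\<xi> (length u))) (indicator {k. P k})"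
    by (intro Bochner_Integration.integral_cong) (auto simp: indicator_def)
  finally show ?thesis by simp
qed

lemma tree_prob_snoc:
  assumes "u \<in> seqs" "1 \<le> i"
  shows "tree_prob (u @ [i]) = tree_prob u * measure_pmf.prob (p (\<xi> (length u))) {k. i \<le> k}"
proof -
  have "tree_prob (u @ [i]) = (\<integral>w. of_bool (u \<in> tree w) * of_bool (i \<le> offspring w u) \<partial>M)"
    unfolding tree_prob_def using assms
    by (intro Bochner_Integration.integral_cong) (auto simp: tree_snoc_iff)
  then show ?thesis using tree_offspring_prob[OF assms(1), of "\<lambda>k. i \<le> k"] by simp
qed

end

text \<open>The tail-sum formula for a mean, cut at \<open>K\<close>: for a fixed \<open>k\<close>
  there are exactly \<open>min k K\<close> indices \<open>i\<close> in \<open>1..K\<close> with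
  \<open>i \<le> k\<close>. The predicate \<open>P\<close> serves to restrict to small or to large
  families.\<close>

lemma sum_prob_ge:
  fixes q :: "nat pmf"
  shows "(\<Sum>i=1..K. measure_pmf.prob q {k. i \<le> k \<and> P k})
    = measure_pmf.expectation q (\<lambda>k. real (min k K) * of_bool (P k))"
proof -
  have "(\<Sum>i=1..K. measure_pmf.prob q {k. i \<le> k \<and> P k})
     = (\<Sum>i=1..K. measure_pmf.expectation q (indicator {k. i \<le> k \<and> P k}))" by simp
  also have "\<dots> = measure_pmf.expectation q (\<lambda>k. \<Sum>i=1..K. indicator {k. i \<le> k \<and> P k} k)"
    by (intro Bochner_Integration.integral_sum[symmetric] measure_pmf.integrable_const_bound[where B=1])
      (auto simp: indicator_def)
  also have "\<dots> = measure_pmf.expectation q (\<lambda>k. real (min k K) * of_bool (P k))"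
  proof (intro Bochner_Integration.integral_cong refl)
    fix k
    have "{i \<in> {1..K}. i \<le> k} = {1..min k K}" by auto
    then show "(\<Sum>i=1..K. indicator {k. i \<le> k \<and> P k} k) = real (min k K) * of_bool (P k)"
      by (cases "P k") (auto simp: indicator_def if_distrib sum.If_cases Int_def)
  qed
  finally show ?thesis .
qed

section \<open>Quenched martingales\<close>

text \<open>What matters of the polynomials is the averaging identity \<open>pol_mart\<close> and a
  first-moment bound depending on the generation alone, so the three \<nu> are treated at
  once.\<close>

locale quenched_poly = quenched p G \<xi>
  for p :: "'e \<Rightarrow> nat pmf" and G :: "'e \<Rightarrow> real measure" and \<xi> :: "nat \<Rightarrow> 'e" +
  fixes pol :: "nat \<Rightarrow> real \<Rightarrow> real" and R :: "nat \<Rightarrow> real"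
  assumes mean_int: "\<And>n. integrable (measure_pmf (p (\<xi> n))) real"
    and mean_pos: "\<And>n. 0 < mean_offspring p G n \<xi>"
    and pol_meas [measurable]: "\<And>n. pol n \<in> borel_measurable borel"
    and pol_mart: "\<And>n s. (\<integral>x. pol (Suc n) (s + (x - mean_displ p G n \<xi>)) \<partial>G (\<xi> n)) = pol n s"
    and pol_int: "\<And>v. v \<in> seqs \<Longrightarrow> integrable M (\<lambda>w. pol (length v) (position w v - ell p G (length v) \<xi>))"
    and pol_bound: "\<And>v. v \<in> seqs \<Longrightarrow>
      (\<integral>w. \<bar>pol (length v) (position w v - ell p G (length v) \<xi>)\<bar> \<partial>M) \<le> R (length v)"
begin

abbreviation "m n \<equiv> mean_offspring p G n \<xi>"
abbreviation "PI n \<equiv> Pi_norm p G n \<xi>"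

definition H :: "nat list \<Rightarrow> process \<Rightarrow> real" where
  "H v w = pol (length v) (position w v - ell p G (length v) \<xi>)"

definition T :: "nat list \<Rightarrow> process \<Rightarrow> real" where
  "T v w = of_bool (v \<in> tree w)"

definition Y :: "nat \<Rightarrow> process \<Rightarrow> real" where
  "Y n w = 1 / PI n * (\<Sum>u\<in>generation w n. H u w)"

definition YK :: "nat \<Rightarrow> nat \<Rightarrow> process \<Rightarrow> real" where
  "YK K n w = 1 / PI n * (\<Sum>u\<in>trunc_seqs K n. T u w * H u w)"

lemma PI_pos: "0 < PI n"
  unfolding Pi_norm_def by (intro prod_pos) (simp add: mean_pos)

lemma PI_0 [simp]: "PI 0 = 1"
  by (simp add: Pi_norm_def)

lemma PI_Suc: "PI (Suc n) = PI n * m n"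
  by (simp add: Pi_norm_def)

lemma R_nonneg: "0 \<le> R n"
proof -
  have "0 \<le> (\<integral>w. \<bar>H (replicate n 1) w\<bar> \<partial>M)" by simp
  also have "\<dots> \<le> R n" using pol_bound[of "replicate n 1"] by (simp add: H_def)
  finally show ?thesis .
qed

lemma H_integrable: "v \<in> seqs \<Longrightarrow> integrable M (H v)"
  using pol_int by (simp add: H_def[abs_def])

lemma H_bound: "v \<in> seqs \<Longrightarrow> (\<integral>w. \<bar>H v w\<bar> \<partial>M) \<le> R (length v)"
  using pol_bound by (simp add: H_def)

lemma H_meas [measurable]: "v \<in> seqs \<Longrightarrow> H v \<in> borel_measurable M"
  using H_integrable by auto

lemma T_meas [measurable]: "v \<in> seqs \<Longrightarrow> T v \<in> borel_measurable M"
  unfolding T_def[abs_def] by measurable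

lemma T_bounds: "0 \<le> T v w" "T v w \<le> 1" "\<bar>T v w\<bar> \<le> 1" "T v w * T v w = T v w"
  by (auto simp: T_def)

lemma T_snoc: "1 \<le> i \<Longrightarrow> T (u @ [i]) w = T u w * of_bool (i \<le> offspring w u)"
  by (auto simp: T_def tree_snoc_iff)

lemma H_snd: "H v w = H v (a, snd w)"
  unfolding H_def by (subst position_snd[of w v a]) rule

lemma T_fst: "T v w = T v (fst w, b)"
  unfolding T_def by (subst tree_fst[of v w b]) rule

lemma T_resample_displ: "T u (fst w, b) = T u w"
  using T_fst[of u w] by simp

lemma T_resample_offspring:
  assumes "length u \<le> length v"
  shows "T u ((fst w)(v := k), b) = T u w"
  unfolding T_def
proof (rule arg_cong[where f=of_bool], rule tree_cong)
  fix j assume "j < length u"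
  with assms have "take j u \<noteq> v" by auto
  then show "offspring ((fst w)(v := k), b) (take j u) = offspring w (take j u)" by simp
qed

lemma H_resample_offspring: "H u (a, snd w) = H u w"
  using H_snd[of u w] by simp

text \<open>Unlike membership in the tree, the position of \<open>u\<close> reads a displacement at
  \<open>u\<close> itself, hence the condition \<open>u \<noteq> v\<close>. Equal lengths are
  allowed: siblings and cousins do not interact.\<close>

lemma H_resample_displ:
  assumes "length u \<le> length v" "u \<noteq> v"
  shows "H u (a, (snd w)(v := x)) = H u w"
  unfolding H_def
proof (rule arg_cong[where f="\<lambda>z. pol _ (z - _)"], rule position_cong)
  fix j assume "j < length u"
  with assms have "take (Suc j) u \<noteq> v"
    by (metis Suc_leI le_antisym length_take min.absorb2 take_all)
  then show "displ (a, (snd w)(v := x)) (take (Suc j) u) = displ w (take (Suc j) u)" by simp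
qed

lemma H_snoc: "H (u @ [i]) w
   = pol (Suc (length u)) (position w u - ell p G (length u) \<xi> + (displ w (u @ [i]) - mean_displ p G (length u) \<xi>))"
  by (simp add: H_def position_snoc ell_def algebra_simps)

lemma integral_indep_T:
  assumes v: "v \<in> seqs" and t: "(\<lambda>w. t (fst w)) \<in> borel_measurable M" "\<And>a. \<bar>t a\<bar> \<le> 1"
    and H: "integrable M (\<lambda>w. f (H v w) :: real)"
  shows "integrable M (\<lambda>w. t (fst w) * f (H v w))"
    and "(\<integral>w. t (fst w) * f (H v w) \<partial>M) = (\<integral>w. t (fst w) \<partial>M) * (\<integral>w. f (H v w) \<partial>M)"
proof -
  have *: "H v w = H v (undefined, snd w)" for w by (rule H_snd)
  have "integrable M (\<lambda>w. f (H v (undefined, snd w)))" using H by (simp add: *[symmetric])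
  from indep_offspring_displ[OF t, of "\<lambda>b. f (H v (undefined, b))", OF this]
  show "integrable M (\<lambda>w. t (fst w) * f (H v w))"
    "(\<integral>w. t (fst w) * f (H v w) \<partial>M) = (\<integral>w. t (fst w) \<partial>M) * (\<integral>w. f (H v w) \<partial>M)"
    by (simp_all add: *[symmetric])
qed

lemma T_integral:
  assumes v: "v \<in> seqs" and H: "integrable M (\<lambda>w. f (H v w) :: real)"
  shows "integrable M (\<lambda>w. T v w * f (H v w))"
    and "(\<integral>w. T v w * f (H v w) \<partial>M) = tree_prob v * (\<integral>w. f (H v w) \<partial>M)"
proof -
  have *: "T v w = T v (fst w, undefined)" for w by (rule T_fst)
  have "(\<lambda>w. T v (fst w, undefined)) \<in> borel_measurable M"
    using T_meas[OF v] by (simp add: *[symmetric])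
  from integral_indep_T[OF v this T_bounds(3) H]
  show "integrable M (\<lambda>w. T v w * f (H v w))"
    "(\<integral>w. T v w * f (H v w) \<partial>M) = tree_prob v * (\<integral>w. f (H v w) \<partial>M)"
    by (simp_all add: *[symmetric]) (simp add: T_def[abs_def] tree_prob_def)
qed

lemma sum_tree_prob_snoc:
  assumes "u \<in> seqs"
  shows "(\<Sum>i=1..K. tree_prob (u @ [i])) \<le> tree_prob u * m (length u)"
proof -
  have "(\<Sum>i=1..K. measure_pmf.prob (p (\<xi> (length u))) {k. i \<le> k})
     = measure_pmf.expectation (p (\<xi> (length u))) (\<lambda>k. real (min k K))"
    using sum_prob_ge[of "p (\<xi> (length u))" "\<lambda>_. True" K] by simp
  also have "\<dots> \<le> m (length u)"
    unfolding mean_offspring_eq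
    by (intro integral_mono mean_int measure_pmf.integrable_const_bound[where B=K]) auto
  finally show ?thesis
    using assms tree_prob_nonneg[of u]
    by (simp add: tree_prob_snoc sum_distrib_left[symmetric] mult_left_mono)
qed

text \<open>The expected size of generation \<open>n\<close> is \<open>PI n\<close>; an inequality
  is what remains when labels above \<open>K\<close> are missing.\<close>

lemma sum_tree_prob: "(\<Sum>u\<in>trunc_seqs K n. tree_prob u) \<le> PI n"
proof (induction n)
  case 0
  have "tree_prob [] = 1" by (simp add: tree_prob_def tree.root M.prob_space)
  then show ?case by (simp add: trunc_seqs_0)
next
  case (Suc n)
  have "(\<Sum>u\<in>trunc_seqs K (Suc n). tree_prob u) = (\<Sum>u\<in>trunc_seqs K n. \<Sum>i=1..K. tree_prob (u @ [i]))"
    by (rule sum_trunc_seqs_Suc)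
  also have "\<dots> \<le> (\<Sum>u\<in>trunc_seqs K n. tree_prob u * m n)"
    using sum_tree_prob_snoc trunc_seqsD by (intro sum_mono) metis
  also have "\<dots> \<le> PI (Suc n)"
    using Suc mean_pos[of n] by (simp add: sum_distrib_right[symmetric] PI_Suc)
  finally show ?case .
qed

text \<open>A many-to-one estimate: given the environment the tree is independent of the
  displacements, so each term splits into \<open>tree_prob\<close> times a moment of
  \<open>H\<close>, and the probabilities sum to at most \<open>PI n\<close>.\<close>

lemma sum_TH_bound:
  assumes "\<And>v. v \<in> seqs \<Longrightarrow> length v = n \<Longrightarrow> integrable M (\<lambda>w. f (H v w) :: real)"
    and b: "\<And>v. v \<in> seqs \<Longrightarrow> length v = n \<Longrightarrow> (\<integral>w. f (H v w) \<partial>M) \<le> C" and "0 \<le> C"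
  shows "integrable M (\<lambda>w. \<Sum>u\<in>trunc_seqs K n. T u w * f (H u w))"
    and "(\<integral>w. (\<Sum>u\<in>trunc_seqs K n. T u w * f (H u w)) \<partial>M) \<le> PI n * C"
proof -
  show "integrable M (\<lambda>w. \<Sum>u\<in>trunc_seqs K n. T u w * f (H u w))"
    using assms trunc_seqsD by (intro Bochner_Integration.integrable_sum T_integral) metis+
  have "(\<integral>w. (\<Sum>u\<in>trunc_seqs K n. T u w * f (H u w)) \<partial>M) = (\<Sum>u\<in>trunc_seqs K n. tree_prob u * (\<integral>w. f (H u w) \<partial>M))"
    using assms trunc_seqsD
    by (subst Bochner_Integration.integral_sum) (auto intro!: T_integral sum.cong)
  also have "\<dots> \<le> (\<Sum>u\<in>trunc_seqs K n. tree_prob u * C)"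
    using tree_prob_nonneg trunc_seqsD by (intro sum_mono mult_left_mono b)
  also have "\<dots> \<le> PI n * C"
    using sum_tree_prob \<open>0 \<le> C\<close> by (simp add: sum_distrib_right[symmetric] mult_right_mono)
  finally show "(\<integral>w. (\<Sum>u\<in>trunc_seqs K n. T u w * f (H u w)) \<partial>M) \<le> PI n * C" .
qed

text \<open>One integrable majorant of \<open>YK K n\<close> for all \<open>K\<close>, as dominated
  convergence requires.\<close>

definition D :: "nat \<Rightarrow> process \<Rightarrow> real" where
  "D n w = 1 / PI n * (\<Sum>u\<in>generation w n. \<bar>H u w\<bar>)"

lemma trunc_tendsto:
  "(\<lambda>K. 1 / PI n * (\<Sum>u\<in>trunc_seqs K n. T u w * f u)) \<longlonglongrightarrow> 1 / PI n * (\<Sum>u\<in>generation w n. f u)"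
proof (rule tendsto_eventually)
  show "\<forall>\<^sub>F K in sequentially. 1 / PI n * (\<Sum>u\<in>trunc_seqs K n. T u w * f u)
     = 1 / PI n * (\<Sum>u\<in>generation w n. f u)"
    using sum_generation_trunc[of w f n] unfolding eventually_sequentially T_def by fastforce
qed

lemma YK_tendsto: "(\<lambda>K. YK K n w) \<longlonglongrightarrow> Y n w"
  unfolding YK_def Y_def by (rule trunc_tendsto)

lemma D_integrable: "integrable M (D n)" and D_bound: "(\<integral>w. D n w \<partial>M) \<le> R n"
proof -
  let ?f = "\<lambda>K w. 1 / PI n * (\<Sum>u\<in>trunc_seqs K n. T u w * \<bar>H u w\<bar>)"
  have *: "integrable M (\<lambda>w. \<Sum>u\<in>trunc_seqs K n. T u w * \<bar>H u w\<bar>)"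
    "(\<integral>w. (\<Sum>u\<in>trunc_seqs K n. T u w * \<bar>H u w\<bar>) \<partial>M) \<le> PI n * R n" for K
    using sum_TH_bound[of n abs "R n" K] H_integrable H_bound R_nonneg by auto
  have nn: "0 \<le> ?f K w" for K w
    using PI_pos[of n] by (intro mult_nonneg_nonneg sum_nonneg T_bounds) auto
  have 1: "integrable M (?f K)" for K using * by simp
  have 2: "(\<integral>w. \<bar>?f K w\<bar> \<partial>M) \<le> R n" for K
  proof -
    have "(\<integral>w. \<bar>?f K w\<bar> \<partial>M) = (\<integral>w. ?f K w \<partial>M)" unfolding abs_of_nonneg[OF nn] ..
    also have "\<dots> \<le> R n"
      using *(2)[of K] PI_pos[of n] by (simp add: field_simps)
    finally show ?thesis .
  qed
  have lim: "(\<lambda>K. ?f K w) \<longlonglongrightarrow> D n w" for w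
    unfolding D_def by (rule trunc_tendsto)
  have Dnn: "0 \<le> D n w" for w
    using PI_pos[of n] by (auto simp: D_def intro!: divide_nonneg_nonneg sum_nonneg)
  show "integrable M (D n)"
    by (rule integrable_Fatou(1)[where k=0 and f="?f" and C="R n"]) (rule 1 lim 2)+
  have "(\<integral>w. \<bar>D n w\<bar> \<partial>M) \<le> R n"
    by (rule integrable_Fatou(2)[where k=0 and f="?f" and C="R n"]) (rule 1 lim 2)+
  then show "(\<integral>w. D n w \<partial>M) \<le> R n" using Dnn by simp
qed

lemma YK_le_D: "\<bar>YK K n w\<bar> \<le> D n w"
proof -
  have "\<bar>\<Sum>u\<in>trunc_seqs K n. T u w * H u w\<bar> \<le> (\<Sum>u\<in>trunc_seqs K n. \<bar>T u w * H u w\<bar>)"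
    by (rule sum_abs)
  also have "\<dots> = (\<Sum>u\<in>trunc_seqs K n \<inter> generation w n. \<bar>H u w\<bar>)"
    by (intro sum.mono_neutral_cong_right) (auto simp: T_def generation_def dest: trunc_seqsD)
  also have "\<dots> \<le> (\<Sum>u\<in>generation w n. \<bar>H u w\<bar>)"
    by (intro sum_mono2) auto
  finally show ?thesis
    using PI_pos[of n] by (simp add: YK_def D_def abs_mult divide_right_mono)
qed

lemma YK_meas [measurable]: "YK K n \<in> borel_measurable M"
  unfolding YK_def[abs_def] using trunc_seqsD(1)
  by (intro borel_measurable_times borel_measurable_sum borel_measurable_const T_meas H_meas)

lemma Y_meas [measurable]: "Y n \<in> borel_measurable M"
  by (rule borel_measurable_LIMSEQ_real[OF YK_tendsto]) simp

lemma Y_le_D: "\<bar>Y n w\<bar> \<le> D n w"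
  by (rule tendsto_upperbound[OF tendsto_rabs[OF YK_tendsto]]) (auto simp: YK_le_D)

lemma Y_integrable: "integrable M (Y n)" and Y_bound: "(\<integral>w. \<bar>Y n w\<bar> \<partial>M) \<le> R n"
proof -
  show *: "integrable M (Y n)"
    by (rule Bochner_Integration.integrable_bound[OF D_integrable])
       (auto intro!: AE_I2 order_trans[OF Y_le_D abs_ge_self])
  have "(\<integral>w. \<bar>Y n w\<bar> \<partial>M) \<le> (\<integral>w. D n w \<partial>M)"
    using * by (intro integral_mono D_integrable Y_le_D) auto
  with D_bound show "(\<integral>w. \<bar>Y n w\<bar> \<partial>M) \<le> R n" by (rule order_trans[rotated])
qed

text \<open>The common core of the martingale property and of the orthogonality of increments.
  Averaging over the displacement of \<open>u @ [i]\<close> turns \<open>H (u @ [i])\<close> into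
  \<open>H u\<close>; afterwards N_u occurs only in \<open>h\<close> and can be averaged too.
  \<open>Z\<close> is any factor blind to these two coordinates: a function of the past in one
  application, the increment of another particle in the other.\<close>

lemma child_centering:
  assumes u: "u \<in> seqs" and i: "1 \<le> i" and Z[measurable]: "Z \<in> borel_measurable M"
    and Z_off: "\<And>w k. w \<in> space M \<Longrightarrow> Z ((fst w)(u := k), snd w) = Z w"
    and Z_dis: "\<And>w x. w \<in> space M \<Longrightarrow> Z (fst w, (snd w)(u @ [i] := x)) = Z w"
    and h: "\<And>k. \<bar>h k\<bar> \<le> (1::real)"
    and int: "integrable M (\<lambda>w. Z w * T u w * H (u @ [i]) w)"
  shows "integrable M (\<lambda>w. Z w * T u w * H u w)"
    and "integrable M (\<lambda>w. Z w * T u w * h (offspring w u) * H (u @ [i]) w)"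
    and "(\<integral>w. Z w * T u w * h (offspring w u) * H (u @ [i]) w \<partial>M)
      = measure_pmf.expectation (p (\<xi> (length u))) h * (\<integral>w. Z w * T u w * H u w \<partial>M)"
proof -
  note [measurable] = u
  have uv [measurable]: "u @ [i] \<in> seqs" using u i by simp
  interpret N: resampling M "measure_pmf (p (\<xi> (length u)))" "\<lambda>(k, w). ((fst w)(u := k), snd w)" "\<lambda>w. offspring w u"
    by (rule resampling_offspring[OF u])
  interpret L: resampling M "G (\<xi> (length u))" "\<lambda>(x, w). (fst w, (snd w)(u @ [i] := x))" "\<lambda>w. displ w (u @ [i])"
    using resampling_displ[OF uv] by simp
  have int_h: "integrable M (\<lambda>w. Z w * T u w * f (offspring w u) * H (u @ [i]) w)"
    if f: "\<And>k. \<bar>f k\<bar> \<le> (1::real)" for f :: "nat \<Rightarrow> real"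
  proof (rule Bochner_Integration.integrable_bound[OF int])
    show "AE w in M. norm (Z w * T u w * f (offspring w u) * H (u @ [i]) w) \<le> norm (Z w * T u w * H (u @ [i]) w)"
    proof (rule AE_I2)
      fix w
      have "\<bar>f (offspring w u)\<bar> * \<bar>Z w * T u w * H (u @ [i]) w\<bar> \<le> 1 * \<bar>Z w * T u w * H (u @ [i]) w\<bar>"
        by (intro mult_right_mono f) simp
      then show "norm (Z w * T u w * f (offspring w u) * H (u @ [i]) w) \<le> norm (Z w * T u w * H (u @ [i]) w)"
        by (simp add: abs_mult mult_ac)
    qed
  qed measurable
  \<comment> \<open>The displacement of the child becomes a separate argument \<open>x\<close>, so
    that \<open>w\<close> supplies only what resampling leaves unchanged.\<close>
  define F where "F h w x = Z w * T u w * h (offspring w u)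
     * pol (Suc (length u)) (position w u - ell p G (length u) \<xi> + (x - mean_displ p G (length u) \<xi>))"
    for h :: "nat \<Rightarrow> real" and w x
  have F1: "(\<lambda>(w, x). F h w x) \<in> borel_measurable (M \<Otimes>\<^sub>M G (\<xi> (length u)))" for h
    unfolding F_def using u by measurable
  have F2: "F h (case (x, w) of (x, w) \<Rightarrow> (fst w, (snd w)(u @ [i] := x))) y = F h w y" if "w \<in> space M" for h w x y
  proof -
    have "position (fst w, (snd w)(u @ [i] := x)) u = position w u"
      by (rule position_cong) (auto simp: list_eq_iff_nth_eq)
    then show ?thesis using that by (simp add: F_def Z_dis T_resample_displ)
  qed
  have F3: "(\<lambda>w. Z w * T u w * h (offspring w u) * H (u @ [i]) w) = (\<lambda>w. F h w (displ w (u @ [i])))" for h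
    by (simp add: F_def H_snoc)
  have F4: "(\<integral>x. F h w x \<partial>G (\<xi> (length u))) = Z w * T u w * h (offspring w u) * H u w" for h w
    by (simp add: F_def pol_mart H_def)
  have 1: "integrable M (\<lambda>w. Z w * T u w * f (offspring w u) * H u w)"
    and 2: "(\<integral>w. Z w * T u w * f (offspring w u) * H (u @ [i]) w \<partial>M)
      = (\<integral>w. Z w * T u w * f (offspring w u) * H u w \<partial>M)"
    if f: "\<And>k. \<bar>f k\<bar> \<le> (1::real)" for f :: "nat \<Rightarrow> real"
  proof -
    have "integrable M (\<lambda>w. F f w (displ w (u @ [i])))"
      using int_h[of f] f by (simp only: F3)
    from L.integrable_resample[OF F1 F2 this] L.integral_resample[OF F1 F2 this]
    show "integrable M (\<lambda>w. Z w * T u w * f (offspring w u) * H u w)"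
      "(\<integral>w. Z w * T u w * f (offspring w u) * H (u @ [i]) w \<partial>M)
      = (\<integral>w. Z w * T u w * f (offspring w u) * H u w \<partial>M)"
      by (simp_all only: F3 F4)
  qed
  show I: "integrable M (\<lambda>w. Z w * T u w * H u w)" using 1[of "\<lambda>_. 1"] by simp
  have inv: "Z (case (k, w) of (k, w) \<Rightarrow> ((fst w)(u := k), snd w)) * T u (case (k, w) of (k, w) \<Rightarrow> ((fst w)(u := k), snd w))
      * H u (case (k, w) of (k, w) \<Rightarrow> ((fst w)(u := k), snd w)) = Z w * T u w * H u w" if "w \<in> space M" for k w
    using that by (simp add: Z_off T_resample_offspring H_resample_offspring)
  have "(\<integral>w. (Z w * T u w * H u w) * h (offspring w u) \<partial>M)
     = (\<integral>w. Z w * T u w * H u w \<partial>M) * measure_pmf.expectation (p (\<xi> (length u))) h"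
    by (rule N.integral_resample_mult(2)[OF I inv]) (use h in auto)
  then show "(\<integral>w. Z w * T u w * h (offspring w u) * H (u @ [i]) w \<partial>M)
      = measure_pmf.expectation (p (\<xi> (length u))) h * (\<integral>w. Z w * T u w * H u w \<partial>M)"
    using 2[of h] h by (simp add: mult_ac)
  show "integrable M (\<lambda>w. Z w * T u w * h (offspring w u) * H (u @ [i]) w)" by (rule int_h[of h]) (rule h)
qed

text \<open>\<open>g\<close> stands for the indicator of a past event; \<open>inv\<close> expresses
  measurability with respect to the past as dependence on the coordinates of the past. Displacements
  with labels of length \<open>n\<close> belong to it because such a label is one longer than that
  of the parent.\<close>

theorem quenched_martingale:
  assumes g[measurable]: "g \<in> borel_measurable M" and gb: "\<And>w. \<bar>g w\<bar> \<le> (1::real)"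
    and inv: "\<And>w w'. w \<in> space M \<Longrightarrow> w' \<in> space M \<Longrightarrow>
      (\<And>u. u \<in> seqs \<Longrightarrow> length u < n \<Longrightarrow> offspring w u = offspring w' u) \<Longrightarrow>
      (\<And>v. v \<in> seqs \<Longrightarrow> v \<noteq> [] \<Longrightarrow> length v \<le> n \<Longrightarrow> displ w v = displ w' v) \<Longrightarrow> g w = g w'"
  shows "(\<integral>w. g w * Y (Suc n) w \<partial>M) = (\<integral>w. g w * Y n w \<partial>M)"
proof -
  have sub: "(\<lambda>K. \<integral>w. g w * YK K k w \<partial>M) \<longlonglongrightarrow> (\<integral>w. g w * Y k w \<partial>M)" for k
  proof (rule integral_dominated_convergence[where w="D k"])
    show "AE w in M. (\<lambda>K. g w * YK K k w) \<longlonglongrightarrow> g w * Y k w"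
      by (intro AE_I2 tendsto_mult tendsto_const YK_tendsto)
    show "AE w in M. norm (g w * YK K k w) \<le> D k w" for K
    proof (rule AE_I2)
      fix w
      have "\<bar>g w\<bar> * \<bar>YK K k w\<bar> \<le> 1 * D k w"
        by (intro mult_mono gb YK_le_D) auto
      then show "norm (g w * YK K k w) \<le> D k w" by (simp add: abs_mult)
    qed
  qed (auto intro: D_integrable)
  \<comment> \<open>Truncation at \<open>K\<close> replaces N by min(N, K), so the truncated sums
    are martingales only up to the factor E min(N, K) / m_n, which tends to 1.\<close>
  let ?c = "\<lambda>K. (\<Sum>i=1..K. measure_pmf.prob (p (\<xi> n)) {k. i \<le> k}) / m n"
  have step: "(\<integral>w. g w * YK K (Suc n) w \<partial>M) = ?c K * (\<integral>w. g w * YK K n w \<partial>M)" for K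
  proof -
    have termI: "integrable M (\<lambda>w. g w * (T v w * H v w))" if "v \<in> seqs" for v
    proof (rule Bochner_Integration.integrable_bound[OF H_integrable[OF that]])
      show "AE w in M. norm (g w * (T v w * H v w)) \<le> norm (H v w)"
        using gb T_bounds by (auto simp: abs_mult intro!: mult_left_le_one_le mult_le_one simp flip: mult.assoc)
    qed (use that in measurable)
    have "(\<integral>w. g w * YK K (Suc n) w \<partial>M)
       = (\<integral>w. (\<Sum>u\<in>trunc_seqs K n. \<Sum>i=1..K. 1 / PI (Suc n) * (g w * (T (u @ [i]) w * H (u @ [i]) w))) \<partial>M)"
      unfolding YK_def sum_trunc_seqs_Suc by (simp add: sum_distrib_left mult_ac)
    also have "\<dots> = (\<Sum>u\<in>trunc_seqs K n. \<Sum>i=1..K. 1 / PI (Suc n) * (\<integral>w. g w * (T (u @ [i]) w * H (u @ [i]) w) \<partial>M))"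
    proof -
      have i: "integrable M (\<lambda>w. 1 / PI (Suc n) * (g w * (T (u @ [i]) w * H (u @ [i]) w)))"
        if "u \<in> trunc_seqs K n" "i \<in> {1..K}" for u i
        using that trunc_seqsD by (intro integrable_mult_right termI) auto
      then show ?thesis
        by (simp only: Bochner_Integration.integral_sum Bochner_Integration.integrable_sum integral_mult_right_zero
              cong: sum.cong)
    qed
    also have "\<dots> = (\<Sum>u\<in>trunc_seqs K n. \<Sum>i=1..K. 1 / PI (Suc n) * (measure_pmf.prob (p (\<xi> n)) {k. i \<le> k} *
        (\<integral>w. g w * (T u w * H u w) \<partial>M)))"
    proof (intro sum.cong refl)
      fix u i assume ui: "u \<in> trunc_seqs K n" "i \<in> {1..K}"
      then have u: "u \<in> seqs" and [simp]: "length u = n" and i: "1 \<le> i" using trunc_seqsD by auto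
      \<comment> \<open>\<open>inv\<close> is available on \<open>space M\<close> only, whose points
        are extensional functions, so an updated realization must be seen to stay in that
        space.\<close>
      have s: "w \<in> space M \<Longrightarrow> ((fst w)(u := k), snd w) \<in> space M"
        "w \<in> space M \<Longrightarrow> (fst w, (snd w)(u @ [i] := x)) \<in> space M" for w k x
        using u i by (auto simp: quenched_law_def space_pair_measure space_PiM PiE_iff extensional_def
            prob_space.not_empty[OF prob_G] sets_eq_imp_space_eq[OF sets_G])
      have "integrable M (\<lambda>w. g w * T u w * H (u @ [i]) w)"
      proof (rule Bochner_Integration.integrable_bound[OF H_integrable[of "u @ [i]"]])
        show "AE w in M. norm (g w * T u w * H (u @ [i]) w) \<le> norm (H (u @ [i]) w)"
          using gb T_bounds by (auto simp: abs_mult intro!: mult_left_le_one_le mult_le_one)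
        have [measurable]: "u \<in> seqs" "u @ [i] \<in> seqs" using u i by auto
        show "(\<lambda>w. g w * T u w * H (u @ [i]) w) \<in> borel_measurable M" by measurable
      qed (use u i in auto)
      then have "(\<integral>w. g w * T u w * of_bool (i \<le> offspring w u) * H (u @ [i]) w \<partial>M)
        = measure_pmf.expectation (p (\<xi> (length u))) (\<lambda>k. of_bool (i \<le> k)) * (\<integral>w. g w * T u w * H u w \<partial>M)"
        by (intro child_centering u i g) (auto intro!: inv s)
      also have "measure_pmf.expectation (p (\<xi> (length u))) (\<lambda>k. of_bool (i \<le> k) :: real)
        = measure_pmf.expectation (p (\<xi> n)) (indicator {k. i \<le> k})"
        by (intro Bochner_Integration.integral_cong) (auto simp: indicator_def)
      finally show "1 / PI (Suc n) * (\<integral>w. g w * (T (u @ [i]) w * H (u @ [i]) w) \<partial>M)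
        = 1 / PI (Suc n) * (measure_pmf.prob (p (\<xi> n)) {k. i \<le> k} * (\<integral>w. g w * (T u w * H u w) \<partial>M))"
        by (simp add: T_snoc[OF i] mult_ac)
    qed
    also have "\<dots> = ?c K * (\<Sum>u\<in>trunc_seqs K n. 1 / PI n * (\<integral>w. g w * (T u w * H u w) \<partial>M))"
      unfolding sum_divide_distrib sum_product
      by (subst sum.swap) (auto simp: PI_Suc field_simps intro!: sum.cong)
    also have "(\<Sum>u\<in>trunc_seqs K n. 1 / PI n * (\<integral>w. g w * (T u w * H u w) \<partial>M))
      = (\<integral>w. (\<Sum>u\<in>trunc_seqs K n. 1 / PI n * (g w * (T u w * H u w))) \<partial>M)"
      using termI trunc_seqsD(1) by (subst Bochner_Integration.integral_sum) (auto intro!: termI)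
    also have "\<dots> = (\<integral>w. g w * YK K n w \<partial>M)"
      unfolding YK_def by (simp add: sum_distrib_left mult_ac)
    finally show ?thesis .
  qed
  have c: "?c \<longlonglongrightarrow> 1"
  proof -
    have "(\<lambda>K. measure_pmf.expectation (p (\<xi> n)) (\<lambda>k. real (min k K))) \<longlonglongrightarrow> measure_pmf.expectation (p (\<xi> n)) real"
    proof (rule integral_dominated_convergence[where w=real])
      show "AE k in measure_pmf (p (\<xi> n)). (\<lambda>K. real (min k K)) \<longlonglongrightarrow> real k"
        by (intro AE_I2 tendsto_eventually eventually_sequentiallyI) (auto simp: min_def)
    qed (auto intro: mean_int)
    moreover have "(\<Sum>i=1..K. measure_pmf.prob (p (\<xi> n)) {k. i \<le> k}) = measure_pmf.expectation (p (\<xi> n)) (\<lambda>k. real (min k K))" for K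
      using sum_prob_ge[of "p (\<xi> n)" "\<lambda>_. True" K] by simp
    ultimately have "(\<lambda>K. (\<Sum>i=1..K. measure_pmf.prob (p (\<xi> n)) {k. i \<le> k})) \<longlonglongrightarrow> m n"
      by (simp add: mean_offspring_eq)
    from tendsto_divide[OF this tendsto_const[of "m n"]] mean_pos[of n] show ?thesis by simp
  qed
  have "(\<lambda>K. \<integral>w. g w * YK K (Suc n) w \<partial>M) \<longlonglongrightarrow> 1 * (\<integral>w. g w * Y n w \<partial>M)"
    unfolding step by (rule tendsto_mult[OF c sub])
  with sub[of "Suc n"] show ?thesis using LIMSEQ_unique by fastforce
qed

end

section \<open>Quenched increments\<close>

lemma integrable_mult_of_squares:
  fixes f g :: "'a \<Rightarrow> real"
  assumes [measurable]: "f \<in> borel_measurable M" "g \<in> borel_measurable M"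
    and "integrable M (\<lambda>w. (f w)\<^sup>2)" "integrable M (\<lambda>w. (g w)\<^sup>2)"
  shows "integrable M (\<lambda>w. f w * g w)"
proof (rule Bochner_Integration.integrable_bound)
  show "integrable M (\<lambda>w. (f w)\<^sup>2 + (g w)\<^sup>2)" using assms by simp
  show "AE w in M. norm (f w * g w) \<le> norm ((f w)\<^sup>2 + (g w)\<^sup>2)"
  proof (rule AE_I2)
    fix w
    have "2 * (\<bar>f w\<bar> * \<bar>g w\<bar>) \<le> (f w)\<^sup>2 + (g w)\<^sup>2"
      using sum_squares_bound[of "\<bar>f w\<bar>" "\<bar>g w\<bar>"] by (simp add: mult.assoc)
    then have "\<bar>f w\<bar> * \<bar>g w\<bar> \<le> (f w)\<^sup>2 + (g w)\<^sup>2" by (smt (verit) mult_nonneg_nonneg abs_ge_zero)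
    then show "norm (f w * g w) \<le> norm ((f w)\<^sup>2 + (g w)\<^sup>2)" by (simp add: abs_mult)
  qed
qed measurable

lemma integrable_square_add:
  fixes f g :: "'a \<Rightarrow> real"
  assumes [measurable]: "f \<in> borel_measurable M" "g \<in> borel_measurable M"
    and "integrable M (\<lambda>w. (f w)\<^sup>2)" "integrable M (\<lambda>w. (g w)\<^sup>2)"
  shows "integrable M (\<lambda>w. (f w + g w)\<^sup>2)"
proof -
  have "integrable M (\<lambda>w. (f w)\<^sup>2 + (g w)\<^sup>2 + 2 * (f w * g w))"
    using assms integrable_mult_of_squares[OF assms] by simp
  then show ?thesis by (simp add: power2_sum mult.assoc)
qed

lemma integrable_square_sum:
  fixes f :: "'i \<Rightarrow> 'a \<Rightarrow> real"
  assumes "finite I" "\<And>i. i \<in> I \<Longrightarrow> f i \<in> borel_measurable M"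
    "\<And>i. i \<in> I \<Longrightarrow> integrable M (\<lambda>w. (f i w)\<^sup>2)"
  shows "integrable M (\<lambda>w. (\<Sum>i\<in>I. f i w)\<^sup>2)"
  using assms
proof (induction I rule: finite_induct)
  case (insert i I)
  then have "integrable M (\<lambda>w. (f i w + (\<Sum>i\<in>I. f i w))\<^sup>2)"
    by (intro integrable_square_add borel_measurable_sum) auto
  with insert show ?case by simp
qed simp

text \<open>Jensen's inequality, read off from the nonnegative variance of the absolute
  value.\<close>

lemma (in prob_space) integral_abs_le_sqrt:
  fixes f :: "'a \<Rightarrow> real"
  assumes [measurable]: "f \<in> borel_measurable M" and sq: "integrable M (\<lambda>w. (f w)\<^sup>2)"
  shows "integrable M f" "(\<integral>w. \<bar>f w\<bar> \<partial>M) \<le> sqrt (\<integral>w. (f w)\<^sup>2 \<partial>M)"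
proof -
  have "integrable M (\<lambda>w. f w * 1)"
    by (rule integrable_mult_of_squares) (use sq in auto)
  then show f: "integrable M f" by simp
  have "0 \<le> variance (\<lambda>w. \<bar>f w\<bar>)" by (rule variance_positive)
  also have "\<dots> = (\<integral>w. (f w)\<^sup>2 \<partial>M) - (\<integral>w. \<bar>f w\<bar> \<partial>M)\<^sup>2"
    using f sq by (subst variance_eq) auto
  finally show "(\<integral>w. \<bar>f w\<bar> \<partial>M) \<le> sqrt (\<integral>w. (f w)\<^sup>2 \<partial>M)"
    by (intro real_le_rsqrt) simp
qed

text \<open>The second moments \<open>R2\<close> are kept apart from \<open>R\<close>: the
  martingale property uses displacement moments of order \<nu>, the rate uses order 2\<nu>.\<close>

locale quenched_square = quenched_poly p G \<xi> pol R
  for p :: "'e \<Rightarrow> nat pmf" and G :: "'e \<Rightarrow> real measure" and \<xi> :: "nat \<Rightarrow> 'e"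
    and pol :: "nat \<Rightarrow> real \<Rightarrow> real" and R :: "nat \<Rightarrow> real" +
  fixes R2 :: "nat \<Rightarrow> real"
  assumes sq_int: "\<And>v. v \<in> seqs \<Longrightarrow>
      integrable M (\<lambda>w. (pol (length v) (position w v - ell p G (length v) \<xi>))\<^sup>2)"
    and sq_bound: "\<And>v. v \<in> seqs \<Longrightarrow>
      (\<integral>w. (pol (length v) (position w v - ell p G (length v) \<xi>))\<^sup>2 \<partial>M) \<le> R2 (length v)"
begin

lemma H_sq_int: "v \<in> seqs \<Longrightarrow> integrable M (\<lambda>w. (H v w)\<^sup>2)"
  using sq_int by (simp add: H_def)

lemma H_sq_bound: "v \<in> seqs \<Longrightarrow> (\<integral>w. (H v w)\<^sup>2 \<partial>M) \<le> R2 (length v)"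
  using sq_bound by (simp add: H_def)

lemma R2_nonneg: "0 \<le> R2 n"
proof -
  have "0 \<le> (\<integral>w. (H (replicate n 1) w)\<^sup>2 \<partial>M)" by simp
  also have "\<dots> \<le> R2 n" using H_sq_bound[of "replicate n 1"] by simp
  finally show ?thesis .
qed

context
  fixes K b n :: nat
begin

text \<open>By \<open>sum_prob_ge\<close> this is the mean of min(N, K) on the event N \<le> b,
  divided by \<open>m n\<close>: the factor by which the retained children reproduce
  \<open>H u\<close> on average.\<close>

definition \<alpha> :: real where
  "\<alpha> = (\<Sum>i=1..K. measure_pmf.prob (p (\<xi> n)) {k. i \<le> k \<and> k \<le> b}) / m n"

text \<open>The increment contributed by \<open>u\<close> when its offspring is discarded if \<open>N\<^sub>u > b\<close>; the
  factor \<open>\<alpha>\<close> makes it centred given the past.\<close>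

definition X :: "nat list \<Rightarrow> process \<Rightarrow> real" where
  "X u w = 1 / m n * (\<Sum>i=1..K. of_bool (i \<le> offspring w u \<and> offspring w u \<le> b) * H (u @ [i]) w) - \<alpha> * H u w"

lemma \<alpha>_bounds: "0 \<le> \<alpha>" "\<alpha> \<le> 1"
proof -
  show "0 \<le> \<alpha>" unfolding \<alpha>_def using mean_pos[of n] by (intro divide_nonneg_pos sum_nonneg) auto
  have "(\<Sum>i=1..K. measure_pmf.prob (p (\<xi> n)) {k. i \<le> k \<and> k \<le> b}) \<le> m n"
    unfolding sum_prob_ge mean_offspring_eq
    by (intro integral_mono mean_int measure_pmf.integrable_const_bound[where B=K]) auto
  then show "\<alpha> \<le> 1" unfolding \<alpha>_def using mean_pos[of n] by simp
qed

lemma X_meas [measurable]: "u \<in> seqs \<Longrightarrow> X u \<in> borel_measurable M"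
proof -
  assume u [measurable]: "u \<in> seqs"
  have [measurable]: "H (u @ [i]) \<in> borel_measurable M" if "i \<in> {1..K}" for i
    using that u by (intro H_meas) auto
  show ?thesis unfolding X_def[abs_def] by measurable
qed

lemma of_bool_H_sq_int:
  assumes "v \<in> seqs" and [measurable]: "t \<in> borel_measurable M" and t: "\<And>w. \<bar>t w\<bar> \<le> 1"
  shows "integrable M (\<lambda>w. (t w * H v w)\<^sup>2)"
proof (rule Bochner_Integration.integrable_bound[OF H_sq_int[OF assms(1)]])
  show "AE w in M. norm ((t w * H v w)\<^sup>2) \<le> norm ((H v w)\<^sup>2)"
  proof (rule AE_I2)
    fix w
    have "(t w)\<^sup>2 \<le> 1" using t[of w] by (simp add: abs_square_le_1)
    then show "norm ((t w * H v w)\<^sup>2) \<le> norm ((H v w)\<^sup>2)"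
      by (simp add: power_mult_distrib mult_left_le_one_le)
  qed
  show "(\<lambda>w. (t w * H v w)\<^sup>2) \<in> borel_measurable M" using assms(1) by measurable
qed

lemma X_sq_int:
  assumes u: "u \<in> seqs"
  shows "integrable M (\<lambda>w. (X u w)\<^sup>2)"
proof -
  note [measurable] = u
  let ?S = "\<lambda>w. \<Sum>i=1..K. of_bool (i \<le> offspring w u \<and> offspring w u \<le> b) * H (u @ [i]) w"
  have 1: "integrable M (\<lambda>w. (?S w)\<^sup>2)"
    using u by (intro integrable_square_sum of_bool_H_sq_int) auto
  have [measurable]: "?S \<in> borel_measurable M"
    using u by (intro borel_measurable_sum borel_measurable_times H_meas) auto
  have "integrable M (\<lambda>w. (1 / m n * ?S w + (- \<alpha> * H u w))\<^sup>2)"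
  proof (rule integrable_square_add)
    show "integrable M (\<lambda>w. (1 / m n * ?S w)\<^sup>2)"
      unfolding power_mult_distrib using 1 by (intro integrable_mult_right)
    show "integrable M (\<lambda>w. (- \<alpha> * H u w)\<^sup>2)"
      unfolding power_mult_distrib using H_sq_int[OF u] by (intro integrable_mult_right)
  qed measurable
  then show ?thesis by (simp add: X_def)
qed

lemma TX_sq_int:
  assumes u: "u \<in> seqs"
  shows "integrable M (\<lambda>w. (T u w * X u w)\<^sup>2)"
proof (rule Bochner_Integration.integrable_bound[OF X_sq_int[OF u]])
  show "AE w in M. norm ((T u w * X u w)\<^sup>2) \<le> norm ((X u w)\<^sup>2)"
    by (rule AE_I2) (simp add: T_def)
  show "(\<lambda>w. (T u w * X u w)\<^sup>2) \<in> borel_measurable M" using u by measurable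
qed

text \<open>The factor belonging to \<open>v\<close> reads neither N_u nor the displacements of the
  children of \<open>u\<close>, so \<open>child_centering\<close> applies with it as
  \<open>Z\<close>. The means of the retained children then add up to \<alpha> times
  \<open>H u\<close>, which is what \<open>X\<close> subtracts.\<close>

lemma cross_term:
  assumes u: "u \<in> seqs" "length u = n" and v: "v \<in> seqs" "length v = n" and "u \<noteq> v"
  shows "(\<integral>w. T v w * X v w * (T u w * X u w) \<partial>M) = 0"
proof -
  define Z where "Z = (\<lambda>w. T v w * X v w)"
  note [measurable] = u(1) v(1)
  have Z [measurable]: "Z \<in> borel_measurable M" unfolding Z_def by measurable
  have Z_sq: "integrable M (\<lambda>w. (Z w)\<^sup>2)" unfolding Z_def by (rule TX_sq_int[OF v(1)])
  have Z_off: "Z ((fst w)(u := k), snd w) = Z w" for w k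
    using u v \<open>u \<noteq> v\<close>
    by (simp add: Z_def X_def T_resample_offspring H_resample_offspring)
  have Z_dis: "Z (fst w, (snd w)(u @ [i] := x)) = Z w" for w x i
  proof -
    have "H (v @ [j]) (fst w, (snd w)(u @ [i] := x)) = H (v @ [j]) w" for j
      using u v \<open>u \<noteq> v\<close> by (intro H_resample_displ) auto
    moreover have "H v (fst w, (snd w)(u @ [i] := x)) = H v w"
      using u v by (intro H_resample_displ) auto
    ultimately show ?thesis by (simp add: Z_def X_def T_resample_displ)
  qed
  have int0: "integrable M (\<lambda>w. Z w * T u w * H u w)"
    using integrable_mult_of_squares[OF Z _ Z_sq of_bool_H_sq_int[OF u(1) T_meas[OF u(1)] T_bounds(3)]]
    by (simp add: mult.assoc)
  have int1: "integrable M (\<lambda>w. Z w * T u w * H (u @ [i]) w)" if "1 \<le> i" for i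
  proof -
    have ui [measurable]: "u @ [i] \<in> seqs" using u that by simp
    show ?thesis
      using integrable_mult_of_squares[OF Z _ Z_sq of_bool_H_sq_int[OF ui T_meas[OF u(1)] T_bounds(3)]]
      by (simp add: mult.assoc)
  qed
  let ?h = "\<lambda>i k. of_bool (i \<le> k \<and> k \<le> b) :: real"
  have c: "integrable M (\<lambda>w. Z w * T u w * ?h i (offspring w u) * H (u @ [i]) w)"
    "(\<integral>w. Z w * T u w * ?h i (offspring w u) * H (u @ [i]) w \<partial>M)
      = measure_pmf.prob (p (\<xi> n)) {k. i \<le> k \<and> k \<le> b} * (\<integral>w. Z w * T u w * H u w \<partial>M)" if i: "1 \<le> i" for i
  proof -
    have h: "\<bar>?h i k\<bar> \<le> 1" for k by simp
    show "integrable M (\<lambda>w. Z w * T u w * ?h i (offspring w u) * H (u @ [i]) w)"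
      by (rule child_centering(2)[where h="?h i", OF u(1) i Z Z_off Z_dis h int1[OF i]])
    have "measure_pmf.expectation (p (\<xi> n)) (?h i) = measure_pmf.expectation (p (\<xi> n)) (indicator {k. i \<le> k \<and> k \<le> b})"
      by (intro Bochner_Integration.integral_cong) (auto simp: indicator_def)
    then show "(\<integral>w. Z w * T u w * ?h i (offspring w u) * H (u @ [i]) w \<partial>M)
      = measure_pmf.prob (p (\<xi> n)) {k. i \<le> k \<and> k \<le> b} * (\<integral>w. Z w * T u w * H u w \<partial>M)"
      using child_centering(3)[where h="?h i", OF u(1) i Z Z_off Z_dis h int1[OF i]] u(2) by simp
  qed
  have "(\<integral>w. Z w * (T u w * X u w) \<partial>M)
    = (\<integral>w. 1 / m n * (\<Sum>i=1..K. Z w * T u w * ?h i (offspring w u) * H (u @ [i]) w) - \<alpha> * (Z w * T u w * H u w) \<partial>M)"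
    by (intro Bochner_Integration.integral_cong refl)
       (simp add: X_def sum_distrib_left algebra_simps del: sum_mult_of_bool_eq sum_of_bool_mult_eq)
  also have "\<dots> = 1 / m n * (\<Sum>i=1..K. \<integral>w. Z w * T u w * ?h i (offspring w u) * H (u @ [i]) w \<partial>M)
      - \<alpha> * (\<integral>w. Z w * T u w * H u w \<partial>M)"
  proof -
    have i: "integrable M (\<lambda>w. \<Sum>i=1..K. Z w * T u w * ?h i (offspring w u) * H (u @ [i]) w)"
      using c(1) by (intro Bochner_Integration.integrable_sum) simp
    have e: "(\<integral>w. (\<Sum>i=1..K. Z w * T u w * ?h i (offspring w u) * H (u @ [i]) w) \<partial>M)
       = (\<Sum>i=1..K. \<integral>w. Z w * T u w * ?h i (offspring w u) * H (u @ [i]) w \<partial>M)"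
      using c(1) by (intro Bochner_Integration.integral_sum) simp
    show ?thesis
      by (simp only: Bochner_Integration.integral_diff[OF integrable_mult_right[OF i] integrable_mult_right[OF int0]]
          integral_mult_right_zero e)
  qed
  also have "\<dots> = 0"
    using c(2) by (simp add: \<alpha>_def sum_distrib_right[symmetric])
  finally show ?thesis by (simp add: Z_def mult_ac)
qed

text \<open>At most \<open>b\<close> children are retained, so Cauchy-Schwarz costs a factor
  \<open>b\<close>; the tree probabilities of the children add up to at most \<open>m n\<close>
  times that of \<open>u\<close>, which cancels one of the two factors \<open>1 / m n\<close>. What
  is left is the ratio \<open>b / m n\<close>.\<close>

lemma diagonal_term:
  assumes u: "u \<in> seqs" "length u = n"
  shows "(\<integral>w. (T u w * X u w)\<^sup>2 \<partial>M) \<le> tree_prob u * (2 * (real b / m n * R2 (Suc n) + R2 n))"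
proof -
  let ?c = "2 * (1 / m n)\<^sup>2 * real b"
  have ui: "u @ [i] \<in> seqs" if "i \<in> {1..K}" for i using u that by simp
  have pt: "(T u w * X u w)\<^sup>2 \<le> ?c * (\<Sum>i=1..K. T (u @ [i]) w * (H (u @ [i]) w)\<^sup>2) + 2 * (T u w * (H u w)\<^sup>2)" for w
  proof -
    let ?t = "\<lambda>i. of_bool (i \<le> offspring w u \<and> offspring w u \<le> b) :: real"
    let ?S = "\<Sum>i=1..K. ?t i * H (u @ [i]) w"
    \<comment> \<open>Doubling the idempotent indicator makes Cauchy-Schwarz count the nonzero
      terms, at most \<open>b\<close>, instead of all \<open>K\<close>.\<close>
    have "?S\<^sup>2 = (\<Sum>i=1..K. ?t i * (?t i * H (u @ [i]) w))\<^sup>2"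
      by (intro arg_cong[where f="\<lambda>x. x\<^sup>2"] sum.cong) auto
    also have "\<dots> \<le> (\<Sum>i=1..K. (?t i)\<^sup>2) * (\<Sum>i=1..K. (?t i * H (u @ [i]) w)\<^sup>2)"
      by (rule Cauchy_Schwarz_ineq_sum)
    also have "\<dots> \<le> real b * (\<Sum>i=1..K. of_bool (i \<le> offspring w u) * (H (u @ [i]) w)\<^sup>2)"
    proof (intro mult_mono sum_mono)
      have "(\<Sum>i=1..K. (?t i)\<^sup>2) \<le> (\<Sum>i=1..K. of_bool (i \<in> {1..b}))"
        by (intro sum_mono) auto
      also have "\<dots> = real (card ({1..K} \<inter> {1..b}))"
        by (simp add: of_bool_def sum.If_cases Int_def del: atLeastAtMost_iff One_nat_def)
      also have "\<dots> \<le> real b"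
        using card_mono[of "{1..b}" "{1..K} \<inter> {1..b}"] by simp
      finally show "(\<Sum>i=1..K. (?t i)\<^sup>2) \<le> real b" .
    qed (auto simp: power_mult_distrib intro!: sum_nonneg)
    finally have S: "?S\<^sup>2 \<le> real b * (\<Sum>i=1..K. of_bool (i \<le> offspring w u) * (H (u @ [i]) w)\<^sup>2)" .
    have "(X u w)\<^sup>2 = (1 / m n * ?S - \<alpha> * H u w)\<^sup>2" by (simp add: X_def)
    also have "\<dots> \<le> 2 * (1 / m n * ?S)\<^sup>2 + 2 * (\<alpha> * H u w)\<^sup>2"
      using zero_le_power2[of "1 / m n * ?S + \<alpha> * H u w"] by (simp add: power2_eq_square algebra_simps)
    also have "\<dots> = 2 * (1 / m n)\<^sup>2 * ?S\<^sup>2 + 2 * (\<alpha>\<^sup>2 * (H u w)\<^sup>2)"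
      by (simp only: power_mult_distrib mult.assoc)
    also have "\<dots> \<le> 2 * (1 / m n)\<^sup>2 * (real b * (\<Sum>i=1..K. of_bool (i \<le> offspring w u) * (H (u @ [i]) w)\<^sup>2))
       + 2 * (1 * (H u w)\<^sup>2)"
      using \<alpha>_bounds by (intro add_mono mult_left_mono mult_right_mono S) (auto simp: power_le_one)
    finally have X: "(X u w)\<^sup>2 \<le> ?c * (\<Sum>i=1..K. of_bool (i \<le> offspring w u) * (H (u @ [i]) w)\<^sup>2) + 2 * (H u w)\<^sup>2"
      by (simp add: mult.assoc)
    have "(\<Sum>i=1..K. T (u @ [i]) w * (H (u @ [i]) w)\<^sup>2)
      = T u w * (\<Sum>i=1..K. of_bool (i \<le> offspring w u) * (H (u @ [i]) w)\<^sup>2)"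
      unfolding sum_distrib_left by (intro sum.cong refl) (simp add: T_snoc)
    then show ?thesis using X by (cases "u \<in> tree w") (simp_all add: T_def)
  qed
  have i1: "integrable M (\<lambda>w. T v w * (H v w)\<^sup>2)" if "v \<in> seqs" for v
    using T_integral(1)[of v "\<lambda>x. x\<^sup>2"] H_sq_int that by auto
  have i2: "(\<integral>w. T v w * (H v w)\<^sup>2 \<partial>M) \<le> tree_prob v * R2 (length v)" if "v \<in> seqs" for v
    using T_integral(2)[of v "\<lambda>x. x\<^sup>2"] H_sq_int[OF that] H_sq_bound[OF that] that tree_prob_nonneg[of v]
    by (simp add: mult_left_mono)
  have "(\<integral>w. (T u w * X u w)\<^sup>2 \<partial>M)
    \<le> (\<integral>w. ?c * (\<Sum>i=1..K. T (u @ [i]) w * (H (u @ [i]) w)\<^sup>2) + 2 * (T u w * (H u w)\<^sup>2) \<partial>M)"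
    using ui u by (intro integral_mono TX_sq_int Bochner_Integration.integrable_add integrable_mult_right
        Bochner_Integration.integrable_sum i1 pt)
  also have "\<dots> = ?c * (\<Sum>i=1..K. \<integral>w. T (u @ [i]) w * (H (u @ [i]) w)\<^sup>2 \<partial>M) + 2 * (\<integral>w. T u w * (H u w)\<^sup>2 \<partial>M)"
  proof -
    have i: "integrable M (\<lambda>w. \<Sum>i=1..K. T (u @ [i]) w * (H (u @ [i]) w)\<^sup>2)"
      by (intro Bochner_Integration.integrable_sum i1 ui)
    have e: "(\<integral>w. (\<Sum>i=1..K. T (u @ [i]) w * (H (u @ [i]) w)\<^sup>2) \<partial>M)
       = (\<Sum>i=1..K. \<integral>w. T (u @ [i]) w * (H (u @ [i]) w)\<^sup>2 \<partial>M)"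
      by (rule Bochner_Integration.integral_sum) (rule i1[OF ui])
    show ?thesis
      by (simp only: Bochner_Integration.integral_add[OF integrable_mult_right[OF i] integrable_mult_right[OF i1[OF u(1)]]]
          integral_mult_right_zero e)
  qed
  also have "\<dots> \<le> ?c * (tree_prob u * m n * R2 (Suc n)) + 2 * (tree_prob u * R2 n)"
  proof (intro add_mono mult_left_mono)
    have "(\<Sum>i=1..K. \<integral>w. T (u @ [i]) w * (H (u @ [i]) w)\<^sup>2 \<partial>M) \<le> (\<Sum>i=1..K. tree_prob (u @ [i]) * R2 (Suc n))"
      using i2[OF ui] u(2) by (intro sum_mono) simp
    also have "\<dots> \<le> tree_prob u * m n * R2 (Suc n)"
      using sum_tree_prob_snoc[OF u(1), of K] R2_nonneg[of "Suc n"] u(2)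
      by (simp add: sum_distrib_right[symmetric] mult_right_mono)
    finally show "(\<Sum>i=1..K. \<integral>w. T (u @ [i]) w * (H (u @ [i]) w)\<^sup>2 \<partial>M) \<le> tree_prob u * m n * R2 (Suc n)" .
    show "(\<integral>w. T u w * (H u w)\<^sup>2 \<partial>M) \<le> tree_prob u * R2 n" using i2[OF u(1)] u(2) by simp
  qed auto
  also have "\<dots> = tree_prob u * (2 * (real b / m n * R2 (Suc n) + R2 n))"
    using mean_pos[of n] by (simp add: power2_eq_square field_simps)
  finally show ?thesis .
qed

text \<open>Orthogonality reduces the square of the sum to its diagonal, whose tree probabilities
  sum to at most \<open>PI n\<close>; dividing by the square of \<open>PI n\<close> leaves the decay
  \<open>1 / PI n\<close>, and Jensen turns this into a first-moment bound.\<close>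

lemma truncated_part_bound:
  shows "integrable M (\<lambda>w. 1 / PI n * (\<Sum>u\<in>trunc_seqs K n. T u w * X u w))"
    and "(\<integral>w. \<bar>1 / PI n * (\<Sum>u\<in>trunc_seqs K n. T u w * X u w)\<bar> \<partial>M)
      \<le> sqrt (2 * (real b / m n * R2 (Suc n) + R2 n) / PI n)"
proof -
  let ?S = "\<lambda>w. \<Sum>u\<in>trunc_seqs K n. T u w * X u w"
  let ?B = "2 * (real b / m n * R2 (Suc n) + R2 n)"
  have B: "0 \<le> ?B" using R2_nonneg mean_pos[of n] by simp
  have TXm: "(\<lambda>w. T u w * X u w) \<in> borel_measurable M" if "u \<in> trunc_seqs K n" for u
    using trunc_seqsD(1)[OF that] by measurable
  have Sm [measurable]: "?S \<in> borel_measurable M"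
    using TXm by (intro borel_measurable_sum)
  have S_sq: "integrable M (\<lambda>w. (?S w)\<^sup>2)"
    using TXm trunc_seqsD(1) by (intro integrable_square_sum TX_sq_int) auto
  have "(\<integral>w. (?S w)\<^sup>2 \<partial>M) = (\<integral>w. (\<Sum>v\<in>trunc_seqs K n. \<Sum>u\<in>trunc_seqs K n. T v w * X v w * (T u w * X u w)) \<partial>M)"
    by (simp add: power2_eq_square sum_product)
  also have "\<dots> = (\<Sum>v\<in>trunc_seqs K n. \<Sum>u\<in>trunc_seqs K n. \<integral>w. T v w * X v w * (T u w * X u w) \<partial>M)"
  proof -
    have "integrable M (\<lambda>w. T v w * X v w * (T u w * X u w))"
      if "u \<in> trunc_seqs K n" "v \<in> trunc_seqs K n" for u v
      using that TXm trunc_seqsD(1) by (intro integrable_mult_of_squares TX_sq_int) auto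
    then show ?thesis
      by (simp add: Bochner_Integration.integral_sum Bochner_Integration.integrable_sum)
  qed
  also have "\<dots> = (\<Sum>v\<in>trunc_seqs K n. \<Sum>u\<in>trunc_seqs K n. if u = v then (\<integral>w. (T v w * X v w)\<^sup>2 \<partial>M) else 0)"
    using cross_term trunc_seqsD by (intro sum.cong refl) (auto simp: power2_eq_square)
  also have "\<dots> = (\<Sum>v\<in>trunc_seqs K n. \<integral>w. (T v w * X v w)\<^sup>2 \<partial>M)"
    by simp
  also have "\<dots> \<le> (\<Sum>v\<in>trunc_seqs K n. tree_prob v * ?B)"
    using trunc_seqsD by (intro sum_mono diagonal_term) auto
  also have "\<dots> \<le> PI n * ?B"
    using sum_tree_prob B by (simp only: sum_distrib_right[symmetric] mult_right_mono)
  finally have le: "(\<integral>w. (?S w)\<^sup>2 \<partial>M) \<le> PI n * ?B" .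
  have i: "integrable M (\<lambda>w. (1 / PI n * ?S w)\<^sup>2)"
    unfolding power_mult_distrib using S_sq by (intro integrable_mult_right)
  show "integrable M (\<lambda>w. 1 / PI n * ?S w)"
    by (rule M.integral_abs_le_sqrt(1)[OF _ i]) measurable
  have "(\<integral>w. \<bar>1 / PI n * ?S w\<bar> \<partial>M) \<le> sqrt (\<integral>w. (1 / PI n * ?S w)\<^sup>2 \<partial>M)"
    by (rule M.integral_abs_le_sqrt(2)[OF _ i]) measurable
  also have "(\<integral>w. (1 / PI n * ?S w)\<^sup>2 \<partial>M) = (1 / PI n)\<^sup>2 * (\<integral>w. (?S w)\<^sup>2 \<partial>M)"
    unfolding power_mult_distrib by simp
  also have "sqrt \<dots> \<le> sqrt ((1 / PI n)\<^sup>2 * (PI n * ?B))"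
    using le by (intro real_sqrt_le_mono mult_left_mono) auto
  also have "(1 / PI n)\<^sup>2 * (PI n * ?B) = ?B / PI n"
    using PI_pos[of n] by (simp add: power2_eq_square)
  finally show "(\<integral>w. \<bar>1 / PI n * ?S w\<bar> \<partial>M) \<le> sqrt (?B / PI n)" .
qed

text \<open>What is left of the increment are the children in families larger than \<open>b\<close>
  and the share \<open>1 - \<alpha>\<close> of \<open>H u\<close> that compensates them. Each has
  first moment at most \<open>q\<close> times the bound on \<open>H\<close> in its generation, so
  absolute values can be taken throughout.\<close>

lemma removed_part_bound:
  assumes "b \<le> K"
  defines "q \<equiv> measure_pmf.expectation (p (\<xi> n)) (\<lambda>k. real k / m n * of_bool (k > b))"
  shows "(\<integral>w. \<bar>(YK K (Suc n) w - YK K n w) - 1 / PI n * (\<Sum>u\<in>trunc_seqs K n. T u w * X u w)\<bar> \<partial>M)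
     \<le> q * (R (Suc n) + R n)"
proof -
  let ?t = "\<lambda>i w u. of_bool (i \<le> offspring w u \<and> b < offspring w u) :: real"
  let ?P = "\<lambda>i. measure_pmf.prob (p (\<xi> n)) {k. i \<le> k \<and> b < k}"
  have ib: "integrable (measure_pmf (p (\<xi> n))) (\<lambda>k. real k * of_bool (P k))" for P
    by (rule Bochner_Integration.integrable_bound[OF mean_int[of n]]) auto
  have q0: "0 \<le> q" unfolding q_def using mean_pos[of n] by (intro Bochner_Integration.integral_nonneg) simp
  have qm: "q = measure_pmf.expectation (p (\<xi> n)) (\<lambda>k. real k * of_bool (k > b)) / m n"
    unfolding q_def by simp
  have P: "(\<Sum>i=1..K. ?P i) \<le> q * m n"
  proof -
    have "(\<Sum>i=1..K. ?P i) \<le> measure_pmf.expectation (p (\<xi> n)) (\<lambda>k. real k * of_bool (k > b))"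
      unfolding sum_prob_ge
      by (intro integral_mono ib measure_pmf.integrable_const_bound[where B=K]) auto
    then show ?thesis using mean_pos[of n] by (simp add: qm)
  qed
  \<comment> \<open>Here \<open>b \<le> K\<close> enters: a retained family has all its labels
    within \<open>1..K\<close>, so the truncation at \<open>K\<close> removes nothing from
    it.\<close>
  have \<alpha>q: "1 - \<alpha> = q"
  proof -
    have "(\<Sum>i=1..K. measure_pmf.prob (p (\<xi> n)) {k. i \<le> k \<and> k \<le> b})
        = measure_pmf.expectation (p (\<xi> n)) (\<lambda>k. real k * of_bool (k \<le> b))"
      unfolding sum_prob_ge using assms(1)
      by (intro Bochner_Integration.integral_cong) auto
    moreover have "measure_pmf.expectation (p (\<xi> n)) (\<lambda>k. real k * of_bool (k \<le> b))
       + measure_pmf.expectation (p (\<xi> n)) (\<lambda>k. real k * of_bool (k > b))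
       = measure_pmf.expectation (p (\<xi> n)) real"
      by (subst Bochner_Integration.integral_add[symmetric])
         (auto intro!: ib Bochner_Integration.integral_cong)
    ultimately show ?thesis using mean_pos[of n]
      by (simp add: qm \<alpha>_def mean_offspring_eq field_simps)
  qed
  have ident: "(YK K (Suc n) w - YK K n w) - 1 / PI n * (\<Sum>u\<in>trunc_seqs K n. T u w * X u w)
     = 1 / PI n * (\<Sum>u\<in>trunc_seqs K n. 1 / m n * (\<Sum>i=1..K. T u w * ?t i w u * H (u @ [i]) w) - q * (T u w * H u w))"
    (is "_ = 1 / PI n * ?E w") for w
  proof -
    have s: "(\<Sum>i=1..K. T (u @ [i]) w * H (u @ [i]) w)
        = (\<Sum>i=1..K. T u w * ?t i w u * H (u @ [i]) w)
          + T u w * (\<Sum>i=1..K. of_bool (i \<le> offspring w u \<and> offspring w u \<le> b) * H (u @ [i]) w)" for u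
      unfolding sum_distrib_left sum.distrib[symmetric]
      by (intro sum.cong refl) (auto simp: T_snoc)
    have "YK K (Suc n) w = 1 / PI n * (\<Sum>u\<in>trunc_seqs K n. 1 / m n * (\<Sum>i=1..K. T (u @ [i]) w * H (u @ [i]) w))"
      unfolding YK_def sum_trunc_seqs_Suc PI_Suc by (simp add: sum_distrib_left mult_ac)
    then have "(YK K (Suc n) w - YK K n w) - 1 / PI n * (\<Sum>u\<in>trunc_seqs K n. T u w * X u w)
      = 1 / PI n * (\<Sum>u\<in>trunc_seqs K n. 1 / m n * (\<Sum>i=1..K. T (u @ [i]) w * H (u @ [i]) w)
          - T u w * H u w - T u w * X u w)"
      by (simp add: YK_def sum_subtractf sum.distrib algebra_simps diff_divide_distrib add_divide_distrib)
    also have "\<dots> = 1 / PI n * ?E w"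
      unfolding s X_def \<alpha>q[symmetric]
      by (intro arg_cong[where f="\<lambda>x. 1 / PI n * x"] sum.cong refl) (simp add: algebra_simps)
    finally show ?thesis .
  qed
  \<comment> \<open>Absolute values are taken term by term, so that the independence of tree and
    displacements can be applied to each term.\<close>
  define F where "F w = 1 / PI n * (\<Sum>u\<in>trunc_seqs K n. 1 / m n * (\<Sum>i=1..K. T u w * ?t i w u * \<bar>H (u @ [i]) w\<bar>) + q * (T u w * \<bar>H u w\<bar>))" for w
  have pt: "\<bar>1 / PI n * ?E w\<bar> \<le> F w" for w
  proof -
    have "\<bar>?E w\<bar> \<le> (\<Sum>u\<in>trunc_seqs K n. 1 / m n * (\<Sum>i=1..K. T u w * ?t i w u * \<bar>H (u @ [i]) w\<bar>) + q * (T u w * \<bar>H u w\<bar>))"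
    proof (rule order_trans[OF sum_abs], rule sum_mono)
      fix u
      have "\<bar>\<Sum>i=1..K. T u w * ?t i w u * H (u @ [i]) w\<bar> \<le> (\<Sum>i=1..K. T u w * ?t i w u * \<bar>H (u @ [i]) w\<bar>)"
        by (rule order_trans[OF sum_abs]) (auto simp: abs_mult T_def intro!: sum_mono)
      then have "\<bar>1 / m n * (\<Sum>i=1..K. T u w * ?t i w u * H (u @ [i]) w)\<bar> \<le> 1 / m n * (\<Sum>i=1..K. T u w * ?t i w u * \<bar>H (u @ [i]) w\<bar>)"
        using mean_pos[of n] by (simp add: abs_mult divide_right_mono)
      moreover have "\<bar>q * (T u w * H u w)\<bar> = q * (T u w * \<bar>H u w\<bar>)"
        using q0 by (simp add: abs_mult T_def)
      ultimately show "\<bar>1 / m n * (\<Sum>i=1..K. T u w * ?t i w u * H (u @ [i]) w) - q * (T u w * H u w)\<bar>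
        \<le> 1 / m n * (\<Sum>i=1..K. T u w * ?t i w u * \<bar>H (u @ [i]) w\<bar>) + q * (T u w * \<bar>H u w\<bar>)"
        by linarith
    qed
    then show ?thesis using PI_pos[of n] by (simp add: F_def abs_mult divide_right_mono)
  qed
  have A: "integrable M (\<lambda>w. T u w * ?t i w u * \<bar>H (u @ [i]) w\<bar>)"
    "(\<integral>w. T u w * ?t i w u * \<bar>H (u @ [i]) w\<bar> \<partial>M) \<le> tree_prob u * ?P i * R (Suc n)"
    if u: "u \<in> trunc_seqs K n" and i: "i \<in> {1..K}" for u i
  proof -
    have us: "u \<in> seqs" "length u = n" and ui: "u @ [i] \<in> seqs" using u i trunc_seqsD by auto
    note [measurable] = us(1) ui
    have e: "T u w * ?t i w u = T u (fst w, undefined) * ?t i (fst w, undefined) u" for w :: process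
      using T_fst[of u w] by simp
    have ms: "(\<lambda>w. T u (fst w, undefined) * ?t i (fst w, undefined) u) \<in> borel_measurable M"
      unfolding e[symmetric] by measurable
    have bd: "\<bar>T u (a, undefined) * ?t i (a, undefined) u\<bar> \<le> 1" for a by (simp add: T_def)
    note * = integral_indep_T[where f=abs and t="\<lambda>a. T u (a, undefined) * ?t i (a, undefined) u",
        OF ui ms bd integrable_abs[OF H_integrable[OF ui]], folded e]
    show "integrable M (\<lambda>w. T u w * ?t i w u * \<bar>H (u @ [i]) w\<bar>)" by (rule *(1))
    have "(\<integral>w. T u w * ?t i w u \<partial>M) = tree_prob u * ?P i"
      using tree_offspring_prob[OF us(1), of "\<lambda>k. i \<le> k \<and> b < k"] us(2) by (simp add: T_def)
    then show "(\<integral>w. T u w * ?t i w u * \<bar>H (u @ [i]) w\<bar> \<partial>M) \<le> tree_prob u * ?P i * R (Suc n)"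
      using *(2) H_bound[OF ui] us(2) tree_prob_nonneg[of u] by (simp add: mult_left_mono)
  qed
  have A': "integrable M (\<lambda>w. T u w * \<bar>H u w\<bar>)" "(\<integral>w. T u w * \<bar>H u w\<bar> \<partial>M) \<le> tree_prob u * R n"
    if u: "u \<in> trunc_seqs K n" for u
  proof -
    have us: "u \<in> seqs" "length u = n" using u trunc_seqsD by auto
    note * = T_integral[where f=abs, OF us(1) integrable_abs[OF H_integrable[OF us(1)]]]
    show "integrable M (\<lambda>w. T u w * \<bar>H u w\<bar>)" by (rule *(1))
    show "(\<integral>w. T u w * \<bar>H u w\<bar> \<partial>M) \<le> tree_prob u * R n"
      unfolding *(2) using H_bound[OF us(1)] us(2) tree_prob_nonneg[of u] by (simp add: mult_left_mono)
  qed
  have Fi: "integrable M F"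
    unfolding F_def by (intro integrable_mult_right Bochner_Integration.integrable_sum
        Bochner_Integration.integrable_add A(1) A'(1))
  have "(\<integral>w. \<bar>1 / PI n * ?E w\<bar> \<partial>M) \<le> (\<integral>w. F w \<partial>M)"
  proof (rule integral_mono[OF _ Fi pt])
    have "(\<lambda>w. 1 / PI n * ?E w) \<in> borel_measurable M"
    proof -
      have [measurable]: "u \<in> seqs" "u @ [i] \<in> seqs" if "u \<in> trunc_seqs K n" "i \<in> {1..K}" for u i
        using that trunc_seqsD by auto
      have [measurable]: "u \<in> seqs" if "u \<in> trunc_seqs K n" for u
        using that trunc_seqsD by auto
      show ?thesis by measurable
    qed
    then show "integrable M (\<lambda>w. \<bar>1 / PI n * ?E w\<bar>)"
      by (intro integrable_abs, intro Bochner_Integration.integrable_bound[OF Fi] AE_I2)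
         (use pt in \<open>auto intro: order_trans[OF _ abs_ge_self]\<close>)
  qed
  also have "(\<integral>w. F w \<partial>M) = 1 / PI n * (\<Sum>u\<in>trunc_seqs K n. 1 / m n * (\<Sum>i=1..K. \<integral>w. T u w * ?t i w u * \<bar>H (u @ [i]) w\<bar> \<partial>M)
      + q * (\<integral>w. T u w * \<bar>H u w\<bar> \<partial>M))"
  proof -
    have 1: "integrable M (\<lambda>w. 1 / m n * (\<Sum>i=1..K. T u w * ?t i w u * \<bar>H (u @ [i]) w\<bar>))"
      "integrable M (\<lambda>w. q * (T u w * \<bar>H u w\<bar>))" if "u \<in> trunc_seqs K n" for u
      by (intro integrable_mult_right Bochner_Integration.integrable_sum A(1) that)
         (assumption | rule integrable_mult_right[OF A'(1)[OF that]])+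
    have 2: "(\<integral>w. (\<Sum>i=1..K. T u w * ?t i w u * \<bar>H (u @ [i]) w\<bar>) \<partial>M) = (\<Sum>i=1..K. \<integral>w. T u w * ?t i w u * \<bar>H (u @ [i]) w\<bar> \<partial>M)"
      if "u \<in> trunc_seqs K n" for u
      by (rule Bochner_Integration.integral_sum) (rule A(1)[OF that])
    have "(\<integral>w. F w \<partial>M) = 1 / PI n * (\<integral>w. (\<Sum>u\<in>trunc_seqs K n. 1 / m n * (\<Sum>i=1..K. T u w * ?t i w u * \<bar>H (u @ [i]) w\<bar>) + q * (T u w * \<bar>H u w\<bar>)) \<partial>M)"
      unfolding F_def by (rule integral_mult_right_zero)
    also have "(\<integral>w. (\<Sum>u\<in>trunc_seqs K n. 1 / m n * (\<Sum>i=1..K. T u w * ?t i w u * \<bar>H (u @ [i]) w\<bar>) + q * (T u w * \<bar>H u w\<bar>)) \<partial>M)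
      = (\<Sum>u\<in>trunc_seqs K n. \<integral>w. 1 / m n * (\<Sum>i=1..K. T u w * ?t i w u * \<bar>H (u @ [i]) w\<bar>) + q * (T u w * \<bar>H u w\<bar>) \<partial>M)"
      by (rule Bochner_Integration.integral_sum) (intro Bochner_Integration.integrable_add 1)
    also have "\<dots> = (\<Sum>u\<in>trunc_seqs K n. 1 / m n * (\<Sum>i=1..K. \<integral>w. T u w * ?t i w u * \<bar>H (u @ [i]) w\<bar> \<partial>M)
      + q * (\<integral>w. T u w * \<bar>H u w\<bar> \<partial>M))"
      by (intro sum.cong refl) (simp only: Bochner_Integration.integral_add[OF 1] integral_mult_right_zero 2)
    finally show ?thesis .
  qed
  also have "\<dots> \<le> 1 / PI n * (\<Sum>u\<in>trunc_seqs K n. tree_prob u * (q * (R (Suc n) + R n)))"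
  proof (intro mult_left_mono sum_mono)
    fix u assume u: "u \<in> trunc_seqs K n"
    have "(\<Sum>i=1..K. \<integral>w. T u w * ?t i w u * \<bar>H (u @ [i]) w\<bar> \<partial>M) \<le> (\<Sum>i=1..K. tree_prob u * ?P i * R (Suc n))"
      by (intro sum_mono A(2) u)
    also have "\<dots> = tree_prob u * R (Suc n) * (\<Sum>i=1..K. ?P i)"
      by (simp add: sum_distrib_left mult_ac)
    also have "\<dots> \<le> tree_prob u * R (Suc n) * (q * m n)"
      using P R_nonneg tree_prob_nonneg by (intro mult_left_mono) auto
    finally have "1 / m n * (\<Sum>i=1..K. \<integral>w. T u w * ?t i w u * \<bar>H (u @ [i]) w\<bar> \<partial>M) \<le> tree_prob u * R (Suc n) * q"
      using mean_pos[of n] by (simp add: field_simps)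
    moreover have "q * (\<integral>w. T u w * \<bar>H u w\<bar> \<partial>M) \<le> q * (tree_prob u * R n)"
      using A'(2)[OF u] q0 by (rule mult_left_mono)
    ultimately show "1 / m n * (\<Sum>i=1..K. \<integral>w. T u w * ?t i w u * \<bar>H (u @ [i]) w\<bar> \<partial>M) + q * (\<integral>w. T u w * \<bar>H u w\<bar> \<partial>M)
      \<le> tree_prob u * (q * (R (Suc n) + R n))"
      by (simp add: algebra_simps)
  qed (use PI_pos[of n] in simp)
  also have "\<dots> = 1 / PI n * ((\<Sum>u\<in>trunc_seqs K n. tree_prob u) * (q * (R (Suc n) + R n)))"
    by (simp only: sum_distrib_right)
  also have "\<dots> \<le> 1 / PI n * (PI n * (q * (R (Suc n) + R n)))"
    using sum_tree_prob q0 R_nonneg PI_pos[of n] by (intro mult_left_mono mult_right_mono) auto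
  also have "\<dots> = q * (R (Suc n) + R n)" using PI_pos[of n] by simp
  finally show ?thesis unfolding ident .
qed

end

text \<open>Both partial estimates are uniform in \<open>K\<close>, so Fatou applies. The cutoff
  \<open>b\<close> is still free and may later depend on \<open>n\<close> and on the
  environment.\<close>

theorem increment_bound:
  fixes b :: nat
  defines "q \<equiv> \<lambda>n. measure_pmf.expectation (p (\<xi> n)) (\<lambda>k. real k / m n * of_bool (k > b))"
  shows "(\<integral>w. \<bar>Y (Suc n) w - Y n w\<bar> \<partial>M)
    \<le> q n * (R (Suc n) + R n) + sqrt (2 * (real b / m n * R2 (Suc n) + R2 n) / PI n)"
proof -
  have YKi: "integrable M (YK K n)" for K n
    by (rule Bochner_Integration.integrable_bound[OF D_integrable[of n]])
       (auto intro!: AE_I2 order_trans[OF YK_le_D abs_ge_self])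
  let ?S = "\<lambda>K w. 1 / PI n * (\<Sum>u\<in>trunc_seqs K n. T u w * X K b n u w)"
  show ?thesis
  proof (rule integrable_Fatou(2)[where k=b and f="\<lambda>K w. YK K (Suc n) w - YK K n w"])
    fix K assume K: "b \<le> K"
    show "integrable M (\<lambda>w. YK K (Suc n) w - YK K n w)" by (intro Bochner_Integration.integrable_diff YKi)
    have S: "integrable M (?S K)" by (rule truncated_part_bound)
    have "(\<integral>w. \<bar>YK K (Suc n) w - YK K n w\<bar> \<partial>M)
       \<le> (\<integral>w. \<bar>(YK K (Suc n) w - YK K n w) - ?S K w\<bar> + \<bar>?S K w\<bar> \<partial>M)"
      by (intro integral_mono Bochner_Integration.integrable_add integrable_abs
          Bochner_Integration.integrable_diff YKi S order_trans[OF _ abs_triangle_ineq]) simp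
    also have "\<dots> = (\<integral>w. \<bar>(YK K (Suc n) w - YK K n w) - ?S K w\<bar> \<partial>M) + (\<integral>w. \<bar>?S K w\<bar> \<partial>M)"
      by (intro Bochner_Integration.integral_add integrable_abs Bochner_Integration.integrable_diff YKi S)
    also have "\<dots> \<le> q n * (R (Suc n) + R n) + sqrt (2 * (real b / m n * R2 (Suc n) + R2 n) / PI n)"
      unfolding q_def by (intro add_mono removed_part_bound truncated_part_bound K)
    finally show "(\<integral>w. \<bar>YK K (Suc n) w - YK K n w\<bar> \<partial>M)
       \<le> q n * (R (Suc n) + R n) + sqrt (2 * (real b / m n * R2 (Suc n) + R2 n) / PI n)" .
  qed (intro tendsto_diff YK_tendsto)
qed

end

section \<open>Moments of the centred positions\<close>

text \<open>Convexity of the power function. The factor \<open>real n\<close> on the left avoids the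
  exponent q - 1, so that q = 0 and n = 0 are covered.\<close>

lemma power_mean_sum:
  fixes x :: "nat \<Rightarrow> real"
  shows "real n * \<bar>\<Sum>k<n. x k\<bar> ^ q \<le> real n ^ q * (\<Sum>k<n. \<bar>x k\<bar> ^ q)"
proof (cases "n = 0")
  case False
  have "convex_on {0::real..} (\<lambda>x. x ^ q)"
    by (cases "even q") (auto intro: convex_power_odd convex_on_subset[OF convex_power_even])
  then have "(\<Sum>k<n. (1 / real n) *\<^sub>R \<bar>x k\<bar>) ^ q \<le> (\<Sum>k<n. (1 / real n) * \<bar>x k\<bar> ^ q)"
    using False by (intro convex_on_sum[of "{..<n}" "{0..}" "\<lambda>x. x ^ q"]) auto
  then have "((\<Sum>k<n. \<bar>x k\<bar>) / real n) ^ q \<le> (\<Sum>k<n. \<bar>x k\<bar> ^ q) / real n"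
    by (simp add: sum_divide_distrib)
  then have "(\<Sum>k<n. \<bar>x k\<bar>) ^ q * real n \<le> real n ^ q * (\<Sum>k<n. \<bar>x k\<bar> ^ q)"
    using False by (simp add: power_divide field_simps)
  moreover have "\<bar>\<Sum>k<n. x k\<bar> ^ q \<le> (\<Sum>k<n. \<bar>x k\<bar>) ^ q"
    by (intro power_mono sum_abs) simp
  ultimately show ?thesis
    using mult_left_mono[of "\<bar>\<Sum>k<n. x k\<bar> ^ q" "(\<Sum>k<n. \<bar>x k\<bar>) ^ q" "real n"] by (simp add: mult.commute)
qed simp

lemma power_mult_le_add:
  fixes x y :: real
  assumes "0 \<le> x" "0 \<le> y"
  shows "x ^ a * y ^ b \<le> x ^ (a + b) + y ^ (a + b)"
proof (cases "x \<le> y")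
  case True
  then have "x ^ a * y ^ b \<le> y ^ a * y ^ b" using assms by (intro mult_right_mono power_mono) auto
  then show ?thesis using assms by (simp add: power_add add_increasing)
next
  case False
  then have "x ^ a * y ^ b \<le> x ^ a * x ^ b" using assms by (intro mult_left_mono power_mono) auto
  then show ?thesis using assms by (simp add: power_add add_increasing2)
qed

lemma (in prob_space) integrable_abs_power_le:
  fixes f :: "'a \<Rightarrow> real"
  assumes [measurable]: "f \<in> borel_measurable M" and i: "integrable M (\<lambda>x. \<bar>f x\<bar> ^ Q)" and "r \<le> Q"
  shows "integrable M (\<lambda>x. \<bar>f x\<bar> ^ r)"
proof (rule Bochner_Integration.integrable_bound)
  show "integrable M (\<lambda>x. 1 + \<bar>f x\<bar> ^ Q)" using i by simp
  show "AE x in M. norm (\<bar>f x\<bar> ^ r) \<le> norm (1 + \<bar>f x\<bar> ^ Q)"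
  proof (rule AE_I2)
    fix x
    have "\<bar>f x\<bar> ^ r \<le> 1 + \<bar>f x\<bar> ^ Q"
    proof (cases "\<bar>f x\<bar> \<le> 1")
      case True
      then have "\<bar>f x\<bar> ^ r \<le> 1" by (simp add: power_le_one)
      then show ?thesis by (simp add: add_increasing2)
    next
      case False
      then have "\<bar>f x\<bar> ^ r \<le> \<bar>f x\<bar> ^ Q" using \<open>r \<le> Q\<close> by (intro power_increasing) auto
      then show ?thesis by simp
    qed
    then show "norm (\<bar>f x\<bar> ^ r) \<le> norm (1 + \<bar>f x\<bar> ^ Q)" by simp
  qed
qed measurable

text \<open>\<open>power_mult_le_add\<close> integrated over two independent variables, one at a
  time. It merges moments of orders \<open>a\<close> and \<open>b\<close>, taken under different
  laws, into moments of order \<open>a + b\<close>.\<close>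

lemma moment_product_le:
  fixes f g :: "_ \<Rightarrow> real"
  assumes "prob_space \<mu>" "prob_space \<nu>"
    and f: "f \<in> borel_measurable \<mu>" "integrable \<mu> (\<lambda>x. \<bar>f x\<bar> ^ (a + b))"
    and g: "g \<in> borel_measurable \<nu>" "integrable \<nu> (\<lambda>x. \<bar>g x\<bar> ^ (a + b))"
  shows "(\<integral>x. \<bar>f x\<bar> ^ a \<partial>\<mu>) * (\<integral>x. \<bar>g x\<bar> ^ b \<partial>\<nu>)
    \<le> (\<integral>x. \<bar>f x\<bar> ^ (a + b) \<partial>\<mu>) + (\<integral>x. \<bar>g x\<bar> ^ (a + b) \<partial>\<nu>)"
proof -
  interpret \<mu>: prob_space \<mu> by fact
  interpret \<nu>: prob_space \<nu> by fact
  have fa: "integrable \<mu> (\<lambda>x. \<bar>f x\<bar> ^ a)" by (rule \<mu>.integrable_abs_power_le[OF f]) simp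
  have gb: "integrable \<nu> (\<lambda>x. \<bar>g x\<bar> ^ b)" by (rule \<nu>.integrable_abs_power_le[OF g]) simp
  have 1: "(\<integral>x. \<bar>f x\<bar> ^ a \<partial>\<mu>) * \<bar>g y\<bar> ^ b \<le> (\<integral>x. \<bar>f x\<bar> ^ (a + b) \<partial>\<mu>) + \<bar>g y\<bar> ^ (a + b)" for y
  proof -
    have "(\<integral>x. \<bar>f x\<bar> ^ a * \<bar>g y\<bar> ^ b \<partial>\<mu>) \<le> (\<integral>x. \<bar>f x\<bar> ^ (a + b) + \<bar>g y\<bar> ^ (a + b) \<partial>\<mu>)"
      by (intro integral_mono integrable_mult_left fa Bochner_Integration.integrable_add f
          \<mu>.integrable_const power_mult_le_add) auto
    then show ?thesis using f by (simp add: \<mu>.prob_space)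
  qed
  have "(\<integral>y. (\<integral>x. \<bar>f x\<bar> ^ a \<partial>\<mu>) * \<bar>g y\<bar> ^ b \<partial>\<nu>) \<le> (\<integral>y. (\<integral>x. \<bar>f x\<bar> ^ (a + b) \<partial>\<mu>) + \<bar>g y\<bar> ^ (a + b) \<partial>\<nu>)"
    using 1 by (intro integral_mono integrable_mult_right gb Bochner_Integration.integrable_add g \<nu>.integrable_const)
  then show ?thesis using g by (simp add: \<nu>.prob_space)
qed

text \<open>Defined on the state space and not on environments, so that its values along \<xi> are
  i.i.d. and their means are integrals against \<tau>.\<close>

definition cabs_moment :: "('e \<Rightarrow> real measure) \<Rightarrow> nat \<Rightarrow> 'e \<Rightarrow> real" where
  "cabs_moment G q x = (\<integral>y. \<bar>y - (\<integral>z. z \<partial>G x)\<bar> ^ q \<partial>G x)"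

lemma cabs_moment_nonneg: "0 \<le> cabs_moment G q x"
  by (simp add: cabs_moment_def)

text \<open>The polynomial \<open>P\<^sub>n\<close> of the introduction; every \<open>\<nu>\<close> other than \<open>1\<close> and \<open>2\<close> is treated as \<open>3\<close>.\<close>

definition hpol :: "('e \<Rightarrow> nat pmf) \<Rightarrow> ('e \<Rightarrow> real measure) \<Rightarrow> nat \<Rightarrow> nat \<Rightarrow> (nat \<Rightarrow> 'e) \<Rightarrow> real \<Rightarrow> real" where
  "hpol p G \<nu> n \<xi> s = (if \<nu> = 1 then s else if \<nu> = 2 then s\<^sup>2 - s_mom p G 2 n \<xi>
     else s ^ 3 - 3 * s * s_mom p G 2 n \<xi> - s_mom p G 3 n \<xi>)"

context quenched
begin

lemma cpow_integrable:
  assumes Q: "integrable (G (\<xi> n)) (\<lambda>x. \<bar>x\<bar> ^ Q)" and "r \<le> Q" "1 \<le> Q"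
  shows "integrable (G (\<xi> n)) (\<lambda>x. \<bar>x - c\<bar> ^ r)" and "integrable (G (\<xi> n)) (\<lambda>x. (x - c) ^ r)"
proof -
  interpret D: prob_space "G (\<xi> n)" by (rule prob_G)
  have "integrable (G (\<xi> n)) (\<lambda>x. \<bar>x - c\<bar> ^ Q)"
  proof (rule Bochner_Integration.integrable_bound)
    show "integrable (G (\<xi> n)) (\<lambda>x. 2 ^ Q * (\<bar>x\<bar> ^ Q + \<bar>c\<bar> ^ Q))" using Q by simp
    show "AE x in G (\<xi> n). norm (\<bar>x - c\<bar> ^ Q) \<le> norm (2 ^ Q * (\<bar>x\<bar> ^ Q + \<bar>c\<bar> ^ Q))"
    proof (rule AE_I2)
      fix x
      have "\<bar>x - c\<bar> ^ Q \<le> (2 * max \<bar>x\<bar> \<bar>c\<bar>) ^ Q" by (intro power_mono) auto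
      also have "\<dots> = 2 ^ Q * (max \<bar>x\<bar> \<bar>c\<bar>) ^ Q" by (rule power_mult_distrib)
      also have "\<dots> \<le> 2 ^ Q * (\<bar>x\<bar> ^ Q + \<bar>c\<bar> ^ Q)" by (intro mult_left_mono) (auto simp: max_def)
      finally show "norm (\<bar>x - c\<bar> ^ Q) \<le> norm (2 ^ Q * (\<bar>x\<bar> ^ Q + \<bar>c\<bar> ^ Q))" by simp
    qed
  qed measurable
  then show *: "integrable (G (\<xi> n)) (\<lambda>x. \<bar>x - c\<bar> ^ r)"
    by (rule D.integrable_abs_power_le[rotated]) (use assms in auto)
  show "integrable (G (\<xi> n)) (\<lambda>x. (x - c) ^ r)"
    by (rule Bochner_Integration.integrable_bound[OF *]) (auto simp: power_abs)
qed

abbreviation "S q n \<equiv> (\<Sum>k<n. cabs_moment G q (\<xi> k))"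

lemma S_nonneg: "0 \<le> S q n"
  by (intro sum_nonneg cabs_moment_nonneg)

text \<open>The compensators in the polynomials produce products of lower moments. Such a product is
  traded for the top moment at the price of a factor 2n, because each of the n^2 pairs contributes
  two summands.\<close>

lemma moment_sum_product_le:
  assumes Q: "\<And>n. integrable (G (\<xi> n)) (\<lambda>x. \<bar>x\<bar> ^ Q)" and ab: "a + b \<le> Q" "1 \<le> Q"
  shows "S a n * S b n \<le> 2 * real n * S (a + b) n"
proof -
  let ?c = "\<lambda>q k. cabs_moment G q (\<xi> k)"
  have "S a n * S b n = (\<Sum>k<n. \<Sum>j<n. ?c a k * ?c b j)" by (rule sum_product)
  also have "\<dots> \<le> (\<Sum>k<n. \<Sum>j<n. ?c (a + b) k + ?c (a + b) j)"
    unfolding cabs_moment_def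
    by (intro sum_mono moment_product_le prob_G cpow_integrable[OF Q] ab) measurable
  also have "\<dots> = 2 * real n * S (a + b) n"
    by (simp add: sum.distrib sum_distrib_left[symmetric] sum_distrib_right[symmetric])
  finally show ?thesis .
qed

lemma s_mom_abs_le: "\<bar>s_mom p G r n \<xi>\<bar> \<le> S r n"
  unfolding s_mom_def
proof (rule order_trans[OF sum_abs], rule sum_mono)
  fix k
  show "\<bar>central_moment p G r k \<xi>\<bar> \<le> cabs_moment G r (\<xi> k)"
    unfolding central_moment_eq cabs_moment_def
    using integral_abs_bound[of "G (\<xi> k)" "\<lambda>x. (x - (\<integral>x. x \<partial>G (\<xi> k))) ^ r"] by (simp add: power_abs)
qed

abbreviation "cpos v w \<equiv> position w v - ell p G (length v) \<xi>"

text \<open>The power mean inequality, without cancellation between displacements, bounds the moment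
  of order r by n^(r-1) times a sum of n one-step moments. This is cruder than the central limit
  scale n^(r/2), but it is the growth that the exponent \<nu> of the rate permits.\<close>

lemma cpos_moment:
  assumes Q: "\<And>n. integrable (G (\<xi> n)) (\<lambda>x. \<bar>x\<bar> ^ Q)" and r: "r \<le> Q" "1 \<le> Q" and v: "v \<in> seqs"
  shows "integrable M (\<lambda>w. \<bar>cpos v w\<bar> ^ r)"
    and "real (length v) * (\<integral>w. \<bar>cpos v w\<bar> ^ r \<partial>M) \<le> real (length v) ^ r * S r (length v)"
proof -
  let ?n = "length v"
  let ?x = "\<lambda>k w. displ w (take (Suc k) v) - mean_displ p G k \<xi>"
  have cp: "cpos v w = (\<Sum>k<?n. ?x k w)" for w
    by (simp add: position_def ell_def sum_subtractf)
  have s: "take (Suc k) v \<in> seqs" "length (take (Suc k) v) = Suc k" if "k < ?n" for k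
    using that v by (auto simp: seqs_take)
  have i: "integrable M (\<lambda>w. \<bar>?x k w\<bar> ^ r)" "(\<integral>w. \<bar>?x k w\<bar> ^ r \<partial>M) = cabs_moment G r (\<xi> k)" if k: "k < ?n" for k
  proof -
    let ?h = "\<lambda>x. \<bar>x - mean_displ p G k \<xi>\<bar> ^ r"
    have h: "?h \<in> borel_measurable borel" by measurable
    show "integrable M (\<lambda>w. \<bar>?x k w\<bar> ^ r)"
      using integral_displ(2)[OF s[OF k] h] cpow_integrable(1)[OF Q r] by simp
    show "(\<integral>w. \<bar>?x k w\<bar> ^ r \<partial>M) = cabs_moment G r (\<xi> k)"
      using integral_displ(1)[OF s[OF k] h] by (simp add: cabs_moment_def mean_displ_eq)
  qed
  have i': "integrable M (\<lambda>w. real ?n ^ r * (\<Sum>k<?n. \<bar>?x k w\<bar> ^ r))"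
    using i(1) by (intro integrable_mult_right Bochner_Integration.integrable_sum) auto
  have [measurable]: "cpos v \<in> borel_measurable M" using v by measurable
  have pm: "real ?n * \<bar>cpos v w\<bar> ^ r \<le> real ?n ^ r * (\<Sum>k<?n. \<bar>?x k w\<bar> ^ r)" for w
    unfolding cp by (rule power_mean_sum)
  have int_n: "integrable M (\<lambda>w. real ?n * \<bar>cpos v w\<bar> ^ r)"
  proof (rule Bochner_Integration.integrable_bound[OF i'])
    show "AE w in M. norm (real ?n * \<bar>cpos v w\<bar> ^ r) \<le> norm (real ?n ^ r * (\<Sum>k<?n. \<bar>?x k w\<bar> ^ r))"
      by (intro AE_I2) (use pm in \<open>auto simp: abs_mult intro!: order_trans[OF _ abs_ge_self] simp flip: abs_mult\<close>)
  qed measurable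
  show "integrable M (\<lambda>w. \<bar>cpos v w\<bar> ^ r)"
  proof (cases "?n = 0")
    case True
    then show ?thesis by (simp add: position_def ell_def)
  next
    case False
    then show ?thesis using int_n by simp
  qed
  have "(\<integral>w. real ?n * \<bar>cpos v w\<bar> ^ r \<partial>M) \<le> (\<integral>w. real ?n ^ r * (\<Sum>k<?n. \<bar>?x k w\<bar> ^ r) \<partial>M)"
    by (rule integral_mono[OF int_n i' pm])
  also have "\<dots> = real ?n ^ r * (\<Sum>k<?n. \<integral>w. \<bar>?x k w\<bar> ^ r \<partial>M)"
    using i(1) by (simp add: Bochner_Integration.integral_sum)
  also have "\<dots> = real ?n ^ r * S r ?n" using i(2) by simp
  finally show "real ?n * (\<integral>w. \<bar>cpos v w\<bar> ^ r \<partial>M) \<le> real ?n ^ r * S r ?n" by simp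
qed

lemma cpos_moment':
  assumes Q: "\<And>n. integrable (G (\<xi> n)) (\<lambda>x. \<bar>x\<bar> ^ Q)" and r: "Suc r \<le> Q" and v: "v \<in> seqs"
  shows "(\<integral>w. \<bar>cpos v w\<bar> ^ Suc r \<partial>M) \<le> real (length v) ^ r * S (Suc r) (length v)"
proof (cases "length v = 0")
  case True
  then show ?thesis by (simp add: position_def ell_def)
next
  case False
  have "real (length v) * (\<integral>w. \<bar>cpos v w\<bar> ^ Suc r \<partial>M) \<le> real (length v) * (real (length v) ^ r * S (Suc r) (length v))"
    using cpos_moment(2)[OF Q _ _ v, of "Suc r"] r by (simp add: mult.assoc)
  then show ?thesis using False by simp
qed

lemma hpol_length_0:
  assumes "length v = 0"
  shows "hpol p G \<nu> (length v) \<xi> (cpos v w) = 0"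
  using assms by (simp add: hpol_def position_def ell_def s_mom_def)

text \<open>In the expansion of the next polynomial the term linear in the displacement vanishes by
  centring, and the central moments of orders 2 and 3 are exactly the increments of
  \<open>s_mom\<close> that are subtracted.\<close>

lemma hpol_mart:
  assumes \<nu>: "\<nu> \<in> {1, 2, 3}" and Q: "\<And>n. integrable (G (\<xi> n)) (\<lambda>x. \<bar>x\<bar> ^ \<nu>)"
  shows "(\<integral>x. hpol p G \<nu> (Suc n) \<xi> (s + (x - mean_displ p G n \<xi>)) \<partial>G (\<xi> n)) = hpol p G \<nu> n \<xi> s"
proof -
  interpret D: prob_space "G (\<xi> n)" by (rule prob_G)
  let ?y = "\<lambda>x. x - mean_displ p G n \<xi>"
  have i: "integrable (G (\<xi> n)) (\<lambda>x. (?y x) ^ r)" if "r \<le> \<nu>" for r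
    using that \<nu> by (intro cpow_integrable[OF Q]) auto
  have c: "(\<integral>x. (?y x) ^ r \<partial>G (\<xi> n)) = central_moment p G r n \<xi>" for r
    by (simp add: central_moment_eq mean_displ_eq)
  have i1: "integrable (G (\<xi> n)) ?y" using i[of 1] \<nu> by auto
  have "integrable (G (\<xi> n)) (\<lambda>x. ?y x + mean_displ p G n \<xi>)"
    using i1 by (rule Bochner_Integration.integrable_add) simp
  then have "integrable (G (\<xi> n)) (\<lambda>x. x)" by simp
  then have c1: "(\<integral>x. ?y x \<partial>G (\<xi> n)) = 0"
    by (simp add: mean_displ_eq D.prob_space)
  consider "\<nu> = 1" | "\<nu> = 2" | "\<nu> = 3" using \<nu> by auto
  then show ?thesis
  proof cases
    case 1
    then show ?thesis using i1 c1 by (simp add: hpol_def D.prob_space)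
  next
    case 2
    have "(\<integral>x. hpol p G \<nu> (Suc n) \<xi> (s + ?y x) \<partial>G (\<xi> n))
       = (\<integral>x. (s\<^sup>2 - s_mom p G 2 (Suc n) \<xi>) + (2 * s * ?y x + (?y x)\<^sup>2) \<partial>G (\<xi> n))"
      using 2 by (intro Bochner_Integration.integral_cong refl) (simp add: hpol_def power2_eq_square algebra_simps)
    also have "\<dots> = (s\<^sup>2 - s_mom p G 2 (Suc n) \<xi>) + (2 * s * (\<integral>x. ?y x \<partial>G (\<xi> n)) + (\<integral>x. (?y x)\<^sup>2 \<partial>G (\<xi> n)))"
      using i[of 2] 2 i1
      by (simp only: Bochner_Integration.integral_add Bochner_Integration.integrable_add D.integrable_const integrable_mult_right order_refl
          integral_mult_right_zero) (simp add: D.prob_space)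
    also have "\<dots> = hpol p G \<nu> n \<xi> s"
      unfolding c1 c by (simp add: hpol_def 2 s_mom_def)
    finally show ?thesis .
  next
    case 3
    have "(\<integral>x. hpol p G \<nu> (Suc n) \<xi> (s + ?y x) \<partial>G (\<xi> n))
       = (\<integral>x. (s ^ 3 - 3 * s * s_mom p G 2 (Suc n) \<xi> - s_mom p G 3 (Suc n) \<xi>)
          + ((3 * s\<^sup>2 - 3 * s_mom p G 2 (Suc n) \<xi>) * ?y x + (3 * s * (?y x)\<^sup>2 + (?y x) ^ 3)) \<partial>G (\<xi> n))"
      using 3 by (intro Bochner_Integration.integral_cong refl)
         (simp add: hpol_def power2_eq_square power3_eq_cube algebra_simps)
    also have "\<dots> = (s ^ 3 - 3 * s * s_mom p G 2 (Suc n) \<xi> - s_mom p G 3 (Suc n) \<xi>)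
          + ((3 * s\<^sup>2 - 3 * s_mom p G 2 (Suc n) \<xi>) * (\<integral>x. ?y x \<partial>G (\<xi> n))
             + (3 * s * (\<integral>x. (?y x)\<^sup>2 \<partial>G (\<xi> n)) + (\<integral>x. (?y x) ^ 3 \<partial>G (\<xi> n))))"
    proof -
      have j: "integrable (G (\<xi> n)) (\<lambda>x. (?y x)\<^sup>2)" "integrable (G (\<xi> n)) (\<lambda>x. (?y x) ^ 3)"
        using i[of 2] i[of 3] 3 by auto
      show ?thesis
        using j i1
        by (simp only: Bochner_Integration.integral_add Bochner_Integration.integrable_add D.integrable_const integrable_mult_right
          integral_mult_right_zero) (simp add: D.prob_space)
    qed
    also have "\<dots> = hpol p G \<nu> n \<xi> s"
      unfolding c1 c by (simp add: hpol_def 3 s_mom_def algebra_simps)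
    finally show ?thesis .
  qed
qed

lemma hpol_measurable [measurable]: "hpol p G \<nu> n \<xi> \<in> borel_measurable borel"
  unfolding hpol_def[abs_def] by measurable

text \<open>The constant 8 comes from \<nu> = 3: the cube, the mixed term and the compensator
  contribute 1, 6 and 1, where 6 is the coefficient 3 of the mixed term times the 2 of
  \<open>moment_sum_product_le\<close>.\<close>

lemma hpol_moment1:
  assumes \<nu>: "\<nu> \<in> {1, 2, 3}" and Q: "\<And>n. integrable (G (\<xi> n)) (\<lambda>x. \<bar>x\<bar> ^ \<nu>)" and v: "v \<in> seqs"
  shows "integrable M (\<lambda>w. hpol p G \<nu> (length v) \<xi> (cpos v w))" (is ?thesis1)
    and "(\<integral>w. \<bar>hpol p G \<nu> (length v) \<xi> (cpos v w)\<bar> \<partial>M) \<le> 8 * real (length v) ^ (\<nu> - 1) * S \<nu> (length v)" (is ?thesis2)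
proof -
  let ?n = "length v"
  have m [measurable]: "cpos v \<in> borel_measurable M" using v by measurable
  have i: "integrable M (\<lambda>w. \<bar>cpos v w\<bar> ^ r)" if "r \<le> \<nu>" for r
    using that \<nu> by (intro cpos_moment(1)[OF Q _ _ v]) auto
  have b: "(\<integral>w. \<bar>cpos v w\<bar> ^ Suc r \<partial>M) \<le> real ?n ^ r * S (Suc r) ?n" if "Suc r \<le> \<nu>" for r
    using that by (intro cpos_moment'[OF Q _ v])
  define B where "B w = (if \<nu> = 1 then \<bar>cpos v w\<bar> ^ 1 else if \<nu> = 2 then \<bar>cpos v w\<bar> ^ 2 + S 2 ?n
     else \<bar>cpos v w\<bar> ^ 3 + 3 * S 2 ?n * \<bar>cpos v w\<bar> ^ 1 + S 3 ?n)" for w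
  have Bi: "integrable M B"
    unfolding B_def using \<nu> i[of 1] i[of 2] i[of 3] by auto
  have pt: "\<bar>hpol p G \<nu> ?n \<xi> (cpos v w)\<bar> \<le> B w" for w
  proof -
    have g2: "\<bar>x\<^sup>2 - a\<bar> \<le> \<bar>x\<bar>\<^sup>2 + A" if "\<bar>a\<bar> \<le> A" for x a A :: real
      using that zero_le_power2[of x] unfolding power2_abs by linarith
    have g3: "\<bar>x ^ 3 - 3 * x * a - b\<bar> \<le> \<bar>x\<bar> ^ 3 + 3 * A * \<bar>x\<bar> ^ 1 + B"
      if "\<bar>a\<bar> \<le> A" "\<bar>b\<bar> \<le> B" for x a A b B :: real
    proof -
      have "\<bar>x * a\<bar> \<le> A * \<bar>x\<bar>"
        using mult_right_mono[OF that(1), of "\<bar>x\<bar>"] by (simp add: abs_mult mult.commute)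
      moreover have "\<bar>x ^ 3\<bar> = \<bar>x\<bar> ^ 3" by (rule power_abs)
      moreover have "3 * x * a = 3 * (x * a)" "3 * A * \<bar>x\<bar> ^ 1 = 3 * (A * \<bar>x\<bar>)" by simp_all
      ultimately show ?thesis using that(2) by linarith
    qed
    have "\<nu> = 1 \<or> \<nu> = 2 \<or> \<nu> = 3" using \<nu> by simp
    then show ?thesis
      using g2[of "s_mom p G 2 ?n \<xi>" "S 2 ?n" "cpos v w"]
        g3[of "s_mom p G 2 ?n \<xi>" "S 2 ?n" "s_mom p G 3 ?n \<xi>" "S 3 ?n" "cpos v w"]
        s_mom_abs_le[of 2 ?n] s_mom_abs_le[of 3 ?n]
      unfolding B_def hpol_def by (elim disjE) simp_all
  qed
  have hm: "(\<lambda>w. hpol p G \<nu> ?n \<xi> (cpos v w)) \<in> borel_measurable M" by measurable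
  show int: ?thesis1
    by (rule Bochner_Integration.integrable_bound[OF Bi hm])
       (auto intro!: AE_I2 order_trans[OF pt abs_ge_self])
  have le: "(\<integral>w. \<bar>hpol p G \<nu> ?n \<xi> (cpos v w)\<bar> \<partial>M) \<le> (\<integral>w. B w \<partial>M)"
    by (intro integral_mono integrable_abs int Bi pt)
  show ?thesis2
  proof (cases "?n = 0")
    case True
    then show ?thesis using hpol_length_0[of "[]"] by simp
  next
    case False
    then have n1: "1 \<le> real ?n" by (simp add: Suc_le_eq)
    consider "\<nu> = 1" | "\<nu> = 2" | "\<nu> = 3" using \<nu> by auto
    then show ?thesis
    proof cases
      case 1
      then have "(\<integral>w. B w \<partial>M) \<le> S 1 ?n" using b[of 0] by (simp add: B_def)
      then show ?thesis using le 1 S_nonneg[of 1 ?n] by simp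
    next
      case 2
      have "(\<integral>w. B w \<partial>M) = (\<integral>w. \<bar>cpos v w\<bar> ^ 2 \<partial>M) + S 2 ?n"
        using 2 i[of 2] by (simp add: B_def M.prob_space)
      also have "\<dots> \<le> real ?n * S 2 ?n + real ?n * S 2 ?n"
        using b[of 1] 2 n1 S_nonneg[of 2 ?n] mult_right_mono[OF n1 S_nonneg[of 2 ?n]]
        by (auto simp: numeral_2_eq_2)
      finally show ?thesis using le 2 n1 S_nonneg[of 2 ?n] by (auto simp: mult.assoc intro: order_trans)
    next
      case 3
      have "(\<integral>w. B w \<partial>M) = (\<integral>w. \<bar>cpos v w\<bar> ^ 3 \<partial>M) + 3 * S 2 ?n * (\<integral>w. \<bar>cpos v w\<bar> ^ 1 \<partial>M) + S 3 ?n"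
        using 3 i[of 3] i[of 1] by (simp add: B_def M.prob_space)
      also have "\<dots> \<le> real ?n ^ 2 * S 3 ?n + 3 * S 2 ?n * S 1 ?n + S 3 ?n"
        using b[of 2] b[of 0] 3 S_nonneg[of 2 ?n]
        by (intro add_mono mult_left_mono) (auto simp: eval_nat_numeral)
      finally have "(\<integral>w. B w \<partial>M) \<le> real ?n ^ 2 * S 3 ?n + 3 * S 2 ?n * S 1 ?n + S 3 ?n" .
      moreover have "3 * S 2 ?n * S 1 ?n \<le> 3 * (2 * (real ?n * S 3 ?n))"
        using moment_sum_product_le[OF Q, of 2 1 ?n] 3 by (simp add: mult_ac)
      moreover have "real ?n * S 3 ?n \<le> real ?n ^ 2 * S 3 ?n"
        using n1 S_nonneg by (intro mult_right_mono self_le_power) auto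
      moreover have "1 * S 3 ?n \<le> real ?n ^ 2 * S 3 ?n"
        using n1 S_nonneg by (intro mult_right_mono one_le_power)
      ultimately have "(\<integral>w. B w \<partial>M) \<le> 8 * (real ?n ^ 2 * S 3 ?n)" by linarith
      then show ?thesis using le 3 by (simp add: mult.assoc)
    qed
  qed
qed

text \<open>Again \<nu> = 3 decides the constant: squaring three summands gives 3 for the sixth
  power, 27 times 4 for the mixed term and 3 times 2 for the compensator, 117 in all.\<close>

lemma hpol_moment2:
  assumes \<nu>: "\<nu> \<in> {1, 2, 3}" and Q: "\<And>n. integrable (G (\<xi> n)) (\<lambda>x. \<bar>x\<bar> ^ (2 * \<nu>))" and v: "v \<in> seqs"
  shows "integrable M (\<lambda>w. (hpol p G \<nu> (length v) \<xi> (cpos v w))\<^sup>2)" (is ?thesis1)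
    and "(\<integral>w. (hpol p G \<nu> (length v) \<xi> (cpos v w))\<^sup>2 \<partial>M) \<le> 117 * real (length v) ^ (2 * \<nu> - 1) * S (2 * \<nu>) (length v)" (is ?thesis2)
proof -
  let ?n = "length v"
  have m [measurable]: "cpos v \<in> borel_measurable M" using v by measurable
  have i: "integrable M (\<lambda>w. \<bar>cpos v w\<bar> ^ r)" if "r \<le> 2 * \<nu>" for r
    using that \<nu> by (intro cpos_moment(1)[OF Q _ _ v]) auto
  have b: "(\<integral>w. \<bar>cpos v w\<bar> ^ Suc r \<partial>M) \<le> real ?n ^ r * S (Suc r) ?n" if "Suc r \<le> 2 * \<nu>" for r
    using that by (intro cpos_moment'[OF Q _ v])
  define B where "B w = (if \<nu> = 1 then \<bar>cpos v w\<bar> ^ 2 else if \<nu> = 2 then 2 * \<bar>cpos v w\<bar> ^ 4 + 2 * (S 2 ?n)\<^sup>2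
     else 3 * \<bar>cpos v w\<bar> ^ 6 + 27 * (S 2 ?n)\<^sup>2 * \<bar>cpos v w\<bar> ^ 2 + 3 * (S 3 ?n)\<^sup>2)" for w
  have Bi: "integrable M B"
    unfolding B_def using \<nu> i[of 2] i[of 4] i[of 6] by auto
  have pt: "(hpol p G \<nu> ?n \<xi> (cpos v w))\<^sup>2 \<le> B w" for w
  proof -
    let ?x = "cpos v w" and ?a = "s_mom p G 2 ?n \<xi>" and ?b = "s_mom p G 3 ?n \<xi>"
    have a: "?a\<^sup>2 \<le> (S 2 ?n)\<^sup>2" "?b\<^sup>2 \<le> (S 3 ?n)\<^sup>2"
      using s_mom_abs_le S_nonneg by (simp_all add: abs_le_square_iff[symmetric])
    have g2: "(x\<^sup>2 - a)\<^sup>2 \<le> 2 * \<bar>x\<bar> ^ 4 + 2 * A" if "a\<^sup>2 \<le> A" for x a A :: real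
    proof -
      have "(x\<^sup>2 - a)\<^sup>2 + (x\<^sup>2 + a)\<^sup>2 = 2 * x ^ 4 + 2 * a\<^sup>2"
        by (simp add: power2_eq_square power4_eq_xxxx algebra_simps)
      moreover have "\<bar>x\<bar> ^ 4 = x ^ 4" by simp
      ultimately show ?thesis using that zero_le_power2[of "x\<^sup>2 + a"] by linarith
    qed
    have g3: "(x ^ 3 - 3 * x * a - b)\<^sup>2 \<le> 3 * \<bar>x\<bar> ^ 6 + 27 * A * \<bar>x\<bar> ^ 2 + 3 * B"
      if "a\<^sup>2 \<le> A" "b\<^sup>2 \<le> B" for x a b A B :: real
    proof -
      \<comment> \<open>The difference of the two sides is exactly the sum of the three squares
        supplied.\<close>
      have sq: "(u - v - z)\<^sup>2 \<le> 3 * u\<^sup>2 + 3 * v\<^sup>2 + 3 * z\<^sup>2" for u v z :: real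
        using zero_le_power2[of "u + v"] zero_le_power2[of "u + z"] zero_le_power2[of "v - z"]
        by (simp add: power2_eq_square algebra_simps)
      have "(x ^ 3 - 3 * x * a - b)\<^sup>2 \<le> 3 * (x ^ 3)\<^sup>2 + 3 * (3 * x * a)\<^sup>2 + 3 * b\<^sup>2"
        by (rule sq)
      moreover have "(x ^ 3)\<^sup>2 = \<bar>x\<bar> ^ 6" by (simp add: power_mult[symmetric])
      moreover have "3 * (3 * x * a)\<^sup>2 = 27 * (a\<^sup>2 * \<bar>x\<bar>\<^sup>2)" by (simp add: power_mult_distrib)
      moreover have "a\<^sup>2 * \<bar>x\<bar>\<^sup>2 \<le> A * \<bar>x\<bar>\<^sup>2" using that by (intro mult_right_mono) auto
      moreover have "27 * A * \<bar>x\<bar>\<^sup>2 = 27 * (A * \<bar>x\<bar>\<^sup>2)" by simp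
      ultimately show ?thesis using that(2) by linarith
    qed
    note F2 = g2[OF a(1), of ?x] and F3 = g3[OF a, of ?x]
    consider "\<nu> = 1" | "\<nu> = 2" | "\<nu> = 3" using \<nu> by auto
    then show ?thesis
    proof cases
      case 1
      then show ?thesis by (simp add: B_def hpol_def)
    next
      case 2
      then have "B w = 2 * \<bar>?x\<bar> ^ 4 + 2 * (S 2 ?n)\<^sup>2" "hpol p G \<nu> ?n \<xi> ?x = ?x\<^sup>2 - ?a"
        by (simp_all add: B_def hpol_def)
      then show ?thesis using F2 by (simp only:)
    next
      case 3
      then have "B w = 3 * \<bar>?x\<bar> ^ 6 + 27 * (S 2 ?n)\<^sup>2 * \<bar>?x\<bar> ^ 2 + 3 * (S 3 ?n)\<^sup>2"
        "hpol p G \<nu> ?n \<xi> ?x = ?x ^ 3 - 3 * ?x * ?a - ?b"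
        by (simp_all add: B_def hpol_def)
      then show ?thesis using F3 by (simp only:)
    qed
  qed
  have hm: "(\<lambda>w. hpol p G \<nu> ?n \<xi> (cpos v w)) \<in> borel_measurable M" by measurable
  show int: ?thesis1
    by (rule Bochner_Integration.integrable_bound[OF Bi])
       (use hm in \<open>auto intro!: AE_I2 order_trans[OF pt abs_ge_self]\<close>)
  have le: "(\<integral>w. (hpol p G \<nu> ?n \<xi> (cpos v w))\<^sup>2 \<partial>M) \<le> (\<integral>w. B w \<partial>M)"
    by (intro integral_mono int Bi pt)
  show ?thesis2
  proof (cases "?n = 0")
    case True
    have l: "(\<integral>w. (hpol p G \<nu> ?n \<xi> (cpos v w))\<^sup>2 \<partial>M) = 0"
      by (simp only: hpol_length_0[OF True]) simp
    have r: "S (2 * \<nu>) ?n = 0" unfolding True by simp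
    show ?thesis by (simp only: l r mult_zero_right order_refl)
  next
    case False
    then have n1: "1 \<le> real ?n" by (simp add: Suc_le_eq)
    have up: "real ?n ^ a * S r ?n \<le> real ?n ^ c * S r ?n" if "a \<le> c" for a c r
      using that n1 S_nonneg by (intro mult_right_mono power_increasing)
    consider "\<nu> = 1" | "\<nu> = 2" | "\<nu> = 3" using \<nu> by auto
    then show ?thesis
    proof cases
      case 1
      then have "(\<integral>w. B w \<partial>M) \<le> real ?n * S 2 ?n" using b[of 1] by (simp add: B_def numeral_2_eq_2)
      moreover have "0 \<le> real ?n * S 2 ?n" using S_nonneg[of 2 ?n] by simp
      ultimately show ?thesis using le 1 by (simp add: mult.assoc)
    next
      case 2
      have "(\<integral>w. B w \<partial>M) = 2 * (\<integral>w. \<bar>cpos v w\<bar> ^ 4 \<partial>M) + 2 * (S 2 ?n * S 2 ?n)"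
        using 2 i[of 4] by (simp add: B_def M.prob_space power2_eq_square)
      also have "\<dots> \<le> 2 * (real ?n ^ 3 * S 4 ?n) + 2 * (2 * (real ?n ^ 1 * S 4 ?n))"
        using b[of 3] 2 moment_sum_product_le[OF Q, of 2 2 ?n]
        by (intro add_mono mult_left_mono) (auto simp: eval_nat_numeral mult.assoc)
      also have "\<dots> \<le> 6 * (real ?n ^ 3 * S 4 ?n)"
        using up[of 1 3 4] by simp
      finally have "(\<integral>w. B w \<partial>M) \<le> 6 * (real ?n ^ 3 * S 4 ?n)" .
      moreover have "0 \<le> real ?n ^ 3 * S 4 ?n"
        by (intro mult_nonneg_nonneg S_nonneg) simp
      ultimately have "(\<integral>w. B w \<partial>M) \<le> 117 * (real ?n ^ 3 * S 4 ?n)" by linarith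
      then show ?thesis using le 2 by (simp add: mult.assoc)
    next
      case 3
      have p1: "S 2 ?n * S 4 ?n \<le> 2 * real ?n * S 6 ?n" "S 3 ?n * S 3 ?n \<le> 2 * real ?n * S 6 ?n"
        "S 2 ?n * S 2 ?n \<le> 2 * real ?n * S 4 ?n"
        using moment_sum_product_le[OF Q, of 2 4 ?n] moment_sum_product_le[OF Q, of 3 3 ?n]
          moment_sum_product_le[OF Q, of 2 2 ?n] 3 by auto
      \<comment> \<open>The cube of \<open>S 2\<close> is raised to \<open>S 6\<close> in two steps,
        through \<open>S 4\<close>, each costing a factor 2n.\<close>
      have "(S 2 ?n)\<^sup>2 * S 2 ?n = S 2 ?n * (S 2 ?n * S 2 ?n)" by (simp add: power2_eq_square)
      also have "\<dots> \<le> S 2 ?n * (2 * real ?n * S 4 ?n)" using p1 S_nonneg by (intro mult_left_mono)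
      also have "\<dots> = 2 * real ?n * (S 2 ?n * S 4 ?n)" by simp
      also have "\<dots> \<le> 2 * real ?n * (2 * real ?n * S 6 ?n)" using p1 by (intro mult_left_mono) auto
      finally have p2: "(S 2 ?n)\<^sup>2 * S 2 ?n \<le> 4 * (real ?n ^ 2 * S 6 ?n)" by (simp add: power2_eq_square mult_ac)
      have "(\<integral>w. B w \<partial>M) = 3 * (\<integral>w. \<bar>cpos v w\<bar> ^ 6 \<partial>M) + 27 * (S 2 ?n)\<^sup>2 * (\<integral>w. \<bar>cpos v w\<bar> ^ 2 \<partial>M) + 3 * (S 3 ?n * S 3 ?n)"
      proof -
        have "B = (\<lambda>w. 3 * \<bar>cpos v w\<bar> ^ 6 + 27 * (S 2 ?n)\<^sup>2 * \<bar>cpos v w\<bar> ^ 2 + 3 * (S 3 ?n)\<^sup>2)"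
          using 3 by (simp add: B_def fun_eq_iff)
        then show ?thesis using 3 i[of 6] i[of 2]
          by (simp only: Bochner_Integration.integral_add Bochner_Integration.integrable_add M.integrable_const integrable_mult_right
            integral_mult_right_zero) (simp add: M.prob_space power2_eq_square)
      qed
      also have "\<dots> \<le> 3 * (real ?n ^ 5 * S 6 ?n) + 27 * (S 2 ?n)\<^sup>2 * (real ?n * S 2 ?n) + 3 * (2 * real ?n * S 6 ?n)"
        using b[of 5] b[of 1] 3 p1 by (intro add_mono mult_left_mono) (auto simp: eval_nat_numeral)
      finally have "(\<integral>w. B w \<partial>M) \<le> 3 * (real ?n ^ 5 * S 6 ?n) + 27 * (S 2 ?n)\<^sup>2 * (real ?n * S 2 ?n)
        + 3 * (2 * real ?n * S 6 ?n)" .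
      moreover have "27 * (S 2 ?n)\<^sup>2 * (real ?n * S 2 ?n) \<le> 108 * (real ?n ^ 3 * S 6 ?n)"
      proof -
        have "27 * (S 2 ?n)\<^sup>2 * (real ?n * S 2 ?n) = 27 * real ?n * ((S 2 ?n)\<^sup>2 * S 2 ?n)" by simp
        also have "\<dots> \<le> 27 * real ?n * (4 * (real ?n ^ 2 * S 6 ?n))" using p2 by (intro mult_left_mono) auto
        also have "\<dots> = 108 * (real ?n ^ 3 * S 6 ?n)" by (simp add: power2_eq_square power3_eq_cube)
        finally show ?thesis .
      qed
      moreover have "3 * (2 * real ?n * S 6 ?n) = 6 * (real ?n ^ 1 * S 6 ?n)" by simp
      ultimately have "(\<integral>w. B w \<partial>M) \<le> 117 * (real ?n ^ 5 * S 6 ?n)"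
        using up[of 1 5 6] up[of 3 5 6] by linarith
      then show ?thesis using le 3 by (simp add: mult.assoc)
    qed
  qed
qed

end

section \<open>I.i.d. environments and weighted series\<close>

lemma prob_space_env_law: "prob_space \<tau> \<Longrightarrow> prob_space (env_law \<tau>)"
  unfolding env_law_def by (rule prob_space_PiM)

lemma measurable_env_component [measurable (raw)]: "(\<lambda>\<xi>. \<xi> n) \<in> env_law \<tau> \<rightarrow>\<^sub>M \<tau>"
  unfolding env_law_def by simp

lemma distr_env_component: "prob_space \<tau> \<Longrightarrow> distr (env_law \<tau>) \<tau> (\<lambda>\<xi>. \<xi> n) = \<tau>"
  unfolding env_law_def by (rule distr_PiM_component) auto

lemma AE_env_component:
  assumes "prob_space \<tau>" "AE x in \<tau>. P x"
  shows "AE \<xi> in env_law \<tau>. \<forall>n. P (\<xi> n)"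
  unfolding AE_all_countable env_law_def
  using assms by (intro allI AE_PiM_component) auto

lemma nn_integral_env_component:
  assumes "prob_space \<tau>" "f \<in> borel_measurable \<tau>"
  shows "(\<integral>\<^sup>+\<xi>. f (\<xi> n) \<partial>env_law \<tau>) = (\<integral>\<^sup>+x. f x \<partial>\<tau>)"
  using nn_integral_distr[of "\<lambda>\<xi>. \<xi> n" "env_law \<tau>" \<tau> f] assms
  by (simp add: distr_env_component)

text \<open>A nonnegative series with finite expectation is finite almost surely, and each
  expectation depends on the common marginal alone. Both the tail estimate and the displacement
  estimate along the environment come from it.\<close>

lemma AE_env_suminf_finite:
  fixes h :: "nat \<Rightarrow> 'e \<Rightarrow> ennreal"
  assumes "prob_space \<tau>" and [measurable]: "\<And>n. h n \<in> borel_measurable \<tau>"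
    and fin: "(\<Sum>n. \<integral>\<^sup>+x. h n x \<partial>\<tau>) < \<infinity>"
  shows "AE \<xi> in env_law \<tau>. (\<Sum>n. h n (\<xi> n)) < \<infinity>"
proof -
  have "(\<integral>\<^sup>+\<xi>. (\<Sum>n. h n (\<xi> n)) \<partial>env_law \<tau>) = (\<Sum>n. \<integral>\<^sup>+\<xi>. h n (\<xi> n) \<partial>env_law \<tau>)"
    by (rule nn_integral_suminf) measurable
  also have "\<dots> = (\<Sum>n. \<integral>\<^sup>+x. h n x \<partial>\<tau>)"
    using assms by (simp add: nn_integral_env_component)
  finally have "(\<integral>\<^sup>+\<xi>. (\<Sum>n. h n (\<xi> n)) \<partial>env_law \<tau>) \<noteq> \<infinity>" using fin by simp
  then have "AE \<xi> in env_law \<tau>. (\<Sum>n. h n (\<xi> n)) \<noteq> \<infinity>"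
    by (intro nn_integral_PInf_AE) measurable
  then show ?thesis by (simp add: less_top[symmetric])
qed

lemma summable_of_suminf_ennreal:
  assumes "\<And>n. 0 \<le> f n" "(\<Sum>n. ennreal (f n)) < \<infinity>"
  shows "summable f"
  using assms by (intro summable_suminf_not_top) auto

text \<open>The environment is itself a product law, so the resampling rules made for the process
  also show that centred functions of distinct \<xi>_k are uncorrelated.\<close>

lemma resampling_env:
  assumes "prob_space \<tau>"
  shows "resampling (env_law \<tau>) \<tau> (\<lambda>(x, \<xi>). \<xi>(j := x)) (\<lambda>\<xi>. \<xi> j)"
proof -
  interpret \<tau>: prob_space \<tau> by fact
  interpret E: prob_space "env_law \<tau>" by (rule prob_space_env_law) fact
  show ?thesis
  proof
    have "(\<lambda>z. (snd z)(j := fst z)) \<in> \<tau> \<Otimes>\<^sub>M env_law \<tau> \<rightarrow>\<^sub>M env_law \<tau>"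
      unfolding env_law_def by (rule measurable_fun_upd[where J=UNIV]) auto
    then show "(\<lambda>(x, \<xi>). \<xi>(j := x)) \<in> \<tau> \<Otimes>\<^sub>M env_law \<tau> \<rightarrow>\<^sub>M env_law \<tau>"
      by (simp add: case_prod_beta')
    show "distr (\<tau> \<Otimes>\<^sub>M env_law \<tau>) (env_law \<tau>) (\<lambda>(x, \<xi>). \<xi>(j := x)) = env_law \<tau>"
      unfolding env_law_def using distr_pair_PiM_eq_PiM[of UNIV "\<lambda>_. \<tau>" j] assms by simp
  qed auto
qed

lemma env_variance_sum:
  fixes Z :: "'e \<Rightarrow> real"
  assumes \<tau>: "prob_space \<tau>" and Z[measurable]: "Z \<in> borel_measurable \<tau>"
    and Z2: "integrable \<tau> (\<lambda>x. (Z x)\<^sup>2)" and Z0: "(\<integral>x. Z x \<partial>\<tau>) = 0"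
  shows "integrable (env_law \<tau>) (\<lambda>\<xi>. (\<Sum>k<N. Z (\<xi> k))\<^sup>2)"
    and "(\<integral>\<xi>. (\<Sum>k<N. Z (\<xi> k))\<^sup>2 \<partial>env_law \<tau>) = real N * (\<integral>x. (Z x)\<^sup>2 \<partial>\<tau>)"
proof -
  interpret E: prob_space "env_law \<tau>" by (rule prob_space_env_law) fact
  have co: "integrable (env_law \<tau>) (\<lambda>\<xi>. (Z (\<xi> k))\<^sup>2)"
    "(\<integral>\<xi>. (Z (\<xi> k))\<^sup>2 \<partial>env_law \<tau>) = (\<integral>x. (Z x)\<^sup>2 \<partial>\<tau>)" for k
  proof -
    interpret r: resampling "env_law \<tau>" \<tau> "\<lambda>(x, \<xi>). \<xi>(k := x)" "\<lambda>\<xi>. \<xi> k" by (rule resampling_env) fact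
    show "integrable (env_law \<tau>) (\<lambda>\<xi>. (Z (\<xi> k))\<^sup>2)"
      "(\<integral>\<xi>. (Z (\<xi> k))\<^sup>2 \<partial>env_law \<tau>) = (\<integral>x. (Z x)\<^sup>2 \<partial>\<tau>)"
      using r.integral_coordinate[of "\<lambda>x. (Z x)\<^sup>2"] Z2 by auto
  qed
  show "integrable (env_law \<tau>) (\<lambda>\<xi>. (\<Sum>k<N. Z (\<xi> k))\<^sup>2)"
  proof (rule integrable_square_sum[where f="\<lambda>k \<xi>. Z (\<xi> k)"])
    show "(\<lambda>\<xi>. Z (\<xi> k)) \<in> borel_measurable (env_law \<tau>)" for k by (rule measurable_compose[OF measurable_env_component Z])
  qed (simp, rule co(1))
  have prod: "integrable (env_law \<tau>) (\<lambda>\<xi>. Z (\<xi> j) * Z (\<xi> k))" for j k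
    by (rule integrable_mult_of_squares[OF _ _ co(1) co(1)]) (rule measurable_compose[OF measurable_env_component Z])+
  have cross: "(\<integral>\<xi>. Z (\<xi> j) * Z (\<xi> k) \<partial>env_law \<tau>) = (if k = j then (\<integral>x. (Z x)\<^sup>2 \<partial>\<tau>) else 0)" for j k
  proof (cases "k = j")
    case True
    then show ?thesis using co(2)[of j] by (simp add: power2_eq_square)
  next
    case False
    interpret r: resampling "env_law \<tau>" \<tau> "\<lambda>(x, \<xi>). \<xi>(k := x)" "\<lambda>\<xi>. \<xi> k" by (rule resampling_env) fact
    have "(\<integral>\<xi>. Z (\<xi> j) * Z (\<xi> k) \<partial>env_law \<tau>) = (\<integral>\<xi>. \<integral>x. Z (\<xi> j) * Z x \<partial>\<tau> \<partial>env_law \<tau>)"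
    proof (rule r.integral_resample[where F="\<lambda>\<xi> x. Z (\<xi> j) * Z x"])
      show "(\<lambda>(\<xi>, x). Z (\<xi> j) * Z x) \<in> borel_measurable (env_law \<tau> \<Otimes>\<^sub>M \<tau>)"
        unfolding case_prod_beta' by (intro borel_measurable_times measurable_compose[OF _ Z]
          measurable_compose[OF measurable_fst measurable_env_component] measurable_snd)
    qed (use False prod in auto)
    then show ?thesis using False Z0 by simp
  qed
  have "(\<integral>\<xi>. (\<Sum>k<N. Z (\<xi> k))\<^sup>2 \<partial>env_law \<tau>) = (\<integral>\<xi>. (\<Sum>j<N. \<Sum>k<N. Z (\<xi> j) * Z (\<xi> k)) \<partial>env_law \<tau>)"
    by (simp add: power2_eq_square sum_product)
  also have "\<dots> = (\<Sum>j<N. \<Sum>k<N. \<integral>\<xi>. Z (\<xi> j) * Z (\<xi> k) \<partial>env_law \<tau>)"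
    by (simp add: Bochner_Integration.integral_sum Bochner_Integration.integrable_sum prod)
  also have "\<dots> = real N * (\<integral>x. (Z x)\<^sup>2 \<partial>\<tau>)"
    unfolding cross by simp
  finally show "(\<integral>\<xi>. (\<Sum>k<N. Z (\<xi> k))\<^sup>2 \<partial>env_law \<tau>) = real N * (\<integral>x. (Z x)\<^sup>2 \<partial>\<tau>)" .
qed

text \<open>Chebyshev along the squares; monotonicity of the partial sums fills the gaps.\<close>

lemma env_sum_upper_bound:
  fixes Z :: "'e \<Rightarrow> real"
  assumes \<tau>: "prob_space \<tau>" and Z[measurable]: "Z \<in> borel_measurable \<tau>" and nn: "\<And>x. 0 \<le> Z x"
    and Z2: "integrable \<tau> (\<lambda>x. (Z x)\<^sup>2)" and \<epsilon>: "0 < \<epsilon>"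
  shows "AE \<xi> in env_law \<tau>. \<exists>C. \<forall>n. (\<Sum>k<n. Z (\<xi> k)) \<le> ((\<integral>x. Z x \<partial>\<tau>) + \<epsilon>) * real n + C"
proof -
  interpret \<tau>: prob_space \<tau> by fact
  interpret E: prob_space "env_law \<tau>" by (rule prob_space_env_law) fact
  define a where "a = (\<integral>x. Z x \<partial>\<tau>)"
  have a0: "0 \<le> a" unfolding a_def using nn by simp
  have Z1: "integrable \<tau> Z" by (rule \<tau>.integral_abs_le_sqrt(1)) (use Z2 in auto)
  define W where "W x = Z x - a" for x
  have W [measurable]: "W \<in> borel_measurable \<tau>" unfolding W_def[abs_def] by measurable
  have W2: "integrable \<tau> (\<lambda>x. (W x)\<^sup>2)"
    unfolding W_def power2_diff using Z1 Z2 by simp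
  have W0: "(\<integral>x. W x \<partial>\<tau>) = 0" unfolding W_def using Z1 by (simp add: \<tau>.prob_space a_def)
  define V where "V = (\<integral>x. (W x)\<^sup>2 \<partial>\<tau>)"
  have V0: "0 \<le> V" unfolding V_def by simp
  \<comment> \<open>The variance of a sum of (j+1)^2 terms is (j+1)^2 V; division by (j+1)^4 leaves
    the summable V / (j+1)^2. Using \<open>Suc j\<close> avoids a zero denominator.\<close>
  define Q where "Q j \<xi> = ((\<Sum>k<(Suc j)\<^sup>2. W (\<xi> k)) / (real (Suc j))\<^sup>2)\<^sup>2" for j \<xi>
  have Qm [measurable]: "Q j \<in> borel_measurable (env_law \<tau>)" for j unfolding Q_def by measurable
  have Q_int: "(\<integral>\<^sup>+\<xi>. ennreal (Q j \<xi>) \<partial>env_law \<tau>) = ennreal (V / (real (Suc j))\<^sup>2)" for j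
  proof -
    note v = env_variance_sum[OF \<tau> W W2 W0, of "(Suc j)\<^sup>2"]
    have i: "integrable (env_law \<tau>) (Q j)"
      unfolding Q_def power_divide using v(1) by (intro integrable_divide)
    have "(\<integral>\<xi>. Q j \<xi> \<partial>env_law \<tau>) = (real ((Suc j)\<^sup>2) * V) / ((real (Suc j))\<^sup>2)\<^sup>2"
      unfolding Q_def power_divide V_def using v by simp
    also have "\<dots> = V / (real (Suc j))\<^sup>2"
    proof -
      have "s\<^sup>2 * V / (s\<^sup>2)\<^sup>2 = V / s\<^sup>2" if "s \<noteq> 0" for s :: real
        using that by (simp add: power2_eq_square)
      from this[of "real (Suc j)"] show ?thesis by (simp only: of_nat_power)
    qed
    finally have e: "(\<integral>\<xi>. Q j \<xi> \<partial>env_law \<tau>) = V / (real (Suc j))\<^sup>2" .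
    have "(\<integral>\<^sup>+\<xi>. ennreal (Q j \<xi>) \<partial>env_law \<tau>) = ennreal (\<integral>\<xi>. Q j \<xi> \<partial>env_law \<tau>)"
      by (rule nn_integral_eq_integral[OF i]) (simp add: Q_def)
    then show ?thesis unfolding e .
  qed
  have "summable (\<lambda>j. V / (real (Suc j))\<^sup>2)"
  proof -
    have "summable (\<lambda>j. V * inverse (real j ^ 2))"
      by (intro summable_mult inverse_power_summable) simp
    then show ?thesis
      by (subst summable_Suc_iff[of "\<lambda>j. V / (real j)\<^sup>2"]) (simp add: divide_inverse)
  qed
  then have "(\<Sum>j. \<integral>\<^sup>+\<xi>. ennreal (Q j \<xi>) \<partial>env_law \<tau>) \<noteq> \<infinity>"
    unfolding Q_int using V0 by (subst suminf_ennreal2) auto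
  moreover have "(\<Sum>j. \<integral>\<^sup>+\<xi>. ennreal (Q j \<xi>) \<partial>env_law \<tau>) = (\<integral>\<^sup>+\<xi>. (\<Sum>j. ennreal (Q j \<xi>)) \<partial>env_law \<tau>)"
    by (rule nn_integral_suminf[symmetric]) measurable
  ultimately have "AE \<xi> in env_law \<tau>. (\<Sum>j. ennreal (Q j \<xi>)) \<noteq> \<infinity>"
    by (intro nn_integral_PInf_AE) auto
  then show ?thesis
  proof (rule AE_mp, intro AE_I2 impI)
    fix \<xi> assume fin: "(\<Sum>j. ennreal (Q j \<xi>)) \<noteq> \<infinity>"
    have "summable (\<lambda>j. Q j \<xi>)"
      by (rule summable_of_suminf_ennreal) (use fin in \<open>auto simp: Q_def less_top[symmetric]\<close>)
    then have "(\<lambda>j. Q j \<xi>) \<longlonglongrightarrow> 0" by (rule summable_LIMSEQ_zero)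
    then have "\<forall>\<^sub>F j in sequentially. Q j \<xi> < (\<epsilon> / 2)\<^sup>2"
      using \<epsilon> by (intro order_tendstoD) auto
    then obtain J where J: "\<And>j. j \<ge> J \<Longrightarrow> Q j \<xi> < (\<epsilon> / 2)\<^sup>2"
      unfolding eventually_sequentially by auto
    let ?T = "\<lambda>n. \<Sum>k<n. Z (\<xi> k)"
    have T_mono: "?T n \<le> ?T n'" if "n \<le> n'" for n n'
      using that nn by (intro sum_mono2) auto
    have sq: "?T ((Suc j)\<^sup>2) \<le> (a + \<epsilon> / 2) * (real (Suc j))\<^sup>2" if "j \<ge> J" for j
    proof -
      have "(\<Sum>k<(Suc j)\<^sup>2. W (\<xi> k)) / (real (Suc j))\<^sup>2 \<le> \<epsilon> / 2"
      proof (rule power2_le_imp_le)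
        show "((\<Sum>k<(Suc j)\<^sup>2. W (\<xi> k)) / (real (Suc j))\<^sup>2)\<^sup>2 \<le> (\<epsilon> / 2)\<^sup>2"
          using J[OF that] unfolding Q_def by (rule less_imp_le)
        show "0 \<le> \<epsilon> / 2" using \<epsilon> by simp
      qed
      then have "(\<Sum>k<(Suc j)\<^sup>2. W (\<xi> k)) \<le> \<epsilon> / 2 * (real (Suc j))\<^sup>2"
        by (simp add: pos_divide_le_eq)
      then show ?thesis unfolding W_def sum_subtractf
        by (simp add: algebra_simps)
    qed
    define B where "B = a + \<epsilon> / 2"
    have B0: "0 < B" using a0 \<epsilon> by (simp add: B_def)
    \<comment> \<open>The first summand handles n \<le> J^2. The second collects the cost of
      rounding n up to a square: B from the constant term of (sqrt n + 1)^2, and 2 B^2 / \<epsilon>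
      from splitting 2 B sqrt n by the arithmetic-geometric mean inequality.\<close>
    define C where "C = ?T (J\<^sup>2) + B * (1 + 2 * B / \<epsilon>)"
    have "?T n \<le> (a + \<epsilon>) * real n + C" for n
    proof (cases "n \<le> J\<^sup>2")
      case True
      have "0 \<le> B * (1 + 2 * B / \<epsilon>)" "0 \<le> (a + \<epsilon>) * real n" using B0 a0 \<epsilon> by auto
      with T_mono[OF True] show ?thesis unfolding C_def by linarith
    next
      case False
      define j where "j = nat \<lfloor>sqrt (real n)\<rfloor>"
      have j1: "real j \<le> sqrt (real n)" "sqrt (real n) < real j + 1" unfolding j_def by auto
      have jJ: "J \<le> j"
      proof -
        have "real (J\<^sup>2) < real n" using False by linarith
        then have "real J < sqrt (real n)" by (intro real_less_rsqrt) simp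
        with j1 show ?thesis by linarith
      qed
      have "real n \<le> (real j + 1)\<^sup>2"
        using j1(2) by (metis less_eq_real_def of_nat_0_le_iff real_sqrt_ge_zero real_sqrt_pow2 power_mono)
      then have "n \<le> (Suc j)\<^sup>2" by (metis of_nat_Suc of_nat_le_iff of_nat_power add.commute)
      then have "?T n \<le> B * (real (Suc j))\<^sup>2"
        using T_mono sq[OF jJ] unfolding B_def by (meson order_trans)
      also have "\<dots> \<le> B * (sqrt (real n) + 1)\<^sup>2"
        using j1(1) B0 by (intro mult_left_mono power_mono) auto
      also have "\<dots> = B * real n + B + 2 * B * sqrt (real n)"
        by (simp add: power2_eq_square algebra_simps)
      also have "2 * B * sqrt (real n) \<le> \<epsilon> / 2 * real n + 2 * B * B / \<epsilon>"
      proof -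
        have "0 \<le> (\<epsilon> * sqrt (real n) - 2 * B)\<^sup>2" by simp
        also have "(\<epsilon> * sqrt (real n) - 2 * B)\<^sup>2 = \<epsilon> * \<epsilon> * real n - 4 * B * \<epsilon> * sqrt (real n) + 4 * B * B"
          by (simp add: power2_eq_square algebra_simps)
        finally show ?thesis using \<epsilon> by (simp add: field_simps)
      qed
      finally have "?T n \<le> (B + \<epsilon> / 2) * real n + (B + 2 * B * B / \<epsilon>)" by (simp add: algebra_simps)
      moreover have "0 \<le> ?T (J\<^sup>2)" using nn by (intro sum_nonneg) auto
      moreover have "B * (1 + 2 * B / \<epsilon>) = B + 2 * B * B / \<epsilon>" by (simp add: algebra_simps)
      moreover have "(B + \<epsilon> / 2) * real n = (a + \<epsilon>) * real n" by (simp add: B_def)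
      ultimately show ?thesis unfolding C_def by linarith
    qed
    then show "\<exists>C. \<forall>n. ?T n \<le> ((\<integral>x. Z x \<partial>\<tau>) + \<epsilon>) * real n + C"
      unfolding a_def by blast
  qed
qed

text \<open>Square integrability is available for the negative part of \<open>f\<close>, so
  \<open>f\<close> is capped at a level \<open>K\<close> high enough to keep the mean positive. Then
  \<open>K\<close> minus the capped function is nonnegative and square integrable, and an upper
  bound for its sums is a lower bound for those of \<open>f\<close>.\<close>

lemma env_sum_lower_bound:
  fixes f :: "'e \<Rightarrow> real"
  assumes \<tau>: "prob_space \<tau>" and f: "integrable \<tau> f" "0 < (\<integral>x. f x \<partial>\<tau>)"
    and neg: "integrable \<tau> (\<lambda>x. (max (- f x) 0)\<^sup>2)"
  shows "\<exists>\<gamma>>0. AE \<xi> in env_law \<tau>. \<exists>C. \<forall>n. \<gamma> * real n - C \<le> (\<Sum>k<n. f (\<xi> k))"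
proof -
  interpret \<tau>: prob_space \<tau> by fact
  have [measurable]: "f \<in> borel_measurable \<tau>" using f by auto
  have "(\<lambda>K. \<integral>x. min (f x) (real K) \<partial>\<tau>) \<longlonglongrightarrow> (\<integral>x. f x \<partial>\<tau>)"
  proof (rule integral_dominated_convergence[where w="\<lambda>x. \<bar>f x\<bar>"])
    show "AE x in \<tau>. (\<lambda>K. min (f x) (real K)) \<longlonglongrightarrow> f x"
    proof (intro AE_I2 tendsto_eventually)
      fix x
      obtain K0 :: nat where "f x \<le> real K0" using real_arch_simple by blast
      then show "\<forall>\<^sub>F K in sequentially. min (f x) (real K) = f x"
        by (intro eventually_sequentiallyI[of K0]) (auto simp: min_def)
    qed
  qed (use f in \<open>auto simp: min_def\<close>)
  then have "\<forall>\<^sub>F K in sequentially. 0 < (\<integral>x. min (f x) (real K) \<partial>\<tau>)"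
    using f(2) by (rule order_tendstoD)
  then obtain K :: nat where K: "0 < (\<integral>x. min (f x) (real K) \<partial>\<tau>)"
    by (meson eventually_happens sequentially_bot)
  define b where "b = (\<integral>x. min (f x) (real K) \<partial>\<tau>)"
  have mi: "integrable \<tau> (\<lambda>x. min (f x) (real K))" using f by simp
  define Z where "Z x = real K - min (f x) (real K)" for x
  have Zm [measurable]: "Z \<in> borel_measurable \<tau>" unfolding Z_def[abs_def] by measurable
  have Zn: "0 \<le> Z x" for x by (simp add: Z_def)
  have Z2: "integrable \<tau> (\<lambda>x. (Z x)\<^sup>2)"
  proof (rule Bochner_Integration.integrable_bound)
    show "integrable \<tau> (\<lambda>x. 2 * (real K)\<^sup>2 + 2 * (max (- f x) 0)\<^sup>2)" using neg by simp
    show "AE x in \<tau>. norm ((Z x)\<^sup>2) \<le> norm (2 * (real K)\<^sup>2 + 2 * (max (- f x) 0)\<^sup>2)"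
    proof (rule AE_I2)
      fix x
      have "Z x \<le> real K + max (- f x) 0" by (auto simp: Z_def)
      then have "(Z x)\<^sup>2 \<le> (real K + max (- f x) 0)\<^sup>2" using Zn by (intro power_mono)
      also have "\<dots> \<le> 2 * (real K)\<^sup>2 + 2 * (max (- f x) 0)\<^sup>2"
        using zero_le_power2[of "real K - max (- f x) 0"] unfolding power2_sum power2_diff by linarith
      finally show "norm ((Z x)\<^sup>2) \<le> norm (2 * (real K)\<^sup>2 + 2 * (max (- f x) 0)\<^sup>2)" by simp
    qed
  qed measurable
  have Za: "(\<integral>x. Z x \<partial>\<tau>) = real K - b" unfolding Z_def b_def using mi by (simp add: \<tau>.prob_space)
  have "AE \<xi> in env_law \<tau>. \<exists>C. \<forall>n. (\<Sum>k<n. Z (\<xi> k)) \<le> ((\<integral>x. Z x \<partial>\<tau>) + b / 2) * real n + C"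
    by (rule env_sum_upper_bound[OF \<tau> Zm Zn Z2]) (use K in \<open>simp add: b_def\<close>)
  then have "AE \<xi> in env_law \<tau>. \<exists>C. \<forall>n. b / 2 * real n - C \<le> (\<Sum>k<n. f (\<xi> k))"
  proof (rule AE_mp, intro AE_I2 impI)
    fix \<xi> assume "\<exists>C. \<forall>n. (\<Sum>k<n. Z (\<xi> k)) \<le> ((\<integral>x. Z x \<partial>\<tau>) + b / 2) * real n + C"
    then obtain C where C: "\<And>n. (\<Sum>k<n. Z (\<xi> k)) \<le> (real K - b + b / 2) * real n + C"
      unfolding Za by auto
    have "b / 2 * real n - C \<le> (\<Sum>k<n. f (\<xi> k))" for n
    proof -
      have "real K * real n - (\<Sum>k<n. f (\<xi> k)) = (\<Sum>k<n. real K - f (\<xi> k))"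
        by (simp add: sum_subtractf)
      also have "\<dots> \<le> (\<Sum>k<n. Z (\<xi> k))" by (intro sum_mono) (simp add: Z_def)
      also have "\<dots> \<le> (real K - b + b / 2) * real n + C" by (rule C)
      finally show ?thesis by (simp add: algebra_simps)
    qed
    then show "\<exists>C. \<forall>n. b / 2 * real n - C \<le> (\<Sum>k<n. f (\<xi> k))" by blast
  qed
  then show ?thesis using K by (intro exI[of _ "b / 2"]) (simp add: b_def)
qed

section \<open>Deterministic estimates for weighted series\<close>

lemma sum_power_indicator_le:
  fixes \<gamma> lam x :: real
  assumes "0 < \<gamma>" "0 \<le> lam" "0 \<le> x"
  shows "(\<Sum>n. ennreal (real (Suc n) powr lam * of_bool (\<gamma> * real n < x))) \<le> ennreal ((x / \<gamma> + 1) powr (1 + lam))"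
proof -
  \<comment> \<open>Nonzero terms have n < N, so there are at most x / \<gamma> + 1 of them, each at
    most (x / \<gamma> + 1)^lam: the exponent 1 + lam of the logarithmic moments originates
    here.\<close>
  define N where "N = nat \<lceil>x / \<gamma>\<rceil>"
  have N: "real N \<le> x / \<gamma> + 1" using assms unfolding N_def by (simp add: of_nat_nat)
  have zero: "real (Suc n) powr lam * of_bool (\<gamma> * real n < x) = 0" if "n \<notin> {..<N}" for n
  proof -
    have "x / \<gamma> \<le> real N" unfolding N_def by (simp add: real_nat_ceiling_ge)
    also have "\<dots> \<le> real n" using that by simp
    finally have "x \<le> \<gamma> * real n" using assms by (simp add: field_simps)
    then show ?thesis by simp
  qed
  have "(\<Sum>n. ennreal (real (Suc n) powr lam * of_bool (\<gamma> * real n < x)))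
    = (\<Sum>n<N. ennreal (real (Suc n) powr lam * of_bool (\<gamma> * real n < x)))"
  proof (rule suminf_finite)
    fix n assume "n \<notin> {..<N}"
    from zero[OF this] show "ennreal (real (Suc n) powr lam * of_bool (\<gamma> * real n < x)) = 0"
      by (simp only: ennreal_0)
  qed simp
  also have "\<dots> = ennreal (\<Sum>n<N. real (Suc n) powr lam * of_bool (\<gamma> * real n < x))"
    by (rule sum_ennreal) simp
  also have "\<dots> \<le> ennreal (\<Sum>n<N. (x / \<gamma> + 1) powr lam)"
  proof (intro ennreal_leI sum_mono)
    fix n assume "n \<in> {..<N}"
    then have "real (Suc n) \<le> x / \<gamma> + 1" using N by simp
    then have "real (Suc n) powr lam \<le> (x / \<gamma> + 1) powr lam" using assms by (intro powr_mono2) auto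
    then show "real (Suc n) powr lam * of_bool (\<gamma> * real n < x) \<le> (x / \<gamma> + 1) powr lam"
      by (cases "\<gamma> * real n < x") auto
  qed
  also have "\<dots> \<le> ennreal ((x / \<gamma> + 1) * (x / \<gamma> + 1) powr lam)"
    using N by (intro ennreal_leI) (simp add: mult_right_mono)
  also have "(x / \<gamma> + 1) * (x / \<gamma> + 1) powr lam = (x / \<gamma> + 1) powr (1 + lam)"
    using assms by (simp add: powr_add)
  finally show ?thesis .
qed

lemma powr_sum3_le:
  fixes u v w s :: real
  assumes "0 \<le> u" "0 \<le> v" "0 \<le> w" "0 \<le> s"
  shows "(u + v + w) powr s \<le> 3 powr s * (u powr s + v powr s + w powr s)"
proof -
  define M where "M = max u (max v w)"
  have "(u + v + w) powr s \<le> (3 * M) powr s"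
    using assms by (intro powr_mono2) (auto simp: M_def)
  also have "\<dots> = 3 powr s * M powr s" using assms by (simp add: powr_mult M_def)
  also have "M powr s \<le> u powr s + v powr s + w powr s"
    unfolding M_def max_def by (auto simp: add_increasing add_increasing2)
  finally show ?thesis by simp
qed

text \<open>With \<open>R2\<close> of order n^(2\<nu>+\<epsilon>), the weight
  n^(lam-\<nu>-\<epsilon>) meets n^(\<nu>+\<epsilon>/2) and leaves at most n^lam times q_n, which is
  summable. Under the square root exp(\<gamma> n) faces exp(2 \<gamma> n), so the other term is a
  power of n times exp(-\<gamma> n / 2).\<close>

lemma summable_rate:
  fixes d q R2 PP bm :: "nat \<Rightarrow> real" and lam \<nu> \<epsilon> \<gamma> \<kappa> C :: real
  assumes q: "summable (\<lambda>n. real (Suc n) powr lam * q n)" and q0: "\<And>n. 0 \<le> q n"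
    and R2: "\<And>n. 0 \<le> R2 n" "\<And>n. R2 n \<le> C * real (Suc n) powr (2 * \<nu> + \<epsilon>)" and C: "0 < C"
    and PP: "\<And>n. \<kappa> * exp (2 * \<gamma> * real n) \<le> PP n" "0 < \<kappa>" "0 < \<gamma>"
    and bm: "\<And>n. bm n \<le> exp (\<gamma> * real n)" and \<nu>: "0 < \<nu>" "0 < \<epsilon>"
    and d0: "\<And>n. 0 \<le> d n"
    and d: "\<And>n. d n \<le> q n * (sqrt (R2 (Suc n)) + sqrt (R2 n)) + sqrt (2 * (bm n * R2 (Suc n) + R2 n) / PP n)"
  shows "summable (\<lambda>n. real (Suc n) powr (lam - \<nu> - \<epsilon>) * d n)"
proof -
  let ?s = "\<lambda>n. real (Suc n)"
  \<comment> \<open>The power of 2 absorbs the shift from n to n + 1, since n + 2 \<le> 2 (n +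
    1).\<close>
  define C1 where "C1 = C * 2 powr (2 * \<nu> + \<epsilon>)"
  have C1: "0 < C1" using C by (simp add: C1_def)
  have R2': "R2 n \<le> C1 * ?s n powr (2 * \<nu> + \<epsilon>)" "R2 (Suc n) \<le> C1 * ?s n powr (2 * \<nu> + \<epsilon>)" for n
  proof -
    have "R2 (Suc n) \<le> C * (2 * ?s n) powr (2 * \<nu> + \<epsilon>)"
      using \<nu> C by (intro order_trans[OF R2(2)] mult_left_mono powr_mono2) auto
    then show "R2 (Suc n) \<le> C1 * ?s n powr (2 * \<nu> + \<epsilon>)"
      unfolding C1_def by (subst (asm) powr_mult) (auto simp: mult.assoc)
    have "1 powr (2 * \<nu> + \<epsilon>) \<le> 2 powr (2 * \<nu> + \<epsilon>)" using \<nu> by (intro powr_mono2) auto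
    then have "C * 1 * ?s n powr (2 * \<nu> + \<epsilon>) \<le> C1 * ?s n powr (2 * \<nu> + \<epsilon>)"
      unfolding C1_def using C by (intro mult_right_mono mult_left_mono) auto
    then show "R2 n \<le> C1 * ?s n powr (2 * \<nu> + \<epsilon>)" using R2(2)[of n] by (simp only: mult_1_right)
  qed
  have sqrt_R2: "sqrt x \<le> sqrt C1 * ?s n powr (\<nu> + \<epsilon> / 2)" if "x \<le> C1 * ?s n powr (2 * \<nu> + \<epsilon>)" for x n
  proof -
    have "sqrt x \<le> sqrt (C1 * ?s n powr (2 * \<nu> + \<epsilon>))" using that by simp
    also have "?s n powr (2 * \<nu> + \<epsilon>) = (?s n powr (\<nu> + \<epsilon> / 2))\<^sup>2"
      by (simp add: power2_eq_square powr_add[symmetric])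
    also have "sqrt (C1 * (?s n powr (\<nu> + \<epsilon> / 2))\<^sup>2) = sqrt C1 * ?s n powr (\<nu> + \<epsilon> / 2)"
      by (simp add: real_sqrt_mult)
    finally show ?thesis .
  qed
  \<comment> \<open>Both summands under the root are at most exp(\<gamma> n) C1
    (n+1)^(2\<nu>+\<epsilon>), and the leading 2 makes this 4 C1; \<kappa> comes from the lower
    bound on \<open>PP\<close>.\<close>
  define A where "A = sqrt (4 * C1 / \<kappa>)"
  have A0: "0 \<le> A" using C1 PP by (simp add: A_def)
  have bound: "?s n powr (lam - \<nu> - \<epsilon>) * d n
    \<le> 2 * sqrt C1 * (?s n powr lam * q n) + A * (?s n powr lam * exp (- (\<gamma> / 2) * real n))" for n
  proof -
    have p: "0 < PP n" using PP(1)[of n] PP(2) by (smt (verit) exp_gt_zero mult_pos_pos)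
    have e1: "1 \<le> exp (\<gamma> * real n)" using PP(3) by simp
    have "2 * (bm n * R2 (Suc n) + R2 n) \<le> 2 * (exp (\<gamma> * real n) * (C1 * ?s n powr (2 * \<nu> + \<epsilon>)) + exp (\<gamma> * real n) * (C1 * ?s n powr (2 * \<nu> + \<epsilon>)))"
    proof (intro mult_left_mono add_mono)
      show "bm n * R2 (Suc n) \<le> exp (\<gamma> * real n) * (C1 * ?s n powr (2 * \<nu> + \<epsilon>))"
        using bm R2 R2' by (meson exp_ge_zero mult_mono order_trans)
      show "R2 n \<le> exp (\<gamma> * real n) * (C1 * ?s n powr (2 * \<nu> + \<epsilon>))"
        using mult_mono[OF e1 R2'(1)[of n]] R2(1)[of n] by simp
    qed simp
    also have "\<dots> = 4 * C1 * ?s n powr (2 * \<nu> + \<epsilon>) * exp (\<gamma> * real n)" by (simp add: algebra_simps)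
    finally have "2 * (bm n * R2 (Suc n) + R2 n) / PP n
       \<le> 4 * C1 * ?s n powr (2 * \<nu> + \<epsilon>) * exp (\<gamma> * real n) / (\<kappa> * exp (2 * \<gamma> * real n))"
      using PP p C1 by (intro frac_le) auto
    also have "exp (2 * \<gamma> * real n) = exp (\<gamma> * real n) * exp (\<gamma> * real n)"
      by (simp add: exp_add[symmetric])
    also have "4 * C1 * ?s n powr (2 * \<nu> + \<epsilon>) * exp (\<gamma> * real n) / (\<kappa> * (exp (\<gamma> * real n) * exp (\<gamma> * real n)))
      = 4 * C1 / \<kappa> * (?s n powr (\<nu> + \<epsilon> / 2) * exp (- (\<gamma> / 2) * real n))\<^sup>2"
    proof -
      have 1: "(exp (- (\<gamma> / 2) * real n))\<^sup>2 = 1 / exp (\<gamma> * real n)"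
        by (simp add: power2_eq_square exp_add[symmetric] exp_minus inverse_eq_divide)
      have 2: "(?s n powr (\<nu> + \<epsilon> / 2))\<^sup>2 = ?s n powr (2 * \<nu> + \<epsilon>)"
        by (simp add: power2_eq_square powr_add[symmetric])
      show ?thesis unfolding power_mult_distrib 1 2 using PP(2) by simp
    qed
    finally have "sqrt (2 * (bm n * R2 (Suc n) + R2 n) / PP n)
      \<le> sqrt (4 * C1 / \<kappa> * (?s n powr (\<nu> + \<epsilon> / 2) * exp (- (\<gamma> / 2) * real n))\<^sup>2)"
      by (rule real_sqrt_le_mono)
    also have "\<dots> = A * (?s n powr (\<nu> + \<epsilon> / 2) * exp (- (\<gamma> / 2) * real n))"
      unfolding A_def by (simp only: real_sqrt_mult real_sqrt_abs) simp
    finally have s2: "sqrt (2 * (bm n * R2 (Suc n) + R2 n) / PP n) \<le> A * (?s n powr (\<nu> + \<epsilon> / 2) * exp (- (\<gamma> / 2) * real n))" .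
    have s1: "q n * (sqrt (R2 (Suc n)) + sqrt (R2 n)) \<le> q n * (2 * (sqrt C1 * ?s n powr (\<nu> + \<epsilon> / 2)))"
      using sqrt_R2[OF R2'(1)[of n]] sqrt_R2[OF R2'(2)[of n]] q0[of n] by (intro mult_left_mono) auto
    have "d n \<le> ?s n powr (\<nu> + \<epsilon> / 2) * (2 * sqrt C1 * q n + A * exp (- (\<gamma> / 2) * real n))"
      using d[of n] s1 s2 by (simp add: algebra_simps)
    then have "?s n powr (lam - \<nu> - \<epsilon>) * d n
       \<le> ?s n powr (lam - \<nu> - \<epsilon>) * (?s n powr (\<nu> + \<epsilon> / 2) * (2 * sqrt C1 * q n + A * exp (- (\<gamma> / 2) * real n)))"
      by (intro mult_left_mono) auto
    also have "\<dots> = ?s n powr (lam - \<epsilon> / 2) * (2 * sqrt C1 * q n + A * exp (- (\<gamma> / 2) * real n))"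
      unfolding mult.assoc[symmetric] powr_add[symmetric] by simp
    also have "\<dots> \<le> ?s n powr lam * (2 * sqrt C1 * q n + A * exp (- (\<gamma> / 2) * real n))"
      using \<nu> q0[of n] C1 A0 by (intro mult_right_mono powr_mono) auto
    finally show ?thesis by (simp add: algebra_simps)
  qed
  have "summable (\<lambda>n. ?s n powr lam * exp (- (\<gamma> / 2) * real n))"
  proof (rule summable_comparison_test_bigo)
    show "summable (\<lambda>n. norm (1 / real n ^ 2))"
      using inverse_power_summable[of 2, where 'a=real] by (simp add: field_simps)
    show "(\<lambda>n. ?s n powr lam * exp (- (\<gamma> / 2) * real n)) \<in> O(\<lambda>n. 1 / real n ^ 2)"
      using PP(3) by real_asymp
  qed
  then have "summable (\<lambda>n. 2 * sqrt C1 * (?s n powr lam * q n) + A * (?s n powr lam * exp (- (\<gamma> / 2) * real n)))"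
    using q by (intro summable_add summable_mult)
  then show ?thesis
    by (rule summable_comparison_test'[where N=0]) (use bound d0 in auto)
qed

text \<open>The increasing weight can be pulled out of the tail sum, which is then at most
  n^(-a+\<delta>) times the tail of a convergent series and hence of smaller order. The hypothesis
  runs over countably many exponents so that it can hold outside a single null set.\<close>

lemma weighted_summable_tail:
  fixes x :: "nat \<Rightarrow> real" and a :: real
  assumes sum: "\<And>j::nat. summable (\<lambda>n. real (Suc n) powr (a - 1 / real (Suc j)) * \<bar>x (Suc n) - x n\<bar>)" and a: "0 < a"
  shows "\<exists>V. x \<longlonglongrightarrow> V \<and> (\<forall>\<delta>>0. (\<lambda>n. x n - V) \<in> o(\<lambda>n. real n powr (- a + \<delta>)))"
proof -
  let ?d = "\<lambda>n. x (Suc n) - x n"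
  have key: "summable (\<lambda>n. real (Suc n) powr (a - \<delta>) * \<bar>?d n\<bar>)" if \<delta>: "0 < \<delta>" for \<delta>
  proof -
    obtain j where j: "inverse (real (Suc j)) < \<delta>" using reals_Archimedean[OF \<delta>] by auto
    show ?thesis
    proof (rule summable_comparison_test'[OF sum[of j], where N=0])
      fix n
      have "real (Suc n) powr (a - \<delta>) \<le> real (Suc n) powr (a - 1 / real (Suc j))"
        using j by (intro powr_mono) (auto simp: inverse_eq_divide)
      then show "norm (real (Suc n) powr (a - \<delta>) * \<bar>?d n\<bar>) \<le> real (Suc n) powr (a - 1 / real (Suc j)) * \<bar>?d n\<bar>"
        by (simp add: abs_mult mult_right_mono)
    qed
  qed
  \<comment> \<open>With \<delta> = a the weight is constantly 1.\<close>
  have sd: "summable (\<lambda>n. \<bar>?d n\<bar>)"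
    using key[of a] a by simp
  then have sd': "summable ?d" by (rule summable_rabs_cancel)
  define V where "V = x 0 + (\<Sum>n. ?d n)"
  have tail: "V - x n = (\<Sum>k. ?d (k + n))" for n
  proof -
    have "(\<Sum>k<n. ?d k) = x n - x 0" by (rule sum_lessThan_telescope)
    then show ?thesis using suminf_split_initial_segment[OF sd', of n] by (simp add: V_def)
  qed
  have lim: "x \<longlonglongrightarrow> V"
  proof -
    have "(\<lambda>n. \<Sum>k<n. ?d k) \<longlonglongrightarrow> (\<Sum>n. ?d n)" by (rule summable_LIMSEQ[OF sd'])
    then have "(\<lambda>n. x n - x 0) \<longlonglongrightarrow> (\<Sum>n. ?d n)" by (simp add: sum_lessThan_telescope)
    from tendsto_add[OF this tendsto_const[of "x 0"]] show ?thesis by (simp add: V_def add.commute)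
  qed
  have "(\<lambda>n. x n - V) \<in> o(\<lambda>n. real n powr (- a + \<delta>))" if "0 < \<delta>" for \<delta>
  proof -
    \<comment> \<open>Capping \<delta> at \<open>a\<close> keeps the exponent of the weight
      nonnegative, so that the weight is increasing; a smaller \<delta> only strengthens the
      claim.\<close>
    define \<delta>' where "\<delta>' = min \<delta> a"
    have \<delta>': "0 < \<delta>'" "\<delta>' \<le> a" "\<delta>' \<le> \<delta>" using that a by (auto simp: \<delta>'_def)
    let ?w = "\<lambda>n. real (Suc n) powr (a - \<delta>')"
    let ?t = "\<lambda>n. \<Sum>k. ?w (k + n) * \<bar>?d (k + n)\<bar>"
    note sw = key[OF \<delta>'(1)]
    have t0: "?t \<longlonglongrightarrow> 0"
    proof -
      have "?t n = (\<Sum>k. ?w k * \<bar>?d k\<bar>) - (\<Sum>k<n. ?w k * \<bar>?d k\<bar>)" for n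
        using suminf_split_initial_segment[OF sw, of n] by simp
      moreover have "(\<lambda>n. (\<Sum>k. ?w k * \<bar>?d k\<bar>) - (\<Sum>k<n. ?w k * \<bar>?d k\<bar>)) \<longlonglongrightarrow> (\<Sum>k. ?w k * \<bar>?d k\<bar>) - (\<Sum>k. ?w k * \<bar>?d k\<bar>)"
        by (intro tendsto_diff tendsto_const summable_LIMSEQ sw)
      ultimately show ?thesis by simp
    qed
    have le: "\<bar>x n - V\<bar> \<le> ?t n * real n powr (- a + \<delta>')" if n: "1 \<le> n" for n
    proof -
      have s1: "summable (\<lambda>k. \<bar>?d (k + n)\<bar>)" using sd by (rule summable_ignore_initial_segment)
      have s2: "summable (\<lambda>k. ?w (k + n) * \<bar>?d (k + n)\<bar>)" using sw by (rule summable_ignore_initial_segment)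
      have n0: "0 < real n powr (a - \<delta>')" using n by simp
      have "\<bar>x n - V\<bar> = \<bar>\<Sum>k. ?d (k + n)\<bar>" using tail[of n] by simp
      also have "\<dots> \<le> (\<Sum>k. \<bar>?d (k + n)\<bar>)" by (rule summable_rabs[OF s1])
      finally have "real n powr (a - \<delta>') * \<bar>x n - V\<bar> \<le> real n powr (a - \<delta>') * (\<Sum>k. \<bar>?d (k + n)\<bar>)"
        by (intro mult_left_mono) auto
      also have "\<dots> = (\<Sum>k. real n powr (a - \<delta>') * \<bar>?d (k + n)\<bar>)"
        by (rule suminf_mult[symmetric, OF s1])
      also have "\<dots> \<le> ?t n"
      proof (rule suminf_le[OF _ summable_mult[OF s1] s2])
        fix k
        have "real n powr (a - \<delta>') \<le> ?w (k + n)" using \<delta>' by (intro powr_mono2) auto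
        then show "real n powr (a - \<delta>') * \<bar>?d (k + n)\<bar> \<le> ?w (k + n) * \<bar>?d (k + n)\<bar>"
          by (rule mult_right_mono) simp
      qed
      finally have "real n powr (a - \<delta>') * \<bar>x n - V\<bar> \<le> ?t n" .
      then have "\<bar>x n - V\<bar> \<le> ?t n / real n powr (a - \<delta>')" using n0 by (simp add: field_simps)
      also have "\<dots> = ?t n * real n powr (- a + \<delta>')" by (simp add: powr_minus_divide[symmetric] divide_powr_uminus)
      finally show ?thesis .
    qed
    show ?thesis
    proof (rule landau_o.smallI)
      fix c :: real assume c: "0 < c"
      have "\<forall>\<^sub>F n in sequentially. ?t n < c" using t0 c by (rule order_tendstoD)
      then show "\<forall>\<^sub>F n in sequentially. norm (x n - V) \<le> c * norm (real n powr (- a + \<delta>))"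
        using eventually_ge_at_top[of 1]
      proof eventually_elim
        case (elim n)
        have "\<bar>x n - V\<bar> \<le> ?t n * real n powr (- a + \<delta>')" by (rule le[OF elim(2)])
        also have "\<dots> \<le> c * real n powr (- a + \<delta>)"
          using elim c \<delta>' by (intro mult_mono powr_mono) auto
        finally show ?case by simp
      qed
    qed
  qed
  with lim show ?thesis by blast
qed

section \<open>The annealed law\<close>

text \<open>Measurability of an infinite product of kernels is tested on cylinders, where the mass
  is a finite product of measurable functions; cylinders are stable under intersection and generate
  the product \<sigma>-algebra.\<close>

lemma measurable_PiM_kernel:
  assumes K: "\<And>i. i \<in> I \<Longrightarrow> K i \<in> M \<rightarrow>\<^sub>M subprob_algebra (N i)"
    and P: "\<And>i x. i \<in> I \<Longrightarrow> x \<in> space M \<Longrightarrow> prob_space (K i x)"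
  shows "(\<lambda>x. \<Pi>\<^sub>M i\<in>I. K i x) \<in> M \<rightarrow>\<^sub>M subprob_algebra (\<Pi>\<^sub>M i\<in>I. N i)"
proof (rule measurable_subprob_algebra_generated[OF sets_PiM Int_stable_prod_algebra prod_algebra_sets_into_space])
  fix x assume x: "x \<in> space M"
  have ps: "prob_space (\<Pi>\<^sub>M i\<in>I. K i x)" by (intro prob_space_PiM P x)
  then show "subprob_space (\<Pi>\<^sub>M i\<in>I. K i x)" by (rule prob_space_imp_subprob_space)
  show "sets (\<Pi>\<^sub>M i\<in>I. K i x) = sets (\<Pi>\<^sub>M i\<in>I. N i)"
    by (intro sets_PiM_cong refl) (rule sets_kernel[OF K x])
next
  fix A assume "A \<in> prod_algebra I N"
  then obtain J E where J: "A = prod_emb I N J (\<Pi>\<^sub>E j\<in>J. E j)" "finite J" "J \<subseteq> I" "\<And>j. j \<in> J \<Longrightarrow> E j \<in> sets (N j)"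
    using prod_algebraE[of A I N] by metis
  have eq: "emeasure (\<Pi>\<^sub>M i\<in>I. K i x) A = (\<Prod>j\<in>J. emeasure (K j x) (E j))" if x: "x \<in> space M" for x
  proof -
    have s: "sets (K i x) = sets (N i)" if "i \<in> I" for i using sets_kernel[OF K[OF that] x] .
    have "A = prod_emb I (\<lambda>i. K i x) J (\<Pi>\<^sub>E j\<in>J. E j)"
      unfolding J(1) prod_emb_def using s[THEN sets_eq_imp_space_eq] by (simp cong: PiE_cong)
    then show ?thesis
      using J(2,3,4) s by (simp only:) (intro emeasure_PiM_emb P x, auto)
  qed
  have "(\<lambda>x. \<Prod>j\<in>J. emeasure (K j x) (E j)) \<in> borel_measurable M"
    using J(3,4) by (intro borel_measurable_prod_ennreal measurable_emeasure_kernel[OF K]) auto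
  then show "(\<lambda>x. emeasure (\<Pi>\<^sub>M i\<in>I. K i x) A) \<in> borel_measurable M"
    by (rule measurable_cong[THEN iffD1, rotated]) (simp add: eq)
next
  have "emeasure (\<Pi>\<^sub>M i\<in>I. K i x) (\<Pi>\<^sub>E i\<in>I. space (N i)) = 1" if x: "x \<in> space M" for x
  proof -
    have s: "space (K i x) = space (N i)" if "i \<in> I" for i
      using sets_kernel[OF K[OF that] x] by (rule sets_eq_imp_space_eq)
    have "(\<Pi>\<^sub>E i\<in>I. space (N i)) = space (\<Pi>\<^sub>M i\<in>I. K i x)"
      unfolding space_PiM using s by (simp cong: PiE_cong)
    then show ?thesis
      using prob_space.emeasure_space_1[OF prob_space_PiM[of I "\<lambda>i. K i x"]] P[OF _ x] by simp
  qed
  then show "(\<lambda>x. emeasure (\<Pi>\<^sub>M i\<in>I. K i x) (\<Pi>\<^sub>E i\<in>I. space (N i))) \<in> borel_measurable M"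
    by (simp cong: measurable_cong)
qed

locale brw =
  fixes \<tau> :: "'e measure" and p :: "'e \<Rightarrow> nat pmf" and G :: "'e \<Rightarrow> real measure"
  assumes random_environment: "random_environment \<tau> p G"
begin

lemma prob_\<tau>: "prob_space \<tau>"
  and pmf_meas: "(\<lambda>x. pmf (p x) k) \<in> borel_measurable \<tau>"
  and G_kernel: "G \<in> \<tau> \<rightarrow>\<^sub>M prob_algebra borel"
  using random_environment by (auto simp: random_environment_def)

sublocale \<tau>: prob_space \<tau> by (rule prob_\<tau>)

abbreviation "E \<equiv> env_law \<tau>"

sublocale E: prob_space E by (rule prob_space_env_law[OF prob_\<tau>])

lemma E_space: "\<xi> \<in> space E \<Longrightarrow> \<xi> n \<in> space \<tau>"
  by (auto simp: env_law_def space_PiM)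

lemma G_space: "x \<in> space \<tau> \<Longrightarrow> G x \<in> space (prob_algebra borel)"
  using G_kernel by (rule measurable_space)

lemma quenched: "\<xi> \<in> space E \<Longrightarrow> quenched G \<xi>"
  by unfold_locales (intro G_space E_space)

lemma G_kernel' [measurable]: "G \<in> \<tau> \<rightarrow>\<^sub>M subprob_algebra borel"
  using G_kernel by (rule measurable_prob_algebraD)

text \<open>The hypothesis gives measurability of single point masses; the mass of a general set is
  a series of these.\<close>

lemma p_kernel [measurable]: "(\<lambda>x. measure_pmf (p x)) \<in> \<tau> \<rightarrow>\<^sub>M subprob_algebra (count_space UNIV)"
proof (rule measurable_subprob_algebra)
  fix A :: "nat set"
  have "emeasure (measure_pmf (p x)) A = (\<Sum>k. ennreal (pmf (p x) k) * indicator A k)" for x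
  proof -
    have "emeasure (measure_pmf (p x)) A = (\<integral>\<^sup>+k. indicator A k \<partial>measure_pmf (p x))" by simp
    also have "\<dots> = (\<integral>\<^sup>+k. ennreal (pmf (p x) k) * indicator A k \<partial>count_space UNIV)"
      by (rule nn_integral_measure_pmf)
    finally show ?thesis by (simp add: nn_integral_count_space_nat)
  qed
  then show "(\<lambda>x. emeasure (measure_pmf (p x)) A) \<in> borel_measurable \<tau>"
    using pmf_meas by simp
qed (auto intro: measure_pmf.subprob_space_axioms)

abbreviation "PS \<equiv> (\<Pi>\<^sub>M u\<in>seqs. count_space (UNIV :: nat set)) \<Otimes>\<^sub>M (\<Pi>\<^sub>M v\<in>seqs - {[]}. (borel :: real measure))"

lemma quenched_kernel: "quenched_law p G \<in> E \<rightarrow>\<^sub>M subprob_algebra PS"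
proof -
  have "(\<lambda>\<xi>. (\<Pi>\<^sub>M u\<in>seqs. measure_pmf (p (\<xi> (length u)))) \<Otimes>\<^sub>M (\<Pi>\<^sub>M v\<in>seqs - {[]}. G (\<xi> (length v - 1))))
    \<in> E \<rightarrow>\<^sub>M subprob_algebra PS"
  proof (intro measurable_pair_measure measurable_PiM_kernel)
    show "(\<lambda>\<xi>. measure_pmf (p (\<xi> (length u)))) \<in> E \<rightarrow>\<^sub>M subprob_algebra (count_space UNIV)" for u :: "nat list"
      by (rule measurable_compose[OF measurable_env_component p_kernel])
    show "(\<lambda>\<xi>. G (\<xi> (length v - 1))) \<in> E \<rightarrow>\<^sub>M subprob_algebra borel" for v :: "nat list"
      by (rule measurable_compose[OF measurable_env_component G_kernel'])
    show "prob_space (G (\<xi> (length v - 1)))" if "\<xi> \<in> space E" for \<xi> and v :: "nat list"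
      using quenched.prob_G[OF quenched[OF that]] .
  qed (rule prob_space_measure_pmf)
  then show ?thesis by (simp only: quenched_law_def[abs_def])
qed

lemma sets_quenched: "\<xi> \<in> space E \<Longrightarrow> sets (quenched_law p G \<xi>) = sets PS"
  using quenched.sets_M[OF quenched] .

lemma space_quenched: "\<xi> \<in> space E \<Longrightarrow> space (quenched_law p G \<xi>) = space PS"
  using sets_quenched by (rule sets_eq_imp_space_eq)

lemma prob_quenched: "\<xi> \<in> space E \<Longrightarrow> prob_space (quenched_law p G \<xi>)"
proof -
  assume "\<xi> \<in> space E"
  then interpret quenched p G \<xi> by (rule quenched)
  show ?thesis by (rule M.prob_space_axioms)
qed

abbreviation "AL \<equiv> annealed_law \<tau> p G"

lemma annealed_kernel: "(\<lambda>\<xi>. return E \<xi> \<Otimes>\<^sub>M quenched_law p G \<xi>) \<in> E \<rightarrow>\<^sub>M subprob_algebra (E \<Otimes>\<^sub>M PS)"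
  by (intro measurable_pair_measure quenched_kernel return_measurable)

lemma sets_annealed [measurable_cong]: "sets AL = sets (E \<Otimes>\<^sub>M PS)"
  unfolding annealed_law_def
  by (rule sets_bind[OF sets_kernel[OF annealed_kernel] E.not_empty])

lemma space_annealed: "space AL = space E \<times> space PS"
  using sets_eq_imp_space_eq[OF sets_annealed] by (simp add: space_pair_measure)

lemma nn_integral_annealed:
  assumes f: "f \<in> borel_measurable (E \<Otimes>\<^sub>M PS)"
  shows "(\<integral>\<^sup>+\<omega>. f \<omega> \<partial>AL) = (\<integral>\<^sup>+\<xi>. \<integral>\<^sup>+w. f (\<xi>, w) \<partial>quenched_law p G \<xi> \<partial>E)"
proof -
  have "(\<integral>\<^sup>+\<omega>. f \<omega> \<partial>AL) = (\<integral>\<^sup>+\<xi>. \<integral>\<^sup>+\<omega>. f \<omega> \<partial>(return E \<xi> \<Otimes>\<^sub>M quenched_law p G \<xi>) \<partial>E)"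
    unfolding annealed_law_def by (rule nn_integral_bind[OF f annealed_kernel])
  also have "\<dots> = (\<integral>\<^sup>+\<xi>. \<integral>\<^sup>+w. f (\<xi>, w) \<partial>quenched_law p G \<xi> \<partial>E)"
  proof (rule nn_integral_cong)
    fix \<xi> assume \<xi>: "\<xi> \<in> space E"
    interpret q: prob_space "quenched_law p G \<xi>" by (rule prob_quenched[OF \<xi>])
    have f': "f \<in> borel_measurable (return E \<xi> \<Otimes>\<^sub>M quenched_law p G \<xi>)"
      using f by (simp add: measurable_cong_sets[OF sets_pair_measure_cong[OF sets_return sets_quenched[OF \<xi>]] refl])
    have f'': "f \<in> borel_measurable (E \<Otimes>\<^sub>M quenched_law p G \<xi>)"
      using f by (simp add: measurable_cong_sets[OF sets_pair_measure_cong[OF refl sets_quenched[OF \<xi>]] refl])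
    have "(\<integral>\<^sup>+\<omega>. f \<omega> \<partial>(return E \<xi> \<Otimes>\<^sub>M quenched_law p G \<xi>))
      = (\<integral>\<^sup>+x. \<integral>\<^sup>+w. f (x, w) \<partial>quenched_law p G \<xi> \<partial>return E \<xi>)"
      by (rule q.nn_integral_fst[OF f', symmetric])
    also have "\<dots> = (\<integral>\<^sup>+w. f (\<xi>, w) \<partial>quenched_law p G \<xi>)"
      by (rule nn_integral_return[OF \<xi> q.borel_measurable_nn_integral_fst[OF f'']])
    finally show "(\<integral>\<^sup>+\<omega>. f \<omega> \<partial>(return E \<xi> \<Otimes>\<^sub>M quenched_law p G \<xi>)) = (\<integral>\<^sup>+w. f (\<xi>, w) \<partial>quenched_law p G \<xi>)" .
  qed
  finally show ?thesis .
qed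

lemma section_meas:
  assumes "f \<in> E \<Otimes>\<^sub>M PS \<rightarrow>\<^sub>M N" "\<xi> \<in> space E"
  shows "(\<lambda>w. f (\<xi>, w)) \<in> quenched_law p G \<xi> \<rightarrow>\<^sub>M N"
  using measurable_compose[OF measurable_Pair1'[OF assms(2)] assms(1)]
  by (simp add: measurable_cong_sets[OF sets_quenched[OF assms(2)] refl])

lemma prob_annealed: "prob_space AL"
proof
  have "emeasure AL (space AL) = (\<integral>\<^sup>+\<omega>. 1 \<partial>AL)" by simp
  also have "\<dots> = (\<integral>\<^sup>+\<xi>. \<integral>\<^sup>+w. 1 \<partial>quenched_law p G \<xi> \<partial>E)" by (rule nn_integral_annealed) simp
  also have "\<dots> = (\<integral>\<^sup>+\<xi>. 1 \<partial>E)"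
    by (intro nn_integral_cong) (simp add: prob_space.emeasure_space_1[OF prob_quenched])
  finally show "emeasure AL (space AL) = 1" by (simp add: E.emeasure_space_1)
qed

sublocale AL: prob_space AL by (rule prob_annealed)

text \<open>Measurability of \<open>P\<close> is what glues the quenched null sets, which vary with
  \<xi>, into one annealed null set.\<close>

lemma AE_annealedI:
  assumes P: "Measurable.pred (E \<Otimes>\<^sub>M PS) P" and ae: "AE \<xi> in E. AE w in quenched_law p G \<xi>. P (\<xi>, w)"
  shows "AE \<omega> in AL. P \<omega>"
proof -
  let ?f = "\<lambda>\<omega>. of_bool (\<not> P \<omega>) :: ennreal"
  have f: "?f \<in> borel_measurable (E \<Otimes>\<^sub>M PS)" using P by measurable
  have "(\<integral>\<^sup>+\<omega>. ?f \<omega> \<partial>AL) = (\<integral>\<^sup>+\<xi>. \<integral>\<^sup>+w. ?f (\<xi>, w) \<partial>quenched_law p G \<xi> \<partial>E)" by (rule nn_integral_annealed[OF f])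
  also have "\<dots> = (\<integral>\<^sup>+\<xi>. 0 \<partial>E)"
  proof (rule nn_integral_cong_AE)
    show "AE \<xi> in E. (\<integral>\<^sup>+w. ?f (\<xi>, w) \<partial>quenched_law p G \<xi>) = 0"
      using ae
    proof (rule AE_mp, intro AE_I2 impI)
      fix \<xi> assume "AE w in quenched_law p G \<xi>. P (\<xi>, w)"
      then have "(\<integral>\<^sup>+w. ?f (\<xi>, w) \<partial>quenched_law p G \<xi>) = (\<integral>\<^sup>+w. 0 \<partial>quenched_law p G \<xi>)"
        by (intro nn_integral_cong_AE) (auto elim: eventually_mono)
      then show "(\<integral>\<^sup>+w. ?f (\<xi>, w) \<partial>quenched_law p G \<xi>) = 0" by simp
    qed
  qed
  finally have "(\<integral>\<^sup>+\<omega>. ?f \<omega> \<partial>AL) = 0" by simp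
  then have "AE \<omega> in AL. ?f \<omega> = 0"
    by (subst (asm) nn_integral_0_iff_AE) (use f in measurable)
  then show ?thesis by (auto elim: eventually_mono)
qed

text \<open>A vanishing quenched integral says that the positive and negative parts have equal
  finite integrals, and in this form it can be averaged with
  \<open>nn_integral_annealed\<close>.\<close>

lemma annealed_integral_zero:
  fixes F :: "_ \<Rightarrow> real"
  assumes F: "integrable AL F"
    and ae: "AE \<xi> in E. integrable (quenched_law p G \<xi>) (\<lambda>w. F (\<xi>, w)) \<and> (\<integral>w. F (\<xi>, w) \<partial>quenched_law p G \<xi>) = 0"
  shows "(\<integral>\<omega>. F \<omega> \<partial>AL) = 0"
proof -
  have Fm: "F \<in> borel_measurable (E \<Otimes>\<^sub>M PS)" using borel_measurable_integrable[OF F] by measurable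
  have Fp: "(\<lambda>\<omega>. ennreal (F \<omega>)) \<in> borel_measurable (E \<Otimes>\<^sub>M PS)" "(\<lambda>\<omega>. ennreal (- F \<omega>)) \<in> borel_measurable (E \<Otimes>\<^sub>M PS)"
    using Fm by measurable
  have "(\<integral>\<^sup>+\<omega>. ennreal (F \<omega>) \<partial>AL) = (\<integral>\<^sup>+\<xi>. \<integral>\<^sup>+w. ennreal (F (\<xi>, w)) \<partial>quenched_law p G \<xi> \<partial>E)"
    by (rule nn_integral_annealed[OF Fp(1)])
  also have "\<dots> = (\<integral>\<^sup>+\<xi>. \<integral>\<^sup>+w. ennreal (- F (\<xi>, w)) \<partial>quenched_law p G \<xi> \<partial>E)"
  proof (rule nn_integral_cong_AE)
    show "AE \<xi> in E. (\<integral>\<^sup>+w. ennreal (F (\<xi>, w)) \<partial>quenched_law p G \<xi>) = (\<integral>\<^sup>+w. ennreal (- F (\<xi>, w)) \<partial>quenched_law p G \<xi>)"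
      using ae
    proof (rule AE_mp, intro AE_I2 impI)
      fix \<xi> assume a: "integrable (quenched_law p G \<xi>) (\<lambda>w. F (\<xi>, w)) \<and> (\<integral>w. F (\<xi>, w) \<partial>quenched_law p G \<xi>) = 0"
      then have "enn2real (\<integral>\<^sup>+w. ennreal (F (\<xi>, w)) \<partial>quenched_law p G \<xi>) = enn2real (\<integral>\<^sup>+w. ennreal (- F (\<xi>, w)) \<partial>quenched_law p G \<xi>)"
        using real_lebesgue_integral_def[of "quenched_law p G \<xi>" "\<lambda>w. F (\<xi>, w)"] by simp
      moreover have "(\<integral>\<^sup>+w. ennreal (F (\<xi>, w)) \<partial>quenched_law p G \<xi>) \<noteq> \<infinity>" "(\<integral>\<^sup>+w. ennreal (- F (\<xi>, w)) \<partial>quenched_law p G \<xi>) \<noteq> \<infinity>"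
        using a by (auto simp: real_integrable_def)
      ultimately show "(\<integral>\<^sup>+w. ennreal (F (\<xi>, w)) \<partial>quenched_law p G \<xi>) = (\<integral>\<^sup>+w. ennreal (- F (\<xi>, w)) \<partial>quenched_law p G \<xi>)"
        by (metis ennreal_enn2real infinity_ennreal_def top.not_eq_extremum)
    qed
  qed
  also have "\<dots> = (\<integral>\<^sup>+\<omega>. ennreal (- F \<omega>) \<partial>AL)"
    by (rule nn_integral_annealed[OF Fp(2), symmetric])
  finally show ?thesis unfolding real_lebesgue_integral_def[OF F] by simp
qed

lemma annealed_fst:
  fixes f :: "_ \<Rightarrow> real"
  assumes f [measurable]: "f \<in> borel_measurable E"
  shows "integrable AL (\<lambda>\<omega>. f (fst \<omega>)) \<longleftrightarrow> integrable E f" "(\<integral>\<omega>. f (fst \<omega>) \<partial>AL) = (\<integral>\<xi>. f \<xi> \<partial>E)"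
proof -
  have fst [measurable]: "fst \<in> AL \<rightarrow>\<^sub>M E" by measurable
  have "distr AL E fst = E"
  proof (rule measure_eqI_nn_integral)
    fix g :: "_ \<Rightarrow> ennreal" assume "g \<in> borel_measurable (distr AL E fst)"
    then have g [measurable]: "g \<in> borel_measurable E" by simp
    have gm: "(\<lambda>\<omega>. g (fst \<omega>)) \<in> borel_measurable (E \<Otimes>\<^sub>M PS)" by measurable
    have "(\<integral>\<^sup>+x. g x \<partial>distr AL E fst) = (\<integral>\<^sup>+\<omega>. g (fst \<omega>) \<partial>AL)" by (simp add: nn_integral_distr)
    also have "\<dots> = (\<integral>\<^sup>+\<xi>. \<integral>\<^sup>+w. g \<xi> \<partial>quenched_law p G \<xi> \<partial>E)"
      using nn_integral_annealed[OF gm] by simp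
    also have "\<dots> = (\<integral>\<^sup>+\<xi>. g \<xi> \<partial>E)"
      by (intro nn_integral_cong) (simp add: prob_space.emeasure_space_1[OF prob_quenched])
    finally show "(\<integral>\<^sup>+x. g x \<partial>distr AL E fst) = (\<integral>\<^sup>+x. g x \<partial>E)" .
  qed simp
  then show "integrable AL (\<lambda>\<omega>. f (fst \<omega>)) \<longleftrightarrow> integrable E f" "(\<integral>\<omega>. f (fst \<omega>) \<partial>AL) = (\<integral>\<xi>. f \<xi> \<partial>E)"
    using integrable_distr_eq[OF fst f] integral_distr[OF fst f] by auto
qed

lemma AE_annealed_fst:
  assumes P: "Measurable.pred E P" and ae: "AE \<omega> in AL. P (fst \<omega>)"
  shows "AE \<xi> in E. P \<xi>"
proof -
  have f: "(\<lambda>\<omega>. of_bool (\<not> P (fst \<omega>)) :: ennreal) \<in> borel_measurable (E \<Otimes>\<^sub>M PS)" using P by measurable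
  have "(\<integral>\<^sup>+\<omega>. of_bool (\<not> P (fst \<omega>)) \<partial>AL) = (\<integral>\<^sup>+\<omega>. 0 \<partial>AL)"
    using ae by (intro nn_integral_cong_AE) (auto elim: eventually_mono)
  then have "(\<integral>\<^sup>+\<xi>. \<integral>\<^sup>+w. of_bool (\<not> P \<xi>) \<partial>quenched_law p G \<xi> \<partial>E) = 0"
    using nn_integral_annealed[OF f] by simp
  moreover have "(\<integral>\<^sup>+\<xi>. \<integral>\<^sup>+w. of_bool (\<not> P \<xi>) \<partial>quenched_law p G \<xi> \<partial>E) = (\<integral>\<^sup>+\<xi>. of_bool (\<not> P \<xi>) \<partial>E)"
    by (intro nn_integral_cong) (simp add: prob_space.emeasure_space_1[OF prob_quenched])
  ultimately have "(\<integral>\<^sup>+\<xi>. of_bool (\<not> P \<xi>) \<partial>E) = 0" by simp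
  then have "AE \<xi> in E. (of_bool (\<not> P \<xi>) :: ennreal) = 0"
    by (subst (asm) nn_integral_0_iff_AE) (use P in measurable)
  then show ?thesis by (auto elim: eventually_mono)
qed

lemma AE_\<tau>_of_E0:
  assumes P: "Measurable.pred \<tau> P" and ae: "AE \<xi> in E. P (\<xi> 0)"
  shows "AE x in \<tau>. P x"
proof -
  have "AE x in distr E \<tau> (\<lambda>\<xi>. \<xi> 0). P x"
    using ae P by (subst AE_distr_iff) (auto intro: measurable_env_component)
  then show ?thesis by (simp only: distr_env_component[OF prob_\<tau>])
qed

end

section \<open>Consequences of the moment hypotheses\<close>

context quenched
begin

lemma nn_integral_N_hat:
  "(\<integral>\<^sup>+w. h (offspring w []) \<partial>M) = (\<integral>\<^sup>+k. h k \<partial>measure_pmf (p (\<xi> 0)))"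
proof -
  interpret r: resampling M "measure_pmf (p (\<xi> (length ([]::nat list))))"
    "\<lambda>(k, w). ((fst w)([] := k), snd w)" "\<lambda>w. offspring w []"
    by (rule resampling_offspring) simp
  show ?thesis using r.nn_integral_coordinate[of h] by simp
qed

lemma nn_integral_L_hat:
  assumes h: "h \<in> borel_measurable borel"
  shows "(\<integral>\<^sup>+w. h (displ w [Suc 0]) \<partial>M) = (\<integral>\<^sup>+x. h x \<partial>G (\<xi> 0))"
proof -
  have "[Suc 0] \<in> seqs" using seqs_replicate[of 1] by simp
  then interpret r: resampling M "G (\<xi> (length [Suc 0] - 1))"
    "\<lambda>(x, w). (fst w, (snd w)([Suc 0] := x))" "\<lambda>w. displ w [Suc 0]"
    by (intro resampling_displ) auto
  have "h \<in> borel_measurable (G (\<xi> (length [Suc 0] - 1)))" using h by measurable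
  from r.nn_integral_coordinate[OF this] show ?thesis by simp
qed

end

lemma N1_eq_hpol: "N1 p G n (\<xi>, w) = 1 / Pi_norm p G n \<xi> * (\<Sum>u\<in>generation w n. hpol p G 1 n \<xi> (position w u - ell p G n \<xi>))"
  by (simp add: N1_def hpol_def)

text \<open>The square under the integral makes \<open>s_mom\<close> of order 2 nonnegative in every
  environment, since a divergent Bochner integral is 0 by convention.\<close>

lemma s_dev_square: "(s_dev p G n \<xi>)\<^sup>2 = s_mom p G 2 n \<xi>"
proof -
  have "0 \<le> s_mom p G 2 n \<xi>" unfolding s_mom_def central_moment_def by (intro sum_nonneg) simp
  then show ?thesis by (simp add: s_dev_def)
qed

lemma N2_eq_hpol: "N2 p G n (\<xi>, w) = 1 / Pi_norm p G n \<xi> * (\<Sum>u\<in>generation w n. hpol p G 2 n \<xi> (position w u - ell p G n \<xi>))"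
  by (simp add: N2_def hpol_def s_dev_square)

lemma N3_eq_hpol: "N3 p G n (\<xi>, w) = 1 / Pi_norm p G n \<xi> * (\<Sum>u\<in>generation w n. hpol p G 3 n \<xi> (position w u - ell p G n \<xi>))"
  by (simp add: N3_def hpol_def s_dev_square)

lemma power_le_one_plus_powr:
  fixes y \<eta> :: real
  assumes "real Q \<le> \<eta>"
  shows "\<bar>y\<bar> ^ Q \<le> 1 + \<bar>y\<bar> powr \<eta>"
proof (cases "\<bar>y\<bar> \<le> 1")
  case True
  then have "\<bar>y\<bar> ^ Q \<le> 1" by (simp add: power_le_one)
  then show ?thesis by (simp add: add_increasing2)
next
  case False
  then have "\<bar>y\<bar> ^ Q = \<bar>y\<bar> powr real Q" by (subst powr_realpow) auto
  also have "\<dots> \<le> \<bar>y\<bar> powr \<eta>" using False assms by (intro powr_mono) auto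
  finally show ?thesis by simp
qed

text \<open>Jensen's inequality via the tangent line of the power function at \<open>c\<close>, the
  mean of the absolute value. This line is Bernoulli's inequality rescaled by \<open>c\<close>,
  which is why \<open>c = 0\<close> is treated separately.\<close>

lemma (in prob_space) abs_expectation_power_le:
  fixes X :: "'a \<Rightarrow> real"
  assumes X: "X \<in> borel_measurable M" and i: "integrable M (\<lambda>x. \<bar>X x\<bar> ^ Q)"
  shows "\<bar>expectation X\<bar> ^ Q \<le> expectation (\<lambda>x. \<bar>X x\<bar> ^ Q)"
proof -
  define c where "c = expectation (\<lambda>x. \<bar>X x\<bar>)"
  have c0: "0 \<le> c" unfolding c_def by (rule Bochner_Integration.integral_nonneg) simp
  have le: "\<bar>expectation X\<bar> \<le> c" unfolding c_def by (rule integral_abs_bound)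
  have nn: "0 \<le> expectation (\<lambda>x. \<bar>X x\<bar> ^ Q)" by (rule Bochner_Integration.integral_nonneg) simp
  consider "Q = 0" | "0 < Q" "c = 0" | "0 < Q" "0 < c" using c0 by fastforce
  then show ?thesis
  proof cases
    case 1
    then show ?thesis by (simp add: prob_space)
  next
    case 2
    then have "\<bar>expectation X\<bar> = 0" using le by linarith
    then have "\<bar>expectation X\<bar> ^ Q = 0" using 2 by (simp only: zero_power)
    then show ?thesis using nn by linarith
  next
    case 3
    note c = 3(2)
  have X1: "integrable M (\<lambda>x. \<bar>X x\<bar>)" using integrable_abs_power_le[OF X i, of 1] 3 by simp
  have tangent: "c ^ Q * (1 + real Q * (\<bar>X x\<bar> / c - 1)) \<le> \<bar>X x\<bar> ^ Q" for x
  proof -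
    have "1 + real Q * (\<bar>X x\<bar> / c - 1) \<le> (1 + (\<bar>X x\<bar> / c - 1)) ^ Q"
      using c by (intro Bernoulli_inequality) simp
    then have "c ^ Q * (1 + real Q * (\<bar>X x\<bar> / c - 1)) \<le> c ^ Q * (\<bar>X x\<bar> / c) ^ Q"
      using c by (intro mult_left_mono) auto
    then show ?thesis using c by (simp add: power_divide)
  qed
  have "c ^ Q = expectation (\<lambda>x. c ^ Q * (1 + real Q * (\<bar>X x\<bar> / c - 1)))"
    using X1 c by (simp add: prob_space c_def[symmetric])
  also have "\<dots> \<le> expectation (\<lambda>x. \<bar>X x\<bar> ^ Q)"
    using X1 by (intro integral_mono i tangent) simp
  finally have "c ^ Q \<le> expectation (\<lambda>x. \<bar>X x\<bar> ^ Q)" .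
  moreover have "\<bar>expectation X\<bar> ^ Q \<le> c ^ Q"
    using le by (intro power_mono) simp_all
  ultimately show ?thesis by (rule order_trans[rotated])
  qed
qed

context brw
begin

text \<open>The mean as a function of a single environment state: hypotheses on m_0 become
  statements about \<tau> and thereby apply to every \<xi>_n.\<close>

definition \<mu> :: "'e \<Rightarrow> real" where
  "\<mu> x = measure_pmf.expectation (p x) real"

lemma \<mu>_meas [measurable]: "\<mu> \<in> borel_measurable \<tau>"
  unfolding \<mu>_def[abs_def]
  by (rule measurable_compose[OF p_kernel integral_measurable_subprob_algebra]) simp

lemma mean_offspring_\<mu>: "\<xi> \<in> space E \<Longrightarrow> mean_offspring p G n \<xi> = \<mu> (\<xi> n)"
  using quenched.mean_offspring_eq[OF quenched] by (simp add: \<mu>_def)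

lemma Emeas: "f \<in> borel_measurable \<tau> \<Longrightarrow> (\<lambda>\<xi>. f (\<xi> n)) \<in> borel_measurable E"
  by (rule measurable_compose[OF measurable_env_component])

lemma mean_offspring_meas [measurable]: "mean_offspring p G n \<in> borel_measurable E"
  by (rule measurable_cong[THEN iffD2, OF mean_offspring_\<mu> Emeas[OF \<mu>_meas]])

lemma Pi_norm_meas [measurable]: "Pi_norm p G n \<in> borel_measurable E"
  unfolding Pi_norm_def[abs_def] by measurable

definition ml :: "'e \<Rightarrow> real" where
  "ml x = (\<integral>y. y \<partial>G x)"

lemma ml_meas [measurable]: "ml \<in> borel_measurable \<tau>"
  unfolding ml_def[abs_def]
  by (rule measurable_compose[OF G_kernel' integral_measurable_subprob_algebra]) simp

lemma mean_displ_meas [measurable]: "mean_displ p G n \<in> borel_measurable E"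
  by (rule measurable_cong[THEN iffD2, OF _ Emeas[OF ml_meas, of n]])
     (simp add: ml_def quenched.mean_displ_eq[OF quenched])

lemma ell_meas [measurable]: "ell p G n \<in> borel_measurable E"
  unfolding ell_def[abs_def] by measurable

text \<open>The integrand varies with \<open>x\<close> too, so the kernel is pushed forward along
  \<open>Pair x\<close> to the product space, on which the integrand is one fixed function.\<close>

lemma G_integral_meas:
  fixes f :: "'e \<Rightarrow> real \<Rightarrow> real"
  assumes "(\<lambda>(x, y). f x y) \<in> borel_measurable (\<tau> \<Otimes>\<^sub>M borel)"
  shows "(\<lambda>x. \<integral>y. f x y \<partial>G x) \<in> borel_measurable \<tau>"
proof -
  have K: "(\<lambda>x. distr (G x) (\<tau> \<Otimes>\<^sub>M borel) (Pair x)) \<in> \<tau> \<rightarrow>\<^sub>M subprob_algebra (\<tau> \<Otimes>\<^sub>M borel)"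
    by (rule measurable_distr2[OF _ G_kernel']) simp
  show ?thesis
  proof (rule measurable_cong[THEN iffD2, OF _ measurable_compose[OF K integral_measurable_subprob_algebra[OF assms]]])
    fix x assume x: "x \<in> space \<tau>"
    have "sets (G x) = sets borel" using G_space[OF x] by (simp add: space_prob_algebra)
    then have P: "Pair x \<in> G x \<rightarrow>\<^sub>M \<tau> \<Otimes>\<^sub>M borel"
      using measurable_Pair1'[OF x, of borel] measurable_cong_sets[OF _ refl, of "G x" borel] by blast
    show "(\<integral>y. f x y \<partial>G x) = (\<integral>z. (case z of (x, y) \<Rightarrow> f x y) \<partial>distr (G x) (\<tau> \<Otimes>\<^sub>M borel) (Pair x))"
      by (simp only: integral_distr[OF P assms] prod.case)
  qed
qed

lemma central_moment_meas [measurable]: "central_moment p G r n \<in> borel_measurable E"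
proof -
  have "(\<lambda>x. \<integral>y. (y - ml x) ^ r \<partial>G x) \<in> borel_measurable \<tau>"
    by (rule G_integral_meas) measurable
  from Emeas[OF this] show ?thesis
    by (rule measurable_cong[THEN iffD2, rotated])
       (simp add: ml_def quenched.central_moment_eq[OF quenched])
qed

lemma s_mom_meas [measurable]: "s_mom p G r n \<in> borel_measurable E"
  unfolding s_mom_def[abs_def] by measurable

lemma cabs_moment_meas [measurable]: "cabs_moment G r \<in> borel_measurable \<tau>"
proof -
  have "(\<lambda>x. \<integral>y. \<bar>y - ml x\<bar> ^ r \<partial>G x) \<in> borel_measurable \<tau>"
    by (rule G_integral_meas) measurable
  then show ?thesis by (simp add: cabs_moment_def[abs_def] ml_def)
qed

lemma G_meas: "x \<in> space \<tau> \<Longrightarrow> f \<in> borel_measurable borel \<Longrightarrow> f \<in> borel_measurable (G x)"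
  using G_space[of x] measurable_cong_sets[OF _ refl, of "G x" borel] by (auto simp: space_prob_algebra)

lemma G_nn_integral_meas:
  fixes f :: "real \<Rightarrow> ennreal"
  shows "f \<in> borel_measurable borel \<Longrightarrow> (\<lambda>x. \<integral>\<^sup>+y. f y \<partial>G x) \<in> borel_measurable \<tau>"
  by (rule measurable_compose[OF G_kernel' nn_integral_measurable_subprob_algebra])

lemma displ_moment_imp:
  assumes "displ_moment \<tau> p G \<eta>" "real Q \<le> \<eta>"
  shows "(\<integral>\<^sup>+x. \<integral>\<^sup>+y. ennreal (\<bar>y\<bar> ^ Q) \<partial>G x \<partial>\<tau>) < \<infinity>"
proof -
  have i: "integrable AL (\<lambda>\<omega>. \<bar>displ (snd \<omega>) [Suc 0]\<bar> powr \<eta>)"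
    using assms(1) by (simp add: displ_moment_def L_hat_def)
  have m: "(\<lambda>\<omega>. ennreal (\<bar>displ (snd \<omega>) [Suc 0]\<bar> powr \<eta>)) \<in> borel_measurable (E \<Otimes>\<^sub>M PS)"
    using borel_measurable_integrable[OF i] by measurable
  have "(\<integral>\<^sup>+x. \<integral>\<^sup>+y. ennreal (\<bar>y\<bar> powr \<eta>) \<partial>G x \<partial>\<tau>) = (\<integral>\<^sup>+\<xi>. \<integral>\<^sup>+y. ennreal (\<bar>y\<bar> powr \<eta>) \<partial>G (\<xi> 0) \<partial>E)"
    by (rule nn_integral_env_component[OF prob_\<tau>, symmetric])
       (rule G_nn_integral_meas, measurable)
  also have "\<dots> = (\<integral>\<^sup>+\<xi>. \<integral>\<^sup>+w. ennreal (\<bar>displ w [Suc 0]\<bar> powr \<eta>) \<partial>quenched_law p G \<xi> \<partial>E)"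
    by (intro nn_integral_cong quenched.nn_integral_L_hat[OF quenched, symmetric]) auto
  also have "\<dots> = (\<integral>\<^sup>+\<omega>. ennreal (\<bar>displ (snd \<omega>) [Suc 0]\<bar> powr \<eta>) \<partial>AL)"
    using nn_integral_annealed[OF m] by simp
  also have "\<dots> < \<infinity>" using i by (simp add: integrable_iff_bounded)
  finally have fin: "(\<integral>\<^sup>+x. \<integral>\<^sup>+y. ennreal (\<bar>y\<bar> powr \<eta>) \<partial>G x \<partial>\<tau>) < \<infinity>" .
  have "(\<integral>\<^sup>+x. \<integral>\<^sup>+y. ennreal (\<bar>y\<bar> ^ Q) \<partial>G x \<partial>\<tau>) \<le> (\<integral>\<^sup>+x. 1 + \<integral>\<^sup>+y. ennreal (\<bar>y\<bar> powr \<eta>) \<partial>G x \<partial>\<tau>)"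
  proof (rule nn_integral_mono)
    fix x assume x: "x \<in> space \<tau>"
    interpret D: prob_space "G x" using G_space[OF x] by (simp add: space_prob_algebra)
    have "(\<integral>\<^sup>+y. ennreal (\<bar>y\<bar> ^ Q) \<partial>G x) \<le> (\<integral>\<^sup>+y. 1 + ennreal (\<bar>y\<bar> powr \<eta>) \<partial>G x)"
      using power_le_one_plus_powr[OF assms(2)]
      by (intro nn_integral_mono) (simp flip: ennreal_1 ennreal_plus add: ennreal_leI)
    also have "\<dots> = 1 + (\<integral>\<^sup>+y. ennreal (\<bar>y\<bar> powr \<eta>) \<partial>G x)"
      by (subst nn_integral_add) (auto simp: D.emeasure_space_1 intro!: G_meas[OF x])
    finally show "(\<integral>\<^sup>+y. ennreal (\<bar>y\<bar> ^ Q) \<partial>G x) \<le> 1 + (\<integral>\<^sup>+y. ennreal (\<bar>y\<bar> powr \<eta>) \<partial>G x)" .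
  qed
  also have "\<dots> = 1 + (\<integral>\<^sup>+x. \<integral>\<^sup>+y. ennreal (\<bar>y\<bar> powr \<eta>) \<partial>G x \<partial>\<tau>)"
    by (subst nn_integral_add) (simp_all add: \<tau>.emeasure_space_1 G_nn_integral_meas)
  also have "\<dots> < \<infinity>" using fin by simp
  finally show ?thesis .
qed

lemma displ_moment_AE:
  assumes "displ_moment \<tau> p G \<eta>" "real Q \<le> \<eta>"
  shows "AE x in \<tau>. integrable (G x) (\<lambda>y. \<bar>y\<bar> ^ Q)"
proof -
  have "AE x in \<tau>. (\<integral>\<^sup>+y. ennreal (\<bar>y\<bar> ^ Q) \<partial>G x) \<noteq> \<infinity>"
    using displ_moment_imp[OF assms]
    by (intro nn_integral_PInf_AE G_nn_integral_meas) simp_all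
  then show ?thesis
  proof (rule AE_mp, intro AE_I2 impI)
    fix x assume x: "x \<in> space \<tau>" and fin: "(\<integral>\<^sup>+y. ennreal (\<bar>y\<bar> ^ Q) \<partial>G x) \<noteq> \<infinity>"
    show "integrable (G x) (\<lambda>y. \<bar>y\<bar> ^ Q)"
      using fin by (intro integrableI_bounded G_meas[OF x]) (auto simp: less_top)
  qed
qed

text \<open>Splitting according to the larger of the displacement and its mean costs
  \<open>2 ^ Q\<close>; Jensen bounds the power of the mean by the moment itself, which doubles it.
  Both steps are made state by state and then integrated over \<tau>.\<close>

lemma cabs_moment_finite:
  assumes "displ_moment \<tau> p G \<eta>" "real Q \<le> \<eta>" "1 \<le> Q"
  shows "(\<integral>\<^sup>+x. ennreal (cabs_moment G Q x) \<partial>\<tau>) < \<infinity>"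
proof -
  have "(\<integral>\<^sup>+x. ennreal (cabs_moment G Q x) \<partial>\<tau>) \<le> (\<integral>\<^sup>+x. ennreal (2 * 2 ^ Q) * (\<integral>\<^sup>+y. ennreal (\<bar>y\<bar> ^ Q) \<partial>G x) \<partial>\<tau>)"
  proof (rule nn_integral_mono_AE, rule AE_mp[OF displ_moment_AE[OF assms(1,2)]], intro AE_I2 impI)
    fix x assume x: "x \<in> space \<tau>" and i: "integrable (G x) (\<lambda>y. \<bar>y\<bar> ^ Q)"
    interpret D: prob_space "G x" using G_space[OF x] by (simp add: space_prob_algebra)
    have le: "\<bar>y - ml x\<bar> ^ Q \<le> 2 ^ Q * (\<bar>y\<bar> ^ Q + \<bar>ml x\<bar> ^ Q)" for y
    proof -
      have "\<bar>y - ml x\<bar> ^ Q \<le> (2 * max \<bar>y\<bar> \<bar>ml x\<bar>) ^ Q" by (intro power_mono) auto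
      also have "\<dots> = 2 ^ Q * (max \<bar>y\<bar> \<bar>ml x\<bar>) ^ Q" by (rule power_mult_distrib)
      also have "\<dots> \<le> 2 ^ Q * (\<bar>y\<bar> ^ Q + \<bar>ml x\<bar> ^ Q)" by (intro mult_left_mono) (auto simp: max_def)
      finally show ?thesis .
    qed
    have i2: "integrable (G x) (\<lambda>y. 2 ^ Q * (\<bar>y\<bar> ^ Q + \<bar>ml x\<bar> ^ Q))" using i by simp
    have i3: "integrable (G x) (\<lambda>y. \<bar>y - ml x\<bar> ^ Q)"
    proof (rule Bochner_Integration.integrable_bound[OF i2])
      show "(\<lambda>y. \<bar>y - ml x\<bar> ^ Q) \<in> borel_measurable (G x)" by (rule G_meas[OF x]) measurable
      show "AE y in G x. norm (\<bar>y - ml x\<bar> ^ Q) \<le> norm (2 ^ Q * (\<bar>y\<bar> ^ Q + \<bar>ml x\<bar> ^ Q))"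
        using order_trans[OF le abs_ge_self] by (intro AE_I2) simp
    qed
    have "cabs_moment G Q x \<le> (\<integral>y. 2 ^ Q * (\<bar>y\<bar> ^ Q + \<bar>ml x\<bar> ^ Q) \<partial>G x)"
      unfolding cabs_moment_def ml_def[symmetric] by (rule integral_mono[OF i3 i2 le])
    also have "\<dots> = 2 ^ Q * ((\<integral>y. \<bar>y\<bar> ^ Q \<partial>G x) + \<bar>ml x\<bar> ^ Q)"
      using i by (simp add: D.prob_space)
    also have "\<dots> \<le> 2 ^ Q * ((\<integral>y. \<bar>y\<bar> ^ Q \<partial>G x) + (\<integral>y. \<bar>y\<bar> ^ Q \<partial>G x))"
    proof (intro mult_left_mono add_left_mono)
      show "\<bar>ml x\<bar> ^ Q \<le> (\<integral>y. \<bar>y\<bar> ^ Q \<partial>G x)"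
        unfolding ml_def by (rule D.abs_expectation_power_le[OF _ i]) (rule G_meas[OF x], simp)
    qed simp
    finally have "cabs_moment G Q x \<le> 2 * 2 ^ Q * (\<integral>y. \<bar>y\<bar> ^ Q \<partial>G x)" by simp
    then have "ennreal (cabs_moment G Q x) \<le> ennreal (2 * 2 ^ Q * (\<integral>y. \<bar>y\<bar> ^ Q \<partial>G x))" by (rule ennreal_leI)
    also have "\<dots> = ennreal (2 * 2 ^ Q) * ennreal (\<integral>y. \<bar>y\<bar> ^ Q \<partial>G x)" by (rule ennreal_mult) auto
    also have "ennreal (\<integral>y. \<bar>y\<bar> ^ Q \<partial>G x) = (\<integral>\<^sup>+y. ennreal (\<bar>y\<bar> ^ Q) \<partial>G x)"
      using i by (intro nn_integral_eq_integral[symmetric]) auto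
    finally show "ennreal (cabs_moment G Q x) \<le> ennreal (2 * 2 ^ Q) * (\<integral>\<^sup>+y. ennreal (\<bar>y\<bar> ^ Q) \<partial>G x)" .
  qed
  also have "\<dots> = ennreal (2 * 2 ^ Q) * (\<integral>\<^sup>+x. \<integral>\<^sup>+y. ennreal (\<bar>y\<bar> ^ Q) \<partial>G x \<partial>\<tau>)"
    by (rule nn_integral_cmult) (simp add: G_nn_integral_meas)
  also have "\<dots> < \<infinity>" using displ_moment_imp[OF assms(1,2)] by (simp add: ennreal_mult_less_top)
  finally show ?thesis .
qed

lemma supercritical_AE:
  assumes "supercritical \<tau> p G"
  shows "AE x in \<tau>. integrable (measure_pmf (p x)) real \<and> 0 < \<mu> x"
proof (rule AE_\<tau>_of_E0)
  have [measurable]: "Measurable.pred \<tau> (\<lambda>x. integrable (measure_pmf (p x)) real)"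
    by (rule measurable_compose[OF p_kernel integrable_measurable_subprob_algebra]) simp
  show m: "Measurable.pred \<tau> (\<lambda>x. integrable (measure_pmf (p x)) real \<and> 0 < \<mu> x)" by measurable
  show "AE \<xi> in E. integrable (measure_pmf (p (\<xi> 0))) real \<and> 0 < \<mu> (\<xi> 0)"
  proof (rule AE_annealed_fst)
    show "Measurable.pred E (\<lambda>\<xi>. integrable (measure_pmf (p (\<xi> 0))) real \<and> 0 < \<mu> (\<xi> 0))"
      by (rule measurable_compose[OF measurable_env_component m])
    have "AE \<omega> in AL. integrable (quenched_law p G (fst \<omega>)) (N_hat 0) \<and> 0 < mean_offspring p G 0 (fst \<omega>)"
      using assms by (simp add: supercritical_def)
    then show "AE \<omega> in AL. integrable (measure_pmf (p (fst \<omega> 0))) real \<and> 0 < \<mu> (fst \<omega> 0)"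
    proof (rule AE_mp, intro AE_I2 impI)
      fix \<omega> assume "\<omega> \<in> space AL" and
        a: "integrable (quenched_law p G (fst \<omega>)) (N_hat 0) \<and> 0 < mean_offspring p G 0 (fst \<omega>)"
      then have \<xi>: "fst \<omega> \<in> space E" by (auto simp: space_annealed)
      show "integrable (measure_pmf (p (fst \<omega> 0))) real \<and> 0 < \<mu> (fst \<omega> 0)"
        using a quenched.integrable_N_hat_iff[OF quenched[OF \<xi>]] mean_offspring_\<mu>[OF \<xi>] by simp
    qed
  qed
qed

lemma log_mean:
  assumes "supercritical \<tau> p G"
  shows "integrable \<tau> (\<lambda>x. ln (\<mu> x))" "0 < (\<integral>x. ln (\<mu> x) \<partial>\<tau>)"
proof -
  interpret r: resampling E \<tau> "\<lambda>(x, \<xi>). \<xi>(0 := x)" "\<lambda>\<xi>. \<xi> 0" by (rule resampling_env[OF prob_\<tau>])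
  have m: "(\<lambda>\<xi>. ln (mean_offspring p G 0 \<xi>)) \<in> borel_measurable E" by measurable
  have lm: "(\<lambda>x. ln (\<mu> x)) \<in> borel_measurable \<tau>" by measurable
  have "integrable E (\<lambda>\<xi>. ln (mean_offspring p G 0 \<xi>))" "0 < (\<integral>\<xi>. ln (mean_offspring p G 0 \<xi>) \<partial>E)"
    using assms annealed_fst[OF m] by (auto simp: supercritical_def)
  moreover have "integrable E (\<lambda>\<xi>. ln (mean_offspring p G 0 \<xi>)) \<longleftrightarrow> integrable E (\<lambda>\<xi>. ln (\<mu> (\<xi> 0)))"
    by (intro Bochner_Integration.integrable_cong refl) (simp add: mean_offspring_\<mu>)
  moreover have "(\<integral>\<xi>. ln (mean_offspring p G 0 \<xi>) \<partial>E) = (\<integral>\<xi>. ln (\<mu> (\<xi> 0)) \<partial>E)"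
    by (intro Bochner_Integration.integral_cong refl) (simp add: mean_offspring_\<mu>)
  ultimately show "integrable \<tau> (\<lambda>x. ln (\<mu> x))" "0 < (\<integral>x. ln (\<mu> x) \<partial>\<tau>)"
    using r.integral_coordinate[OF lm] by auto
qed

lemma ln_minus_moment_imp:
  assumes "ln_minus_moment \<tau> p G lam"
  shows "integrable \<tau> (\<lambda>x. ln_minus (\<mu> x) powr (1 + lam))"
proof -
  interpret r: resampling E \<tau> "\<lambda>(x, \<xi>). \<xi>(0 := x)" "\<lambda>\<xi>. \<xi> 0" by (rule resampling_env[OF prob_\<tau>])
  have m: "(\<lambda>\<xi>. ln_minus (mean_offspring p G 0 \<xi>) powr (1 + lam)) \<in> borel_measurable E"
    unfolding ln_minus_def by measurable
  have lm: "(\<lambda>x. ln_minus (\<mu> x) powr (1 + lam)) \<in> borel_measurable \<tau>"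
    unfolding ln_minus_def by measurable
  have "integrable E (\<lambda>\<xi>. ln_minus (mean_offspring p G 0 \<xi>) powr (1 + lam))"
    using assms annealed_fst(1)[OF m] by (simp add: ln_minus_moment_def)
  moreover have "integrable E (\<lambda>\<xi>. ln_minus (mean_offspring p G 0 \<xi>) powr (1 + lam))
     \<longleftrightarrow> integrable E (\<lambda>\<xi>. ln_minus (\<mu> (\<xi> 0)) powr (1 + lam))"
    by (intro Bochner_Integration.integrable_cong refl) (simp add: mean_offspring_\<mu>)
  ultimately show ?thesis using r.integral_coordinate(2)[OF lm] by auto
qed

lemma p_nn_integral_meas:
  fixes f :: "'e \<Rightarrow> nat \<Rightarrow> ennreal"
  assumes "\<And>k. (\<lambda>x. f x k) \<in> borel_measurable \<tau>"
  shows "(\<lambda>x. \<integral>\<^sup>+k. f x k \<partial>measure_pmf (p x)) \<in> borel_measurable \<tau>"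
proof -
  have "(\<lambda>(x, k). f x k) \<in> borel_measurable (\<tau> \<Otimes>\<^sub>M count_space UNIV)"
    using measurable_compose[OF measurable_pair_swap' measurable_pair_measure_countable1[of UNIV "\<lambda>z. f (snd z) (fst z)" \<tau> borel]] assms
    by (simp add: case_prod_beta')
  from nn_integral_measurable_subprob_algebra2[OF this p_kernel] show ?thesis .
qed

lemma offspring_moment_imp:
  assumes "offspring_moment \<tau> p G lam"
  shows "(\<integral>\<^sup>+x. \<integral>\<^sup>+k. ennreal (1 / \<mu> x * real k * ln_plus (real k) powr (1 + lam)) \<partial>measure_pmf (p x) \<partial>\<tau>) < \<infinity>"
proof -
  let ?f = "\<lambda>\<omega>. 1 / mean_offspring p G 0 (fst \<omega>) * real (offspring (snd \<omega>) []) * ln_plus (real (offspring (snd \<omega>) [])) powr (1 + lam)"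
  have i: "integrable AL ?f" using assms by (simp add: offspring_moment_def N_hat_def)
  have m: "(\<lambda>\<omega>. ennreal (?f \<omega>)) \<in> borel_measurable (E \<Otimes>\<^sub>M PS)"
    using borel_measurable_integrable[OF i] by measurable
  have "(\<integral>\<^sup>+x. \<integral>\<^sup>+k. ennreal (1 / \<mu> x * real k * ln_plus (real k) powr (1 + lam)) \<partial>measure_pmf (p x) \<partial>\<tau>)
    = (\<integral>\<^sup>+\<xi>. \<integral>\<^sup>+k. ennreal (1 / \<mu> (\<xi> 0) * real k * ln_plus (real k) powr (1 + lam)) \<partial>measure_pmf (p (\<xi> 0)) \<partial>E)"
    by (rule nn_integral_env_component[OF prob_\<tau>, symmetric]) (rule p_nn_integral_meas, measurable)
  also have "\<dots> = (\<integral>\<^sup>+\<xi>. \<integral>\<^sup>+w. ennreal (?f (\<xi>, w)) \<partial>quenched_law p G \<xi> \<partial>E)"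
  proof (rule nn_integral_cong)
    fix \<xi> assume \<xi>: "\<xi> \<in> space E"
    show "(\<integral>\<^sup>+k. ennreal (1 / \<mu> (\<xi> 0) * real k * ln_plus (real k) powr (1 + lam)) \<partial>measure_pmf (p (\<xi> 0)))
      = (\<integral>\<^sup>+w. ennreal (?f (\<xi>, w)) \<partial>quenched_law p G \<xi>)"
      using quenched.nn_integral_N_hat[OF quenched[OF \<xi>], where h="\<lambda>k. ennreal (1 / \<mu> (\<xi> 0) * real k * ln_plus (real k) powr (1 + lam))"]
      by (simp add: mean_offspring_\<mu>[OF \<xi>])
  qed
  also have "\<dots> = (\<integral>\<^sup>+\<omega>. ennreal (?f \<omega>) \<partial>AL)" by (rule nn_integral_annealed[OF m, symmetric])
  also have "\<dots> < \<infinity>"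
  proof -
    have "(\<integral>\<^sup>+\<omega>. ennreal (?f \<omega>) \<partial>AL) \<le> (\<integral>\<^sup>+\<omega>. ennreal (norm (?f \<omega>)) \<partial>AL)"
      by (intro nn_integral_mono ennreal_leI) (simp only: real_norm_def abs_ge_self)
    also have "\<dots> < \<infinity>" using i unfolding integrable_iff_bounded by blast
    finally show ?thesis .
  qed
  finally show ?thesis .
qed

end

section \<open>The martingale property\<close>

context brw
begin

definition NN :: "nat \<Rightarrow> nat \<Rightarrow> (nat \<Rightarrow> 'e) \<times> process \<Rightarrow> real" where
  "NN \<nu> n \<omega> = 1 / Pi_norm p G n (fst \<omega>) *
     (\<Sum>u\<in>generation (snd \<omega>) n. hpol p G \<nu> n (fst \<omega>) (position (snd \<omega>) u - ell p G n (fst \<omega>)))"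

lemma N_eq_NN: "N1 p G n = NN 1 n" "N2 p G n = NN 2 n" "N3 p G n = NN 3 n"
  unfolding NN_def[abs_def] by (auto simp: fun_eq_iff N1_eq_hpol N2_eq_hpol N3_eq_hpol)

abbreviation "\<F> \<equiv> filtr \<tau> p G"

definition gens :: "nat \<Rightarrow> ((nat \<Rightarrow> 'e) \<times> process) set set" where
  "gens n = (if n = 0 then {} else
         {env -` A \<inter> space AL | A. A \<in> sets E}
       \<union> {(\<lambda>\<omega>. offspring (snd \<omega>) u) -` A \<inter> space AL | u A. u \<in> seqs \<and> length u < n}
       \<union> {(\<lambda>\<omega>. displ (snd \<omega>) (u @ [i])) -` A \<inter> space AL | u i A.
            u \<in> seqs \<and> length u < n \<and> 1 \<le> i \<and> A \<in> sets borel})"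

lemma filtr_gens: "\<F> n = sigma (space AL) (gens n)"
  by (simp add: filtr_def gens_def Let_def)

lemma gens_Pow: "gens n \<subseteq> Pow (space AL)"
  by (auto simp: gens_def)

lemma space_filtr [simp]: "space (\<F> n) = space AL"
  by (simp add: filtr_gens gens_Pow)

lemma sets_filtr: "sets (\<F> n) = sigma_sets (space AL) (gens n)"
  by (simp add: filtr_gens gens_Pow)

lemma snd_annealed: "snd \<in> AL \<rightarrow>\<^sub>M PS"
  unfolding measurable_cong_sets[OF sets_annealed refl] by (rule measurable_snd)

lemma fst_annealed: "fst \<in> AL \<rightarrow>\<^sub>M E"
  unfolding measurable_cong_sets[OF sets_annealed refl] by (rule measurable_fst)

lemma offspring_annealed:
  assumes u: "u \<in> seqs"
  shows "(\<lambda>\<omega>. offspring (snd \<omega>) u) \<in> AL \<rightarrow>\<^sub>M count_space UNIV"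
  by (rule measurable_compose[OF snd_annealed measurable_compose[OF measurable_fst measurable_component_singleton[OF u]]])

lemma displ_annealed:
  assumes v: "v \<in> seqs" "v \<noteq> []"
  shows "(\<lambda>\<omega>. displ (snd \<omega>) v) \<in> borel_measurable AL"
proof -
  have "v \<in> seqs - {[]}" using v by simp
  from measurable_compose[OF snd_annealed measurable_compose[OF measurable_snd measurable_component_singleton[OF this]]]
  show ?thesis .
qed

lemma gens_sets: "gens n \<subseteq> sets AL"
  using measurable_sets[OF fst_annealed] measurable_sets[OF offspring_annealed] measurable_sets[OF displ_annealed]
  by (auto simp: gens_def)

lemma subalgebra_filtr: "subalgebra AL (\<F> n)"
  unfolding subalgebra_def sets_filtr using sets.sigma_sets_subset[OF gens_sets] by simp

lemma filtr_mono: "sets (\<F> n) \<subseteq> sets (\<F> (Suc n))"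
proof -
  have "gens n \<subseteq> gens (Suc n)"
  proof (cases "n = 0")
    case False
    then show ?thesis unfolding gens_def by (simp, intro conjI Un_mono) (blast intro: less_SucI)+
  qed (simp add: gens_def)
  then show ?thesis unfolding sets_filtr by (rule sigma_sets_mono')
qed

text \<open>An event of \<open>\<F> n\<close> is decided by the environment and by coordinates up to
  generation \<open>n\<close>: this holds for the generators and survives complements and countable
  unions. In this form measurability enters \<open>quenched_martingale\<close>.\<close>

lemma filtr_agree:
  assumes "A \<in> sets (\<F> n)" "\<omega> \<in> space AL" "\<omega>' \<in> space AL" "fst \<omega> = fst \<omega>'"
    and off: "\<And>u. u \<in> seqs \<Longrightarrow> length u < n \<Longrightarrow> offspring (snd \<omega>) u = offspring (snd \<omega>') u"
    and dis: "\<And>v. v \<in> seqs \<Longrightarrow> v \<noteq> [] \<Longrightarrow> length v \<le> n \<Longrightarrow> displ (snd \<omega>) v = displ (snd \<omega>') v"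
  shows "\<omega> \<in> A \<longleftrightarrow> \<omega>' \<in> A"
  using assms(1) unfolding sets_filtr
proof (induction A rule: sigma_sets.induct)
  case (Basic A)
  have d: "displ (snd \<omega>) (u @ [i]) = displ (snd \<omega>') (u @ [i])" if "u \<in> seqs" "length u < n" "1 \<le> i" for u i
    using that by (intro dis) auto
  from Basic consider A' where "A = env -` A' \<inter> space AL"
    | u A' where "A = (\<lambda>\<omega>. offspring (snd \<omega>) u) -` A' \<inter> space AL" "u \<in> seqs" "length u < n"
    | u i A' where "A = (\<lambda>\<omega>. displ (snd \<omega>) (u @ [i])) -` A' \<inter> space AL" "u \<in> seqs" "length u < n" "1 \<le> i"
    unfolding gens_def by (auto split: if_splits)
  then show ?case
  proof cases
    case 1 then show ?thesis using assms(2,3,4) by simp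
  next
    case 2 then show ?thesis using assms(2,3) off by simp
  next
    case 3 then show ?thesis using assms(2,3) d by simp
  qed
qed (use assms(2,3) in auto)

context
  fixes n :: nat
  assumes n: "0 < n"
begin

lemma fst_filtr: "fst \<in> \<F> n \<rightarrow>\<^sub>M E"
proof (rule measurableI)
  fix A assume "A \<in> sets E"
  then have "env -` A \<inter> space AL \<in> gens n" using n by (auto simp: gens_def)
  then show "env -` A \<inter> space (\<F> n) \<in> sets (\<F> n)" by (simp add: sets_filtr sigma_sets.Basic)
qed (auto simp: space_annealed)

lemma offspring_filtr:
  assumes "u \<in> seqs" "length u < n"
  shows "(\<lambda>\<omega>. offspring (snd \<omega>) u) \<in> \<F> n \<rightarrow>\<^sub>M count_space UNIV"
proof (rule measurableI)
  fix A :: "nat set"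
  have "(\<lambda>\<omega>. offspring (snd \<omega>) u) -` A \<inter> space AL \<in> gens n" using n assms unfolding gens_def by auto
  then show "(\<lambda>\<omega>. offspring (snd \<omega>) u) -` A \<inter> space (\<F> n) \<in> sets (\<F> n)"
    by (simp add: sets_filtr sigma_sets.Basic)
qed auto

lemma displ_filtr:
  assumes "u \<in> seqs" "length u < n" "1 \<le> i"
  shows "(\<lambda>\<omega>. displ (snd \<omega>) (u @ [i])) \<in> borel_measurable (\<F> n)"
proof (rule measurableI)
  fix A :: "real set" assume "A \<in> sets borel"
  then have "(\<lambda>\<omega>. displ (snd \<omega>) (u @ [i])) -` A \<inter> space AL \<in> gens n" using n assms unfolding gens_def by auto
  then show "(\<lambda>\<omega>. displ (snd \<omega>) (u @ [i])) -` A \<inter> space (\<F> n) \<in> sets (\<F> n)"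
    by (simp add: sets_filtr sigma_sets.Basic)
qed auto

lemma tree_filtr:
  "u \<in> seqs \<Longrightarrow> length u \<le> n \<Longrightarrow> Measurable.pred (\<F> n) (\<lambda>\<omega>. u \<in> tree (snd \<omega>))"
proof (induction u rule: rev_induct)
  case Nil
  then show ?case by (simp add: tree.root)
next
  case (snoc i u)
  then have u: "u \<in> seqs" "length u < n" by auto
  have [measurable]: "Measurable.pred (\<F> n) (\<lambda>\<omega>. u \<in> tree (snd \<omega>))" using snoc by simp
  have "Measurable.pred (\<F> n) (\<lambda>\<omega>. i \<le> offspring (snd \<omega>) u)"
    by (rule measurable_compose[OF offspring_filtr[OF u]]) simp
  then show ?case unfolding tree_snoc_iff by measurable
qed

lemma position_filtr:
  assumes u: "u \<in> seqs" "length u \<le> n"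
  shows "(\<lambda>\<omega>. position (snd \<omega>) u) \<in> borel_measurable (\<F> n)"
  unfolding position_def
proof (rule borel_measurable_sum)
  fix k assume k: "k \<in> {..<length u}"
  have "u ! k \<in> set u" using k by simp
  with u have "1 \<le> u ! k" by (auto simp: seqs_def)
  with k u show "(\<lambda>\<omega>. displ (snd \<omega>) (take (Suc k) u)) \<in> borel_measurable (\<F> n)"
    by (subst take_Suc_conv_app_nth) (auto intro!: displ_filtr seqs_take)
qed

lemma NN_filtr_pos: "NN \<nu> n \<in> borel_measurable (\<F> n)"
proof (rule borel_measurable_LIMSEQ_real)
  let ?f = "\<lambda>K \<omega>. 1 / Pi_norm p G n (fst \<omega>) *
     (\<Sum>u\<in>trunc_seqs K n. of_bool (u \<in> tree (snd \<omega>)) * hpol p G \<nu> n (fst \<omega>) (position (snd \<omega>) u - ell p G n (fst \<omega>)))"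
  show "(\<lambda>K. ?f K \<omega>) \<longlonglongrightarrow> NN \<nu> n \<omega>" for \<omega>
  proof (rule tendsto_eventually)
    show "\<forall>\<^sub>F K in sequentially. ?f K \<omega> = NN \<nu> n \<omega>"
      using sum_generation_trunc[of "snd \<omega>" "\<lambda>u. hpol p G \<nu> n (fst \<omega>) (position (snd \<omega>) u - ell p G n (fst \<omega>))" n]
      unfolding eventually_sequentially NN_def by fastforce
  qed
  have E: "(\<lambda>\<omega>. f (fst \<omega>)) \<in> borel_measurable (\<F> n)" if "f \<in> borel_measurable E" for f :: "_ \<Rightarrow> real"
    by (rule measurable_compose[OF fst_filtr that])
  show "?f K \<in> borel_measurable (\<F> n)" for K
  proof (intro borel_measurable_times borel_measurable_divide borel_measurable_sum borel_measurable_const E Pi_norm_meas)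
    fix u assume "u \<in> trunc_seqs K n"
    then have u: "u \<in> seqs" "length u \<le> n" using trunc_seqsD by auto
    show "(\<lambda>\<omega>. of_bool (u \<in> tree (snd \<omega>)) :: real) \<in> borel_measurable (\<F> n)"
      using tree_filtr[OF u] by measurable
    have [measurable]: "(\<lambda>\<omega>. position (snd \<omega>) u - ell p G n (fst \<omega>)) \<in> borel_measurable (\<F> n)"
      by (intro borel_measurable_diff position_filtr u E ell_meas)
    have [measurable]: "(\<lambda>\<omega>. s_mom p G r n (fst \<omega>)) \<in> borel_measurable (\<F> n)" for r
      by (intro E s_mom_meas)
    show "(\<lambda>\<omega>. hpol p G \<nu> n (fst \<omega>) (position (snd \<omega>) u - ell p G n (fst \<omega>))) \<in> borel_measurable (\<F> n)"
      unfolding hpol_def by measurable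
  qed
qed

end

text \<open>At time 0 the filtration is trivial and does not even contain the environment, so
  adaptedness rests on the vanishing of the polynomial at the root.\<close>

lemma NN_0: "NN \<nu> 0 \<omega> = 0"
proof -
  have "generation w 0 = {[]}" for w by (auto simp: generation_def tree.root)
  then show ?thesis by (simp add: NN_def hpol_def position_def ell_def s_mom_def)
qed

lemma NN_filtr: "NN \<nu> n \<in> borel_measurable (\<F> n)"
  using NN_filtr_pos[of n \<nu>] NN_0[of \<nu>] by (cases "n = 0") (auto simp: NN_0[abs_def])

lemma NN_meas: "NN \<nu> n \<in> borel_measurable AL"
  by (rule measurable_from_subalg[OF subalgebra_filtr NN_filtr])

lemma NN_meas': "NN \<nu> n \<in> borel_measurable (E \<Otimes>\<^sub>M PS)"
  using NN_meas unfolding measurable_cong_sets[OF sets_annealed refl] .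

text \<open>\<open>R\<close> is left open: integrability uses the bound of order \<nu>, the rate
  uses the square root of a second-moment bound.\<close>

lemma quenched_polyI:
  assumes sup: "\<And>n. integrable (measure_pmf (p (\<xi> n))) real \<and> 0 < \<mu> (\<xi> n)" and \<xi>: "\<xi> \<in> space E"
    and \<nu>: "\<nu> \<in> {1, 2, 3}" and i: "\<And>n. integrable (G (\<xi> n)) (\<lambda>y. \<bar>y\<bar> ^ \<nu>)"
    and R: "\<And>v. v \<in> seqs \<Longrightarrow> (\<integral>w. \<bar>hpol p G \<nu> (length v) \<xi> (position w v - ell p G (length v) \<xi>)\<bar> \<partial>quenched_law p G \<xi>) \<le> R (length v)"
  shows "quenched_poly p G \<xi> (\<lambda>n. hpol p G \<nu> n \<xi>) R"
proof -
  interpret quenched p G \<xi> by (rule quenched[OF \<xi>])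
  show ?thesis
  proof
    show "integrable (measure_pmf (p (\<xi> n))) real" "0 < mean_offspring p G n \<xi>" for n
      using sup[of n] mean_offspring_\<mu>[OF \<xi>] by auto
    show "hpol p G \<nu> n \<xi> \<in> borel_measurable borel" for n by (rule hpol_measurable)
    show "(\<integral>x. hpol p G \<nu> (Suc n) \<xi> (s + (x - mean_displ p G n \<xi>)) \<partial>G (\<xi> n)) = hpol p G \<nu> n \<xi> s" for n s
      by (rule hpol_mart[OF \<nu> i])
    show "integrable M (\<lambda>w. hpol p G \<nu> (length v) \<xi> (position w v - ell p G (length v) \<xi>))" if "v \<in> seqs" for v
      by (rule hpol_moment1(1)[OF \<nu> i that])
  qed (rule R)
qed

lemma Y_eq_NN:
  assumes "quenched_poly p G \<xi> (\<lambda>n. hpol p G \<nu> n \<xi>) R"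
  shows "quenched_poly.Y p G \<xi> (\<lambda>n. hpol p G \<nu> n \<xi>) n w = NN \<nu> n (\<xi>, w)"
proof -
  interpret quenched_poly p G \<xi> "\<lambda>n. hpol p G \<nu> n \<xi>" R by fact
  have "(\<Sum>u\<in>generation w n. hpol p G \<nu> (length u) \<xi> (cpos u w))
     = (\<Sum>u\<in>generation w n. hpol p G \<nu> n \<xi> (position w u - ell p G n \<xi>))"
    by (intro sum.cong refl) (auto simp: generation_def)
  then show ?thesis unfolding Y_def NN_def H_def by simp
qed

lemma AE_good:
  assumes "supercritical \<tau> p G" "displ_moment \<tau> p G \<eta>" "real Q \<le> \<eta>"
  shows "AE \<xi> in E. \<forall>n. (integrable (measure_pmf (p (\<xi> n))) real \<and> 0 < \<mu> (\<xi> n)) \<and> integrable (G (\<xi> n)) (\<lambda>y. \<bar>y\<bar> ^ Q)"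
  by (rule AE_env_component[OF prob_\<tau>]) (intro AE_conjI supercritical_AE displ_moment_AE[OF assms(2,3)] assms(1))

text \<open>The quenched bound is linear in the moments of order \<nu> at single states, so
  averaging it over the environment leads to the annealed moment of the same order.\<close>

lemma NN_integrable:
  assumes sup: "supercritical \<tau> p G" and \<nu>: "\<nu> \<in> {1, 2, 3}" and d: "displ_moment \<tau> p G (real \<nu>)"
  shows "integrable AL (NN \<nu> n)"
proof (rule integrableI_bounded[OF NN_meas])
  define c where "c = 8 * real n ^ (\<nu> - 1)"
  have m: "(\<lambda>\<omega>. ennreal (norm (NN \<nu> n \<omega>))) \<in> borel_measurable (E \<Otimes>\<^sub>M PS)"
    using NN_meas' by measurable
  have "(\<integral>\<^sup>+\<omega>. ennreal (norm (NN \<nu> n \<omega>)) \<partial>AL) = (\<integral>\<^sup>+\<xi>. \<integral>\<^sup>+w. ennreal (norm (NN \<nu> n (\<xi>, w))) \<partial>quenched_law p G \<xi> \<partial>E)"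
    by (rule nn_integral_annealed[OF m])
  also have "\<dots> \<le> (\<integral>\<^sup>+\<xi>. (\<Sum>k<n. ennreal (c * cabs_moment G \<nu> (\<xi> k))) \<partial>E)"
  proof (rule nn_integral_mono_AE, rule AE_mp[OF AE_good[OF sup d order_refl]], intro AE_I2 impI)
    fix \<xi> assume \<xi>: "\<xi> \<in> space E" and
      g: "\<forall>n. (integrable (measure_pmf (p (\<xi> n))) real \<and> 0 < \<mu> (\<xi> n)) \<and> integrable (G (\<xi> n)) (\<lambda>y. \<bar>y\<bar> ^ \<nu>)"
    interpret quenched p G \<xi> by (rule quenched[OF \<xi>])
    let ?R = "\<lambda>n. 8 * real n ^ (\<nu> - 1) * S \<nu> n"
    have qp: "quenched_poly p G \<xi> (\<lambda>n. hpol p G \<nu> n \<xi>) ?R"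
      by (rule quenched_polyI[OF _ \<xi> \<nu>]) (use g hpol_moment1(2)[OF \<nu>] in auto)
    interpret quenched_poly p G \<xi> "\<lambda>n. hpol p G \<nu> n \<xi>" ?R by (rule qp)
    have Y: "Y n = (\<lambda>w. NN \<nu> n (\<xi>, w))" for n using Y_eq_NN[OF qp] by (simp add: fun_eq_iff)
    have "(\<integral>\<^sup>+w. ennreal (norm (NN \<nu> n (\<xi>, w))) \<partial>M) = ennreal (\<integral>w. \<bar>NN \<nu> n (\<xi>, w)\<bar> \<partial>M)"
      using Y_integrable[of n] unfolding Y real_norm_def by (intro nn_integral_eq_integral integrable_abs) auto
    also have "\<dots> \<le> ennreal (?R n)"
      using Y_bound[of n] unfolding Y by (rule ennreal_leI)
    also have "\<dots> = (\<Sum>k<n. ennreal (c * cabs_moment G \<nu> (\<xi> k)))"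
      unfolding c_def by (subst sum_ennreal) (auto simp: cabs_moment_nonneg sum_distrib_left)
    finally show "(\<integral>\<^sup>+w. ennreal (norm (NN \<nu> n (\<xi>, w))) \<partial>M) \<le> (\<Sum>k<n. ennreal (c * cabs_moment G \<nu> (\<xi> k)))" .
  qed
  also have "\<dots> = (\<Sum>k<n. \<integral>\<^sup>+\<xi>. ennreal (c * cabs_moment G \<nu> (\<xi> k)) \<partial>E)"
    by (rule nn_integral_sum) (intro measurable_compose[OF _ measurable_ennreal] borel_measurable_times borel_measurable_const Emeas cabs_moment_meas)
  also have "\<dots> = (\<Sum>k<n. \<integral>\<^sup>+x. ennreal (c * cabs_moment G \<nu> x) \<partial>\<tau>)"
    by (intro sum.cong refl nn_integral_env_component[OF prob_\<tau>]) measurable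
  also have "\<dots> < \<infinity>"
  proof -
    have c0: "0 \<le> c" by (simp add: c_def)
    have "(\<integral>\<^sup>+x. ennreal (c * cabs_moment G \<nu> x) \<partial>\<tau>) = ennreal c * (\<integral>\<^sup>+x. ennreal (cabs_moment G \<nu> x) \<partial>\<tau>)"
      using c0 by (subst nn_integral_cmult[symmetric]) (auto simp: ennreal_mult cabs_moment_nonneg)
    also have "\<dots> < \<infinity>"
      using cabs_moment_finite[OF d order_refl] \<nu> by (auto simp: ennreal_mult_less_top)
    finally show ?thesis by (simp add: ennreal_mult_less_top of_nat_less_top)
  qed
  finally show "(\<integral>\<^sup>+\<omega>. ennreal (norm (NN \<nu> n \<omega>)) \<partial>AL) < \<infinity>" .
qed

text \<open>An event of the filtration is sliced at a fixed environment; the slice depends on the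
  first generations only, so the quenched identity applies to its indicator. The identity that
  characterizes the conditional expectation is written as a difference, to fit
  \<open>annealed_integral_zero\<close>.\<close>

theorem NN_martingale:
  assumes sup: "supercritical \<tau> p G" and \<nu>: "\<nu> \<in> {1, 2, 3}" and d: "displ_moment \<tau> p G (real \<nu>)"
  shows "martingale AL \<F> (NN \<nu>)"
  unfolding martingale_def
proof (intro conjI allI)
  fix n
  show "subalgebra AL (\<F> n)" by (rule subalgebra_filtr)
  show "sets (\<F> n) \<subseteq> sets (\<F> (Suc n))" by (rule filtr_mono)
  show "NN \<nu> n \<in> borel_measurable (\<F> n)" by (rule NN_filtr)
  show "integrable AL (NN \<nu> n)" by (rule NN_integrable[OF assms])
  interpret sub: finite_measure_subalgebra AL "\<F> n"
    by unfold_locales (rule subalgebra_filtr)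
  show "AE \<omega> in AL. real_cond_exp AL (\<F> n) (NN \<nu> (Suc n)) \<omega> = NN \<nu> n \<omega>"
  proof (rule sub.real_cond_exp_charact)
    fix A assume A: "A \<in> sets (\<F> n)"
    have A': "A \<in> sets AL" using subalgebra_filtr[of n] A by (auto simp: subalgebra_def)
    have i: "integrable AL (\<lambda>\<omega>. indicator A \<omega> * NN \<nu> k \<omega>)" for k
      using integrable_mult_indicator[OF A' NN_integrable[OF assms, of k]] by simp
    have "(\<integral>\<omega>. indicator A \<omega> * NN \<nu> (Suc n) \<omega> - indicator A \<omega> * NN \<nu> n \<omega> \<partial>AL) = 0"
    proof (rule annealed_integral_zero)
      show "integrable AL (\<lambda>\<omega>. indicator A \<omega> * NN \<nu> (Suc n) \<omega> - indicator A \<omega> * NN \<nu> n \<omega>)"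
        by (intro Bochner_Integration.integrable_diff i)
      show "AE \<xi> in E. integrable (quenched_law p G \<xi>) (\<lambda>w. indicator A (\<xi>, w) * NN \<nu> (Suc n) (\<xi>, w) - indicator A (\<xi>, w) * NN \<nu> n (\<xi>, w))
        \<and> (\<integral>w. indicator A (\<xi>, w) * NN \<nu> (Suc n) (\<xi>, w) - indicator A (\<xi>, w) * NN \<nu> n (\<xi>, w) \<partial>quenched_law p G \<xi>) = 0"
      proof (rule AE_mp[OF AE_good[OF sup d order_refl]], intro AE_I2 impI)
        fix \<xi> assume \<xi>: "\<xi> \<in> space E" and
          g: "\<forall>n. (integrable (measure_pmf (p (\<xi> n))) real \<and> 0 < \<mu> (\<xi> n)) \<and> integrable (G (\<xi> n)) (\<lambda>y. \<bar>y\<bar> ^ \<nu>)"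
        interpret quenched p G \<xi> by (rule quenched[OF \<xi>])
        let ?R = "\<lambda>n. 8 * real n ^ (\<nu> - 1) * S \<nu> n"
        have qp: "quenched_poly p G \<xi> (\<lambda>n. hpol p G \<nu> n \<xi>) ?R"
          by (rule quenched_polyI[OF _ \<xi> \<nu>]) (use g hpol_moment1(2)[OF \<nu>] in auto)
        interpret quenched_poly p G \<xi> "\<lambda>n. hpol p G \<nu> n \<xi>" ?R by (rule qp)
        have Y: "Y n = (\<lambda>w. NN \<nu> n (\<xi>, w))" for n using Y_eq_NN[OF qp] by (simp add: fun_eq_iff)
        let ?g = "\<lambda>w. indicator A (\<xi>, w) :: real"
        have Am: "(indicator A :: _ \<Rightarrow> real) \<in> borel_measurable (E \<Otimes>\<^sub>M PS)"
          using A' by (simp add: sets_annealed)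
        have gm: "?g \<in> borel_measurable M" by (rule section_meas[OF Am \<xi>])
        have gY: "integrable M (\<lambda>w. ?g w * Y k w)" for k
        proof (rule Bochner_Integration.integrable_bound[OF Y_integrable[of k]])
          show "(\<lambda>w. ?g w * Y k w) \<in> borel_measurable M" using gm Y_meas by (intro borel_measurable_times)
          show "AE w in M. norm (?g w * Y k w) \<le> norm (Y k w)"
            by (intro AE_I2) (auto simp: indicator_def)
        qed
        have "(\<integral>w. ?g w * Y (Suc n) w \<partial>M) = (\<integral>w. ?g w * Y n w \<partial>M)"
        proof (rule quenched_martingale[OF gm])
          show "\<bar>?g w\<bar> \<le> 1" for w by (simp add: indicator_def)
          fix w w' assume w: "w \<in> space M" "w' \<in> space M"
            and a: "\<And>u. u \<in> seqs \<Longrightarrow> length u < n \<Longrightarrow> offspring w u = offspring w' u"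
              "\<And>v. v \<in> seqs \<Longrightarrow> v \<noteq> [] \<Longrightarrow> length v \<le> n \<Longrightarrow> displ w v = displ w' v"
          have "(\<xi>, w) \<in> A \<longleftrightarrow> (\<xi>, w') \<in> A"
            by (rule filtr_agree[OF A]) (use w \<xi> a in \<open>simp_all add: space_annealed space_quenched[OF \<xi>]\<close>)
          then show "?g w = ?g w'" by (simp add: indicator_def)
        qed
        then show "integrable M (\<lambda>w. indicator A (\<xi>, w) * NN \<nu> (Suc n) (\<xi>, w) - indicator A (\<xi>, w) * NN \<nu> n (\<xi>, w))
          \<and> (\<integral>w. indicator A (\<xi>, w) * NN \<nu> (Suc n) (\<xi>, w) - indicator A (\<xi>, w) * NN \<nu> n (\<xi>, w) \<partial>M) = 0"
          using gY[of n] gY[of "Suc n"] unfolding Y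
          by (simp add: Bochner_Integration.integral_diff Bochner_Integration.integrable_diff)
      qed
    qed
    then have "(\<integral>\<omega>. indicator A \<omega> * NN \<nu> (Suc n) \<omega> \<partial>AL) = (\<integral>\<omega>. indicator A \<omega> * NN \<nu> n \<omega> \<partial>AL)"
      by (simp add: Bochner_Integration.integral_diff[OF i i])
    then show "(\<integral>\<omega>\<in>A. NN \<nu> (Suc n) \<omega> \<partial>AL) = (\<integral>\<omega>\<in>A. NN \<nu> n \<omega> \<partial>AL)"
      by (simp add: set_lebesgue_integral_def)
  qed (rule NN_integrable[OF assms] NN_filtr)+
qed

end

section \<open>Rates of convergence\<close>

context brw
begin

text \<open>The threshold is relative to the mean, so that its quotient by \<mu> stays below
  exp(\<gamma> n) however small \<mu> is. Rounding down does not change the retained families, as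
  offspring numbers are integers.\<close>

definition cutoff :: "real \<Rightarrow> nat \<Rightarrow> 'e \<Rightarrow> nat" where
  "cutoff \<gamma> n x = nat \<lfloor>exp (\<gamma> * real n) * \<mu> x\<rfloor>"

definition tail :: "real \<Rightarrow> nat \<Rightarrow> 'e \<Rightarrow> real" where
  "tail \<gamma> n x = measure_pmf.expectation (p x) (\<lambda>k. real k / \<mu> x * of_bool (k > cutoff \<gamma> n x))"

lemma cutoff_less_iff: "0 < \<mu> x \<Longrightarrow> cutoff \<gamma> n x < k \<longleftrightarrow> exp (\<gamma> * real n) * \<mu> x < real k"
  unfolding cutoff_def by (simp add: nat_less_iff floor_less_iff)

lemma tail_nn_integral:
  assumes "integrable (measure_pmf (p x)) real" "0 < \<mu> x"
  shows "ennreal (tail \<gamma> n x) = (\<integral>\<^sup>+k. ennreal (real k / \<mu> x * of_bool (exp (\<gamma> * real n) * \<mu> x < real k)) \<partial>measure_pmf (p x))"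
proof -
  have i: "integrable (measure_pmf (p x)) (\<lambda>k. real k / \<mu> x * of_bool (k > cutoff \<gamma> n x))"
  proof (rule Bochner_Integration.integrable_bound)
    show "integrable (measure_pmf (p x)) (\<lambda>k. real k / \<mu> x)" using assms(1) by simp
    show "AE k in measure_pmf (p x). norm (real k / \<mu> x * of_bool (k > cutoff \<gamma> n x)) \<le> norm (real k / \<mu> x)"
      by (intro AE_I2) simp
  qed simp
  have "ennreal (tail \<gamma> n x) = (\<integral>\<^sup>+k. ennreal (real k / \<mu> x * of_bool (k > cutoff \<gamma> n x)) \<partial>measure_pmf (p x))"
    unfolding tail_def using assms(2) by (intro nn_integral_eq_integral[symmetric] i) auto
  then show ?thesis unfolding cutoff_less_iff[OF assms(2)] .
qed

text \<open>The sum over n is carried out first. For a family of size k the condition exp(\<gamma>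
  n) \<mu> < k admits about ln(k / \<mu>) / \<gamma> values of n, so the weights add up to a power 1
  + lam of \<open>ln_plus\<close> at k plus \<open>ln_minus\<close> at \<mu> plus 1. In
  \<open>C\<close> the power of 3 splits these three summands, and its second factor bounds their
  coefficients.\<close>

lemma tail_sum_le:
  assumes x: "integrable (measure_pmf (p x)) real" "0 < \<mu> x" and \<gamma>: "0 < \<gamma>" and lam: "0 \<le> lam"
  defines "C \<equiv> 3 powr (1 + lam) * (1 + (1 / \<gamma>) powr (1 + lam))"
  shows "(\<Sum>n. ennreal (real (Suc n) powr lam) * (\<integral>\<^sup>+k. ennreal (real k / \<mu> x * of_bool (exp (\<gamma> * real n) * \<mu> x < real k)) \<partial>measure_pmf (p x)))
    \<le> ennreal C * ((\<integral>\<^sup>+k. ennreal (1 / \<mu> x * real k * ln_plus (real k) powr (1 + lam)) \<partial>measure_pmf (p x))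
        + (ennreal (ln_minus (\<mu> x) powr (1 + lam)) + 1))"
proof -
  let ?s = "1 + lam"
  have C0: "0 \<le> C" by (simp add: C_def)
  \<comment> \<open>Size biasing by k / \<mu> gives total mass 1, so the term in
    \<open>ln_minus\<close>, which is constant in k, passes through the integral unchanged.\<close>
  have mean1: "(\<integral>\<^sup>+k. ennreal (real k / \<mu> x) \<partial>measure_pmf (p x)) = 1"
  proof -
    have "(\<integral>\<^sup>+k. ennreal (real k / \<mu> x) \<partial>measure_pmf (p x)) = ennreal (measure_pmf.expectation (p x) (\<lambda>k. real k / \<mu> x))"
      using x by (intro nn_integral_eq_integral) auto
    also have "measure_pmf.expectation (p x) (\<lambda>k. real k / \<mu> x) = 1" using x by (simp add: \<mu>_def)
    finally show ?thesis by simp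
  qed
  have pt: "(\<Sum>n. ennreal (real (Suc n) powr lam) * ennreal (real k / \<mu> x * of_bool (exp (\<gamma> * real n) * \<mu> x < real k)))
    \<le> ennreal C * (ennreal (1 / \<mu> x * real k * ln_plus (real k) powr ?s) + (ennreal (ln_minus (\<mu> x) powr ?s) + 1) * ennreal (real k / \<mu> x))" for k
  proof (cases "k = 0")
    case True
    then show ?thesis by simp
  next
    case False
    define z where "z = max 0 (ln (real k / \<mu> x))"
    have ind: "of_bool (exp (\<gamma> * real n) * \<mu> x < real k) \<le> (of_bool (\<gamma> * real n < z) :: real)" for n
    proof -
      have "\<gamma> * real n < ln (real k / \<mu> x)" if "exp (\<gamma> * real n) * \<mu> x < real k"
      proof -
        have "exp (\<gamma> * real n) < real k / \<mu> x" using that x(2) by (simp add: field_simps)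
        then have "ln (exp (\<gamma> * real n)) < ln (real k / \<mu> x)" by (subst ln_less_cancel_iff) (use x(2) False in auto)
        then show ?thesis by simp
      qed
      then show ?thesis unfolding z_def by auto
    qed
    have "(\<Sum>n. ennreal (real (Suc n) powr lam) * ennreal (real k / \<mu> x * of_bool (exp (\<gamma> * real n) * \<mu> x < real k)))
      \<le> (\<Sum>n. ennreal (real k / \<mu> x) * ennreal (real (Suc n) powr lam * of_bool (\<gamma> * real n < z)))"
    proof (intro suminf_le summableI)
      fix n
      have "real (Suc n) powr lam * (real k / \<mu> x * of_bool (exp (\<gamma> * real n) * \<mu> x < real k))
         \<le> real k / \<mu> x * (real (Suc n) powr lam * of_bool (\<gamma> * real n < z))"
        using mult_left_mono[OF ind[of n], of "real (Suc n) powr lam * (real k / \<mu> x)"] x(2) by (simp add: mult_ac)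
      then show "ennreal (real (Suc n) powr lam) * ennreal (real k / \<mu> x * of_bool (exp (\<gamma> * real n) * \<mu> x < real k))
         \<le> ennreal (real k / \<mu> x) * ennreal (real (Suc n) powr lam * of_bool (\<gamma> * real n < z))"
        using x(2) by (subst (1 2) ennreal_mult[symmetric]) (auto intro!: ennreal_leI)
    qed
    also have "\<dots> = ennreal (real k / \<mu> x) * (\<Sum>n. ennreal (real (Suc n) powr lam * of_bool (\<gamma> * real n < z)))"
      by simp
    also have "\<dots> \<le> ennreal (real k / \<mu> x) * ennreal ((z / \<gamma> + 1) powr ?s)"
      by (intro mult_left_mono sum_power_indicator_le \<gamma> lam) (auto simp: z_def)
    also have "\<dots> \<le> ennreal (real k / \<mu> x) * ennreal (C * (ln_plus (real k) powr ?s + ln_minus (\<mu> x) powr ?s + 1))"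
    proof (intro mult_left_mono ennreal_leI)
      have nn: "0 \<le> ln_plus (real k)" "0 \<le> ln_minus (\<mu> x)" by (simp_all add: ln_plus_def ln_minus_def)
      have "ln (real k / \<mu> x) = ln (real k) - ln (\<mu> x)" using False x(2) by (simp add: ln_div)
      then have "z \<le> ln_plus (real k) + ln_minus (\<mu> x)" unfolding z_def ln_plus_def ln_minus_def by linarith
      then have "z / \<gamma> + 1 \<le> ln_plus (real k) / \<gamma> + ln_minus (\<mu> x) / \<gamma> + 1"
        using \<gamma> by (simp add: add_divide_distrib[symmetric] divide_right_mono)
      then have "(z / \<gamma> + 1) powr ?s \<le> (ln_plus (real k) / \<gamma> + ln_minus (\<mu> x) / \<gamma> + 1) powr ?s"
        using lam \<gamma> by (intro powr_mono2) (auto simp: z_def)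
      also have "\<dots> \<le> 3 powr ?s * ((ln_plus (real k) / \<gamma>) powr ?s + (ln_minus (\<mu> x) / \<gamma>) powr ?s + 1 powr ?s)"
        using lam \<gamma> nn by (intro powr_sum3_le) auto
      also have "\<dots> = 3 powr ?s * ((1 / \<gamma>) powr ?s * ln_plus (real k) powr ?s + (1 / \<gamma>) powr ?s * ln_minus (\<mu> x) powr ?s + 1)"
        using \<gamma> nn by (simp add: powr_divide)
      also have "\<dots> \<le> 3 powr ?s * ((1 + (1 / \<gamma>) powr ?s) * ln_plus (real k) powr ?s + (1 + (1 / \<gamma>) powr ?s) * ln_minus (\<mu> x) powr ?s + (1 + (1 / \<gamma>) powr ?s))"
        by (intro mult_left_mono add_mono mult_right_mono) auto
      also have "\<dots> = C * (ln_plus (real k) powr ?s + ln_minus (\<mu> x) powr ?s + 1)"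
        unfolding C_def by (simp add: algebra_simps)
      finally show "(z / \<gamma> + 1) powr ?s \<le> C * (ln_plus (real k) powr ?s + ln_minus (\<mu> x) powr ?s + 1)" .
    qed simp
    also have "\<dots> = ennreal (C * (1 / \<mu> x * real k * ln_plus (real k) powr ?s + (ln_minus (\<mu> x) powr ?s + 1) * (real k / \<mu> x)))"
      using x(2) C0 by (subst ennreal_mult[symmetric]) (auto intro!: arg_cong[where f=ennreal] simp: algebra_simps)
    also have "\<dots> = ennreal C * (ennreal (1 / \<mu> x * real k * ln_plus (real k) powr ?s) + (ennreal (ln_minus (\<mu> x) powr ?s) + 1) * ennreal (real k / \<mu> x))"
    proof -
      have e: "ennreal (C * (A + (B + 1) * D)) = ennreal C * (ennreal A + (ennreal B + 1) * ennreal D)"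
        if "0 \<le> A" "0 \<le> B" "0 \<le> D" for A B D
        using that C0 by (simp add: ennreal_mult)
      show ?thesis by (rule e) (use x(2) in simp_all)
    qed
    finally show ?thesis .
  qed
  have "(\<Sum>n. ennreal (real (Suc n) powr lam) * (\<integral>\<^sup>+k. ennreal (real k / \<mu> x * of_bool (exp (\<gamma> * real n) * \<mu> x < real k)) \<partial>measure_pmf (p x)))
    = (\<Sum>n. \<integral>\<^sup>+k. ennreal (real (Suc n) powr lam) * ennreal (real k / \<mu> x * of_bool (exp (\<gamma> * real n) * \<mu> x < real k)) \<partial>measure_pmf (p x))"
    by (intro suminf_cong nn_integral_cmult[symmetric]) simp
  also have "\<dots> = (\<integral>\<^sup>+k. (\<Sum>n. ennreal (real (Suc n) powr lam) * ennreal (real k / \<mu> x * of_bool (exp (\<gamma> * real n) * \<mu> x < real k))) \<partial>measure_pmf (p x))"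
    by (rule nn_integral_suminf[symmetric]) simp
  also have "\<dots> \<le> (\<integral>\<^sup>+k. ennreal C * (ennreal (1 / \<mu> x * real k * ln_plus (real k) powr ?s)
      + (ennreal (ln_minus (\<mu> x) powr ?s) + 1) * ennreal (real k / \<mu> x)) \<partial>measure_pmf (p x))"
    by (rule nn_integral_mono) (rule pt)
  also have "\<dots> = ennreal C * ((\<integral>\<^sup>+k. ennreal (1 / \<mu> x * real k * ln_plus (real k) powr ?s) \<partial>measure_pmf (p x))
      + (ennreal (ln_minus (\<mu> x) powr ?s) + 1) * (\<integral>\<^sup>+k. ennreal (real k / \<mu> x) \<partial>measure_pmf (p x)))"
    by (subst nn_integral_cmult, simp, subst nn_integral_add, simp, simp, subst nn_integral_cmult) simp_all
  finally show ?thesis unfolding mean1 by simp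
qed

text \<open>The expectation is computed for the extended integrals in \<open>h\<close>; the Bochner
  integral \<open>tail\<close> agrees with them where the mean is finite and positive, hence the
  implication.\<close>

lemma AE_tail_summable:
  assumes sup: "supercritical \<tau> p G" and off: "offspring_moment \<tau> p G lam" and lnm: "ln_minus_moment \<tau> p G lam"
    and \<gamma>: "0 < \<gamma>" and lam: "0 \<le> lam"
  shows "AE \<xi> in E. (\<forall>n. integrable (measure_pmf (p (\<xi> n))) real \<and> 0 < \<mu> (\<xi> n)) \<longrightarrow> summable (\<lambda>n. real (Suc n) powr lam * tail \<gamma> n (\<xi> n))"
proof -
  define h where "h n x = ennreal (real (Suc n) powr lam) * (\<integral>\<^sup>+k. ennreal (real k / \<mu> x * of_bool (exp (\<gamma> * real n) * \<mu> x < real k)) \<partial>measure_pmf (p x))" for n x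
  have hm: "h n \<in> borel_measurable \<tau>" for n
  proof -
    have [measurable]: "(\<lambda>x. \<integral>\<^sup>+k. ennreal (real k / \<mu> x * of_bool (exp (\<gamma> * real n) * \<mu> x < real k)) \<partial>measure_pmf (p x)) \<in> borel_measurable \<tau>"
      by (rule p_nn_integral_meas) measurable
    show ?thesis unfolding h_def by measurable
  qed
  define C where "C = 3 powr (1 + lam) * (1 + (1 / \<gamma>) powr (1 + lam))"
  have lm [measurable]: "(\<lambda>x. ln_minus (\<mu> x) powr (1 + lam)) \<in> borel_measurable \<tau>"
    unfolding ln_minus_def by measurable
  have om: "(\<lambda>x. \<integral>\<^sup>+k. ennreal (1 / \<mu> x * real k * ln_plus (real k) powr (1 + lam)) \<partial>measure_pmf (p x)) \<in> borel_measurable \<tau>"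
    by (rule p_nn_integral_meas) measurable
  have "(\<Sum>n. \<integral>\<^sup>+x. h n x \<partial>\<tau>) = (\<integral>\<^sup>+x. (\<Sum>n. h n x) \<partial>\<tau>)"
    by (rule nn_integral_suminf[symmetric]) (rule hm)
  also have "\<dots> \<le> (\<integral>\<^sup>+x. ennreal C * ((\<integral>\<^sup>+k. ennreal (1 / \<mu> x * real k * ln_plus (real k) powr (1 + lam)) \<partial>measure_pmf (p x))
        + (ennreal (ln_minus (\<mu> x) powr (1 + lam)) + 1)) \<partial>\<tau>)"
    unfolding h_def C_def
    by (rule nn_integral_mono_AE, rule AE_mp[OF supercritical_AE[OF sup]], intro AE_I2 impI)
       (rule tail_sum_le, use \<gamma> lam in auto)
  also have "\<dots> = ennreal C * ((\<integral>\<^sup>+x. \<integral>\<^sup>+k. ennreal (1 / \<mu> x * real k * ln_plus (real k) powr (1 + lam)) \<partial>measure_pmf (p x) \<partial>\<tau>)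
        + ((\<integral>\<^sup>+x. ennreal (ln_minus (\<mu> x) powr (1 + lam)) \<partial>\<tau>) + 1))"
    using om by (simp add: nn_integral_cmult nn_integral_add \<tau>.emeasure_space_1)
  also have "\<dots> < \<infinity>"
  proof -
    have "(\<integral>\<^sup>+x. ennreal (ln_minus (\<mu> x) powr (1 + lam)) \<partial>\<tau>) < \<infinity>"
      using ln_minus_moment_imp[OF lnm] unfolding integrable_iff_bounded by simp
    then show ?thesis using offspring_moment_imp[OF off] by (simp add: ennreal_mult_less_top)
  qed
  finally have "AE \<xi> in E. (\<Sum>n. h n (\<xi> n)) < \<infinity>"
    by (intro AE_env_suminf_finite[OF prob_\<tau> hm])
  then show ?thesis
  proof (rule AE_mp, intro AE_I2 impI)
    fix \<xi> assume fin: "(\<Sum>n. h n (\<xi> n)) < \<infinity>" and g: "\<forall>n. integrable (measure_pmf (p (\<xi> n))) real \<and> 0 < \<mu> (\<xi> n)"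
    have t0: "0 \<le> tail \<gamma> n (\<xi> n)" for n
      unfolding tail_def using g by (intro Bochner_Integration.integral_nonneg) (auto simp: less_imp_le)
    have "h n (\<xi> n) = ennreal (real (Suc n) powr lam * tail \<gamma> n (\<xi> n))" for n
      unfolding h_def using g t0 by (subst tail_nn_integral[symmetric]) (auto simp: ennreal_mult)
    with fin show "summable (\<lambda>n. real (Suc n) powr lam * tail \<gamma> n (\<xi> n))"
      using t0 by (intro summable_of_suminf_ennreal) auto
  qed
qed

text \<open>The series with weights n^(-1-\<epsilon>) has finite expectation and so converges almost
  surely; comparing each weight with a smaller one at n bounds the partial sums. The excess
  \<epsilon> over linear growth is later absorbed in \<delta>.\<close>

lemma AE_moment_sum_bound:
  assumes d: "displ_moment \<tau> p G \<eta>" "real Q \<le> \<eta>" "1 \<le> Q" and \<epsilon>: "0 < \<epsilon>"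
  shows "AE \<xi> in E. \<exists>C>0. \<forall>n. (\<Sum>k<n. cabs_moment G Q (\<xi> k)) \<le> C * real (Suc n) powr (1 + \<epsilon>)"
proof -
  let ?a = "\<lambda>n. real (Suc n) powr (- 1 - \<epsilon>)"
  define h where "h n x = ennreal (?a n * cabs_moment G Q x)" for n x
  have hm: "h n \<in> borel_measurable \<tau>" for n unfolding h_def by measurable
  define B where "B = (\<integral>\<^sup>+x. ennreal (cabs_moment G Q x) \<partial>\<tau>)"
  have B: "B < \<infinity>" unfolding B_def by (rule cabs_moment_finite[OF d])
  have sa: "summable ?a"
    using \<epsilon> summable_Suc_iff[of "\<lambda>n. real n powr (- 1 - \<epsilon>)"] by (simp add: summable_real_powr_iff)
  have "(\<integral>\<^sup>+x. h n x \<partial>\<tau>) = ennreal (?a n) * B" for n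
    unfolding h_def B_def by (subst nn_integral_cmult[symmetric]) (auto simp: ennreal_mult cabs_moment_nonneg)
  then have "(\<Sum>n. \<integral>\<^sup>+x. h n x \<partial>\<tau>) = (\<Sum>n. ennreal (?a n)) * B" by simp
  also have "\<dots> < \<infinity>"
    using sa B by (subst suminf_ennreal2) (auto simp: ennreal_mult_less_top)
  finally have "AE \<xi> in E. (\<Sum>n. h n (\<xi> n)) < \<infinity>"
    by (intro AE_env_suminf_finite[OF prob_\<tau> hm])
  then show ?thesis
  proof (rule AE_mp, intro AE_I2 impI)
    fix \<xi> assume fin: "(\<Sum>n. h n (\<xi> n)) < \<infinity>"
    let ?c = "\<lambda>k. cabs_moment G Q (\<xi> k)"
    have s: "summable (\<lambda>k. ?a k * ?c k)"
      using fin unfolding h_def by (intro summable_of_suminf_ennreal) (auto simp: cabs_moment_nonneg)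
    \<comment> \<open>Adding 1 makes \<open>C\<close> positive even when all displacements are
      deterministic.\<close>
    define C where "C = (\<Sum>k. ?a k * ?c k) + 1"
    have C0: "0 < C"
    proof -
      have "0 \<le> (\<Sum>k. ?a k * ?c k)"
        by (rule suminf_nonneg[OF s]) (simp add: cabs_moment_nonneg)
      then show ?thesis unfolding C_def by linarith
    qed
    have "(\<Sum>k<n. ?c k) \<le> C * real (Suc n) powr (1 + \<epsilon>)" for n
    proof -
      have "(\<Sum>k<n. ?c k) \<le> (\<Sum>k<n. real (Suc n) powr (1 + \<epsilon>) * (?a k * ?c k))"
      proof (rule sum_mono)
        fix k assume "k \<in> {..<n}"
        then have "real (Suc k) powr (1 + \<epsilon>) * ?a k \<le> real (Suc n) powr (1 + \<epsilon>) * ?a k"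
          using \<epsilon> by (intro mult_right_mono powr_mono2) auto
        moreover have "real (Suc k) powr (1 + \<epsilon>) * ?a k = 1" by (simp add: powr_add[symmetric])
        ultimately have "1 * ?c k \<le> real (Suc n) powr (1 + \<epsilon>) * ?a k * ?c k"
          by (intro mult_right_mono cabs_moment_nonneg) linarith
        then show "?c k \<le> real (Suc n) powr (1 + \<epsilon>) * (?a k * ?c k)" by (simp add: mult.assoc)
      qed
      also have "\<dots> = real (Suc n) powr (1 + \<epsilon>) * (\<Sum>k<n. ?a k * ?c k)" by (simp add: sum_distrib_left)
      also have "\<dots> \<le> real (Suc n) powr (1 + \<epsilon>) * C"
      proof (rule mult_left_mono)
        have "(\<Sum>k<n. ?a k * ?c k) \<le> (\<Sum>k. ?a k * ?c k)"
          by (rule sum_le_suminf[OF s]) (auto simp: cabs_moment_nonneg)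
        then show "(\<Sum>k<n. ?a k * ?c k) \<le> C" unfolding C_def by linarith
      qed simp
      finally show ?thesis by (simp add: mult.commute)
    qed
    with C0 show "\<exists>C>0. \<forall>n. (\<Sum>k<n. ?c k) \<le> C * real (Suc n) powr (1 + \<epsilon>)" by blast
  qed
qed

text \<open>The logarithm of the norming product is a sum of i.i.d. terms with positive mean. Since
  lam \<ge> 1, the moment of order 1 + lam of \<open>ln_minus\<close> controls the square that
  \<open>env_sum_lower_bound\<close> asks for.\<close>

lemma Pi_norm_lower_bound:
  assumes sup: "supercritical \<tau> p G" and lnm: "ln_minus_moment \<tau> p G lam" and lam: "1 \<le> lam"
  shows "\<exists>\<gamma>>0. AE \<xi> in E. (\<forall>n. 0 < \<mu> (\<xi> n)) \<longrightarrow> (\<exists>\<kappa>>0. \<forall>n. \<kappa> * exp (2 * \<gamma> * real n) \<le> Pi_norm p G n \<xi>)"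
proof -
  have "integrable \<tau> (\<lambda>x. (max (- ln (\<mu> x)) 0)\<^sup>2)"
  proof (rule Bochner_Integration.integrable_bound)
    show "integrable \<tau> (\<lambda>x. 1 + ln_minus (\<mu> x) powr (1 + lam))" using ln_minus_moment_imp[OF lnm] by simp
    show "AE x in \<tau>. norm ((max (- ln (\<mu> x)) 0)\<^sup>2) \<le> norm (1 + ln_minus (\<mu> x) powr (1 + lam))"
    proof (rule AE_I2)
      fix x
      have "\<bar>ln_minus (\<mu> x)\<bar> ^ 2 \<le> 1 + \<bar>ln_minus (\<mu> x)\<bar> powr (1 + lam)"
        using lam by (intro power_le_one_plus_powr) simp
      moreover have "0 \<le> ln_minus (\<mu> x)" by (simp add: ln_minus_def)
      ultimately show "norm ((max (- ln (\<mu> x)) 0)\<^sup>2) \<le> norm (1 + ln_minus (\<mu> x) powr (1 + lam))"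
        by (simp add: ln_minus_def)
    qed
  qed measurable
  from env_sum_lower_bound[OF prob_\<tau> log_mean[OF sup] this]
  obtain \<gamma> where \<gamma>: "0 < \<gamma>" "AE \<xi> in E. \<exists>C. \<forall>n. \<gamma> * real n - C \<le> (\<Sum>k<n. ln (\<mu> (\<xi> k)))" by auto
  \<comment> \<open>The rate is halved here: cutting families at half the exponent of
    \<open>Pi_norm\<close> leaves the other half as decay of the variance.\<close>
  have "AE \<xi> in E. (\<forall>n. 0 < \<mu> (\<xi> n)) \<longrightarrow> (\<exists>\<kappa>>0. \<forall>n. \<kappa> * exp (2 * (\<gamma> / 2) * real n) \<le> Pi_norm p G n \<xi>)"
    using \<gamma>(2)
  proof (rule AE_mp, intro AE_I2 impI)
    fix \<xi> assume \<xi>: "\<xi> \<in> space E" and "\<exists>C. \<forall>n. \<gamma> * real n - C \<le> (\<Sum>k<n. ln (\<mu> (\<xi> k)))" and pos: "\<forall>n. 0 < \<mu> (\<xi> n)"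
    then obtain C where C: "\<And>n. \<gamma> * real n - C \<le> (\<Sum>k<n. ln (\<mu> (\<xi> k)))" by auto
    have "exp (- C) * exp (2 * (\<gamma> / 2) * real n) \<le> Pi_norm p G n \<xi>" for n
    proof -
      have "exp (- C) * exp (2 * (\<gamma> / 2) * real n) = exp (\<gamma> * real n - C)" by (simp add: exp_add[symmetric])
      also have "\<dots> \<le> exp (\<Sum>k<n. ln (\<mu> (\<xi> k)))" using C[of n] by simp
      also have "\<dots> = Pi_norm p G n \<xi>"
        using pos by (simp add: exp_sum Pi_norm_def mean_offspring_\<mu>[OF \<xi>])
      finally show ?thesis .
    qed
    then show "\<exists>\<kappa>>0. \<forall>n. \<kappa> * exp (2 * (\<gamma> / 2) * real n) \<le> Pi_norm p G n \<xi>"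
      by (intro exI[of _ "exp (- C)"]) simp
  qed
  then show ?thesis using \<gamma>(1) by (intro exI[of _ "\<gamma> / 2"]) simp
qed

lemma quenched_increments_summable:
  fixes \<epsilon> :: real
  assumes \<xi>: "\<xi> \<in> space E" and good: "\<And>n. integrable (measure_pmf (p (\<xi> n))) real \<and> 0 < \<mu> (\<xi> n)"
    and \<nu>: "\<nu> \<in> {1, 2, 3}" and i: "\<And>n. integrable (G (\<xi> n)) (\<lambda>y. \<bar>y\<bar> ^ (2 * \<nu>))"
    and q: "summable (\<lambda>n. real (Suc n) powr lam * tail \<gamma> n (\<xi> n))"
    and S: "\<And>n. (\<Sum>k<n. cabs_moment G (2 * \<nu>) (\<xi> k)) \<le> C * real (Suc n) powr (1 + \<epsilon>)" "0 < C"
    and P: "\<And>n. \<kappa> * exp (2 * \<gamma> * real n) \<le> Pi_norm p G n \<xi>" "0 < \<kappa>" "0 < \<gamma>" and \<epsilon>: "0 < \<epsilon>"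
  defines "d \<equiv> \<lambda>n. \<integral>w. \<bar>NN \<nu> (Suc n) (\<xi>, w) - NN \<nu> n (\<xi>, w)\<bar> \<partial>quenched_law p G \<xi>"
  shows "summable (\<lambda>n. real (Suc n) powr (lam - real \<nu> - \<epsilon>) * d n)"
    and "\<And>n. integrable (quenched_law p G \<xi>) (\<lambda>w. NN \<nu> n (\<xi>, w))"
proof -
  interpret quenched p G \<xi> by (rule quenched[OF \<xi>])
  \<comment> \<open>\<open>R\<close> will be the root of \<open>R2\<close>, by Jensen, so that a
    single moment sum, of order 2\<nu>, has to be controlled along the environment.\<close>
  define R2 where "R2 n = 117 * real n ^ (2 * \<nu> - 1) * (\<Sum>k<n. cabs_moment G (2 * \<nu>) (\<xi> k))" for n
  define R where "R n = sqrt (R2 n)" for n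
  have i': "integrable (G (\<xi> n)) (\<lambda>y. \<bar>y\<bar> ^ \<nu>)" for n
    by (rule prob_space.integrable_abs_power_le[OF prob_G _ i]) (rule G_meas[OF E_space[OF \<xi>]], simp, simp)
  note h2 = hpol_moment2[OF \<nu> i, folded R2_def]
  have qp: "quenched_poly p G \<xi> (\<lambda>n. hpol p G \<nu> n \<xi>) R"
  proof (rule quenched_polyI[OF good \<xi> \<nu> i'])
    fix v assume v: "v \<in> seqs"
    have "(\<integral>w. \<bar>hpol p G \<nu> (length v) \<xi> (cpos v w)\<bar> \<partial>M) \<le> sqrt (\<integral>w. (hpol p G \<nu> (length v) \<xi> (cpos v w))\<^sup>2 \<partial>M)"
      by (rule M.integral_abs_le_sqrt(2)[OF borel_measurable_integrable[OF hpol_moment1(1)[OF \<nu> i' v]] h2(1)[OF v]])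
    also have "\<dots> \<le> R (length v)" unfolding R_def using h2(2)[OF v] by simp
    finally show "(\<integral>w. \<bar>hpol p G \<nu> (length v) \<xi> (cpos v w)\<bar> \<partial>M) \<le> R (length v)" .
  qed
  interpret quenched_poly p G \<xi> "\<lambda>n. hpol p G \<nu> n \<xi>" R by (rule qp)
  interpret quenched_square p G \<xi> "\<lambda>n. hpol p G \<nu> n \<xi>" R R2
    by unfold_locales (rule h2; assumption)+
  have Y: "Y n = (\<lambda>w. NN \<nu> n (\<xi>, w))" for n using Y_eq_NN[OF qp] by (simp add: fun_eq_iff)
  show "integrable M (\<lambda>w. NN \<nu> n (\<xi>, w))" for n using Y_integrable[of n] by (simp add: Y)
  have \<nu>1: "1 \<le> \<nu>" using \<nu> by auto
  have R2_le: "R2 n \<le> 117 * C * real (Suc n) powr (2 * real \<nu> + \<epsilon>)" for n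
  proof -
    have "R2 n \<le> 117 * real (Suc n) ^ (2 * \<nu> - 1) * (C * real (Suc n) powr (1 + \<epsilon>))"
      unfolding R2_def by (intro mult_mono S(1) sum_nonneg cabs_moment_nonneg power_mono) auto
    also have "real (Suc n) ^ (2 * \<nu> - 1) = real (Suc n) powr (2 * real \<nu> - 1)"
      using \<nu>1 by (simp add: powr_realpow[symmetric] of_nat_diff)
    also have "117 * real (Suc n) powr (2 * real \<nu> - 1) * (C * real (Suc n) powr (1 + \<epsilon>))
      = 117 * C * (real (Suc n) powr (2 * real \<nu> - 1) * real (Suc n) powr (1 + \<epsilon>))" by simp
    also have "real (Suc n) powr (2 * real \<nu> - 1) * real (Suc n) powr (1 + \<epsilon>) = real (Suc n) powr (2 * real \<nu> + \<epsilon>)"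
      by (simp add: powr_add[symmetric])
    finally show ?thesis .
  qed
  have m\<mu>: "m n = \<mu> (\<xi> n)" for n by (rule mean_offspring_\<mu>[OF \<xi>])
  have pos: "0 < \<mu> (\<xi> n)" for n using good by simp
  show "summable (\<lambda>n. real (Suc n) powr (lam - real \<nu> - \<epsilon>) * d n)"
  proof (rule summable_rate[where q="\<lambda>n. tail \<gamma> n (\<xi> n)" and bm="\<lambda>n. real (cutoff \<gamma> n (\<xi> n)) / \<mu> (\<xi> n)" and PP="\<lambda>n. PI n"
        and C="117 * C" and \<kappa>=\<kappa>])
    show "0 \<le> tail \<gamma> n (\<xi> n)" for n
      unfolding tail_def using pos[of n] by (intro Bochner_Integration.integral_nonneg) (auto simp: less_imp_le)
    show "real (cutoff \<gamma> n (\<xi> n)) / \<mu> (\<xi> n) \<le> exp (\<gamma> * real n)" for n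
    proof -
      have "real (cutoff \<gamma> n (\<xi> n)) \<le> exp (\<gamma> * real n) * \<mu> (\<xi> n)"
        unfolding cutoff_def using pos[of n] by (intro of_nat_floor) simp
      then show ?thesis using pos[of n] by (simp add: pos_divide_le_eq)
    qed
    show "d n \<le> tail \<gamma> n (\<xi> n) * (sqrt (R2 (Suc n)) + sqrt (R2 n))
       + sqrt (2 * (real (cutoff \<gamma> n (\<xi> n)) / \<mu> (\<xi> n) * R2 (Suc n) + R2 n) / PI n)" for n
      using increment_bound[of n "cutoff \<gamma> n (\<xi> n)"] unfolding d_def Y tail_def R_def m\<mu> .
    show "0 \<le> d n" for n unfolding d_def by (rule Bochner_Integration.integral_nonneg) simp
  qed (use R2_nonneg R2_le S(2) P \<epsilon> \<nu>1 q in auto)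
qed

text \<open>Quenched summability of the mean increments against the weight makes the weighted series
  of increments finite almost surely; from there on the argument is deterministic for each
  realization.\<close>

theorem NN_rate:
  assumes sup: "supercritical \<tau> p G" and \<nu>: "\<nu> \<in> {1, 2, 3}" and lam: "real \<nu> < lam" and \<eta>: "2 * real \<nu> < \<eta>"
    and off: "offspring_moment \<tau> p G lam" and lnm: "ln_minus_moment \<tau> p G lam" and d: "displ_moment \<tau> p G \<eta>"
  shows "\<exists>V. V \<in> borel_measurable AL \<and>
    (AE \<omega> in AL. \<forall>\<delta>>0. (\<lambda>n. NN \<nu> n \<omega> - V \<omega>) \<in> o(\<lambda>n. real n powr (- lam + real \<nu> + \<delta>)))"
proof -
  have \<nu>1: "1 \<le> \<nu>" using \<nu> by auto
  have lam1: "1 \<le> lam" and lam0: "0 \<le> lam" using lam \<nu>1 by linarith+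
  have Q: "real (2 * \<nu>) \<le> \<eta>" using \<eta> by simp
  obtain \<gamma> where \<gamma>: "0 < \<gamma>"
    "AE \<xi> in E. (\<forall>n. 0 < \<mu> (\<xi> n)) \<longrightarrow> (\<exists>\<kappa>>0. \<forall>n. \<kappa> * exp (2 * \<gamma> * real n) \<le> Pi_norm p G n \<xi>)"
    using Pi_norm_lower_bound[OF sup lnm lam1] by auto
  define a where "a = lam - real \<nu>"
  let ?F = "\<lambda>j n \<omega>. real (Suc n) powr (a - 1 / real (Suc j)) * \<bar>NN \<nu> (Suc n) \<omega> - NN \<nu> n \<omega>\<bar>"
  have Fm: "?F j n \<in> borel_measurable (E \<Otimes>\<^sub>M PS)" for j n
    using NN_meas' by measurable
  \<comment> \<open>The good event is described by countably many series of increments, without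
    reference to a limit. It is thus measurable and can be passed from the quenched laws to the
    annealed law.\<close>
  define P where "P \<omega> = (\<forall>j. (\<Sum>n. ennreal (?F j n \<omega>)) < \<infinity>)" for \<omega>
  have Pm: "Measurable.pred (E \<Otimes>\<^sub>M PS) P"
    unfolding P_def using Fm by measurable
  \<comment> \<open>The same 1 / (j + 1) serves as the excess \<epsilon> in the growth of the
    moments and as the loss in the weight.\<close>
  have A: "AE \<xi> in E. \<forall>j. \<exists>C>0. \<forall>n. (\<Sum>k<n. cabs_moment G (2 * \<nu>) (\<xi> k)) \<le> C * real (Suc n) powr (1 + 1 / real (Suc j))"
    unfolding AE_all_countable using \<nu>1 by (intro allI AE_moment_sum_bound[OF d Q]) auto
  have "AE \<xi> in E. AE w in quenched_law p G \<xi>. P (\<xi>, w)"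
    using AE_good[OF sup d Q] AE_tail_summable[OF sup off lnm \<gamma>(1) lam0] \<gamma>(2) A AE_space
  proof eventually_elim
    case (elim \<xi>)
    then have \<xi>: "\<xi> \<in> space E" and g: "\<And>n. integrable (measure_pmf (p (\<xi> n))) real \<and> 0 < \<mu> (\<xi> n)"
      and i: "\<And>n. integrable (G (\<xi> n)) (\<lambda>y. \<bar>y\<bar> ^ (2 * \<nu>))"
      and t: "summable (\<lambda>n. real (Suc n) powr lam * tail \<gamma> n (\<xi> n))"
      using lam1 by auto
    obtain \<kappa> where \<kappa>: "0 < \<kappa>" "\<And>n. \<kappa> * exp (2 * \<gamma> * real n) \<le> Pi_norm p G n \<xi>" using elim g by auto
    interpret q: prob_space "quenched_law p G \<xi>" by (rule prob_quenched[OF \<xi>])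
    have "AE w in quenched_law p G \<xi>. (\<Sum>n. ennreal (?F j n (\<xi>, w))) < \<infinity>" for j
    proof -
      obtain C where C: "0 < C" "\<And>n. (\<Sum>k<n. cabs_moment G (2 * \<nu>) (\<xi> k)) \<le> C * real (Suc n) powr (1 + 1 / real (Suc j))"
        using elim(4) by blast
      note inc = quenched_increments_summable[OF \<xi> g \<nu> i t C(2) C(1) \<kappa>(2) \<kappa>(1) \<gamma>(1)]
      have e: "0 < 1 / real (Suc j)" by simp
      have sm: "\<And>n. (\<lambda>w. ennreal (?F j n (\<xi>, w))) \<in> borel_measurable (quenched_law p G \<xi>)"
        by (rule measurable_compose[OF section_meas[OF Fm \<xi>] measurable_ennreal])
      have Fi: "integrable (quenched_law p G \<xi>) (\<lambda>w. ?F j n (\<xi>, w))" for n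
        using inc(2)[OF e] by (intro integrable_mult_right integrable_abs Bochner_Integration.integrable_diff)
      have "(\<integral>\<^sup>+w. (\<Sum>n. ennreal (?F j n (\<xi>, w))) \<partial>quenched_law p G \<xi>) = (\<Sum>n. \<integral>\<^sup>+w. ennreal (?F j n (\<xi>, w)) \<partial>quenched_law p G \<xi>)"
        by (rule nn_integral_suminf) (rule sm)
      also have "\<dots> = (\<Sum>n. ennreal (real (Suc n) powr (a - 1 / real (Suc j)) * (\<integral>w. \<bar>NN \<nu> (Suc n) (\<xi>, w) - NN \<nu> n (\<xi>, w)\<bar> \<partial>quenched_law p G \<xi>)))"
      proof (intro suminf_cong)
        fix n
        have "(\<integral>\<^sup>+w. ennreal (?F j n (\<xi>, w)) \<partial>quenched_law p G \<xi>) = ennreal (\<integral>w. ?F j n (\<xi>, w) \<partial>quenched_law p G \<xi>)"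
          by (rule nn_integral_eq_integral[OF Fi]) simp
        then show "(\<integral>\<^sup>+w. ennreal (?F j n (\<xi>, w)) \<partial>quenched_law p G \<xi>)
          = ennreal (real (Suc n) powr (a - 1 / real (Suc j)) * (\<integral>w. \<bar>NN \<nu> (Suc n) (\<xi>, w) - NN \<nu> n (\<xi>, w)\<bar> \<partial>quenched_law p G \<xi>))"
          by simp
      qed
      also have "\<dots> \<noteq> \<infinity>"
        using inc(1)[OF e] unfolding a_def by (subst suminf_ennreal2) auto
      finally have "AE w in quenched_law p G \<xi>. (\<Sum>n. ennreal (?F j n (\<xi>, w))) \<noteq> \<infinity>"
        by (intro nn_integral_PInf_AE borel_measurable_suminf_order[OF sm])
      then show ?thesis by (simp add: less_top[symmetric])
    qed
    then show "AE w in quenched_law p G \<xi>. P (\<xi>, w)"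
      unfolding P_def AE_all_countable by blast
  qed
  from AE_annealedI[OF Pm this] have AEP: "AE \<omega> in AL. P \<omega>" .
  \<comment> \<open>\<open>lim\<close> is total, so \<open>V\<close> is measurable on the whole
    space and equals the limit on the almost sure event where it exists.\<close>
  define V where "V \<omega> = lim (\<lambda>n. NN \<nu> n \<omega>)" for \<omega>
  have Vm: "V \<in> borel_measurable AL"
    unfolding V_def[abs_def] by (rule borel_measurable_lim_metric) (rule NN_meas)
  have "AE \<omega> in AL. \<forall>\<delta>>0. (\<lambda>n. NN \<nu> n \<omega> - V \<omega>) \<in> o(\<lambda>n. real n powr (- lam + real \<nu> + \<delta>))"
    using AEP
  proof (rule AE_mp, intro AE_I2 impI)
    fix \<omega> assume "P \<omega>"
    then have "summable (\<lambda>n. ?F j n \<omega>)" for j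
      unfolding P_def by (intro summable_of_suminf_ennreal) auto
    moreover have "0 < a" using lam by (simp add: a_def)
    ultimately obtain V' where V': "(\<lambda>n. NN \<nu> n \<omega>) \<longlonglongrightarrow> V'"
      "\<And>\<delta>. 0 < \<delta> \<Longrightarrow> (\<lambda>n. NN \<nu> n \<omega> - V') \<in> o(\<lambda>n. real n powr (- a + \<delta>))"
      using weighted_summable_tail[of a "\<lambda>n. NN \<nu> n \<omega>"] by blast
    have "V \<omega> = V'" unfolding V_def by (rule limI[OF V'(1)])
    then show "\<forall>\<delta>>0. (\<lambda>n. NN \<nu> n \<omega> - V \<omega>) \<in> o(\<lambda>n. real n powr (- lam + real \<nu> + \<delta>))"
      using V'(2) by (simp add: a_def algebra_simps)
  qed
  with Vm show ?thesis by blast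
qed

end

text \<open>The predicate \<open>martingale\<close> contains integrability, which the displacement
  moment of order \<nu> secures. In the rates the quantifier over \<delta> stands inside
  \<open>AE\<close>: one limit and one null set serve all \<delta>.\<close>

theorem theorem2p1:
  fixes \<tau> :: "'e measure" and p :: "'e \<Rightarrow> nat pmf" and G :: "'e \<Rightarrow> real measure"
    and lam0 :: real
  assumes "random_environment \<tau> p G"
    and "supercritical \<tau> p G"
    and "lam0 > 0" and "offspring_moment \<tau> p G lam0"
  shows
    "((displ_moment \<tau> p G 1 \<longrightarrow> martingale (annealed_law \<tau> p G) (filtr \<tau> p G) (N1 p G)) \<and>
      (displ_moment \<tau> p G 2 \<longrightarrow> martingale (annealed_law \<tau> p G) (filtr \<tau> p G) (N2 p G)) \<and>
      (displ_moment \<tau> p G 3 \<longrightarrow> martingale (annealed_law \<tau> p G) (filtr \<tau> p G) (N3 p G))) \<and>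
     (\<forall>lam>1. \<forall>\<eta>>2.
        offspring_moment \<tau> p G lam \<longrightarrow> ln_minus_moment \<tau> p G lam \<longrightarrow> displ_moment \<tau> p G \<eta> \<longrightarrow>
        (\<exists>V1. V1 \<in> borel_measurable (annealed_law \<tau> p G) \<and>
           (AE \<omega> in annealed_law \<tau> p G. \<forall>\<delta>>0.
              (\<lambda>n. N1 p G n \<omega> - V1 \<omega>) \<in> o(\<lambda>n. real n powr (- lam + 1 + \<delta>))))) \<and>
     (\<forall>lam>2. \<forall>\<eta>>4.
        offspring_moment \<tau> p G lam \<longrightarrow> ln_minus_moment \<tau> p G lam \<longrightarrow> displ_moment \<tau> p G \<eta> \<longrightarrow>
        (\<exists>V2. V2 \<in> borel_measurable (annealed_law \<tau> p G) \<and>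
           (AE \<omega> in annealed_law \<tau> p G. \<forall>\<delta>>0.
              (\<lambda>n. N2 p G n \<omega> - V2 \<omega>) \<in> o(\<lambda>n. real n powr (- lam + 2 + \<delta>))))) \<and>
     (\<forall>lam>3. \<forall>\<eta>>6.
        offspring_moment \<tau> p G lam \<longrightarrow> ln_minus_moment \<tau> p G lam \<longrightarrow> displ_moment \<tau> p G \<eta> \<longrightarrow>
        (\<exists>V3. V3 \<in> borel_measurable (annealed_law \<tau> p G) \<and>
           (AE \<omega> in annealed_law \<tau> p G. \<forall>\<delta>>0.
              (\<lambda>n. N3 p G n \<omega> - V3 \<omega>) \<in> o(\<lambda>n. real n powr (- lam + 3 + \<delta>)))))"
proof -
  interpret brw \<tau> p G by unfold_locales fact
  note mart = NN_martingale[OF assms(2)] and rate = NN_rate[OF assms(2)]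
  show ?thesis
    unfolding N_eq_NN
    using mart[of 1] mart[of 2] mart[of 3] rate[of 1] rate[of 2] rate[of 3]
    by (intro conjI allI impI) auto
qed

end
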